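(* Let $\Omega\subset\mathbb{C}^n$ be a domain with $C^1$ boundary such that its closure $\overline{\Omega}$ is polynomially convex (respectively, rationally convex). Then $\Omega$ is isotopic, by an arbitrarily small ambient $C^1$ isotopy of $\mathbb{C}^n$, to a smoothly bounded strictly pseudoconvex domain $\Omega'\subset\Omega$ whose closure is polynomially convex (respectively, rationally convex).
   Context: A domain is a connected open subset; "smooth" means $C^\infty$. A domain has $C^1$ boundary if near each of its boundary points it is of the form $\{\rho<0\}$ for a $C^1$ real function $\rho$ with $d\rho\neq0$. For a compact set $K\subset\mathbb{C}^n$, its polynomially convex hull is $\widehat{K}=\{z\in\mathbb{C}^n : |P(z)|\le\max_K|P| \text{ for all } P\in\mathbb{C}[z_1,\dots,z_n]\}$, and its rationally convex hull is $\mathscr{R}\text{-hull}(K)=\{z\in\mathbb{C}^n : |R(z)|\le\max_K|R| \text{ for all } R\in\mathbb{C}(z_1,\dots,z_n) \text{ regular on } K\}$. $K$ is polynomially (resp. rationally) convex if it is compact and equal to its polynomially (resp. rationally) convex hull; in particular $\overline{\Omega}$ is compact here. $\Omega$ is isotopic to $\Omega'$ by an ambient $C^1$ isotopy if there is a continuous family $h_s$, $s\in[0,1]$, of $C^1$ diffeomorphisms of $\mathbb{C}^n$ with $h_0=\mathrm{id}$ and $h_1(\Omega)=\Omega'$. "Arbitrarily small" means that for every $\varepsilon>0$ the domain $\Omega'$ and the isotopy can be chosen so that $|h_s(z)-z|<\varepsilon$ for all $z\in\mathbb{C}^n$ and $s\in[0,1]$. *)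

theory Defs
  imports "HOL-Analysis.Analysis" "HOL-Library.Poly_Mapping"
begin

text \<open>
  Complex \<open>n\<close>-space is \<open>complex ^ 'n\<close> with its Euclidean norm; as a real normed space it is
  \<open>\<real>\<^sup>2\<^sup>n\<close>, and differentiability below is always real differentiability.
\<close>

section \<open>Functions of class \<open>C\<^sup>k\<close> and \<open>C\<^sup>\<infinity>\<close>\<close>

text \<open>
  To be used on open sets \<open>U\<close>. As the source is finite-dimensional, continuity of
  \<open>x \<mapsto> f' x v\<close> for every direction \<open>v\<close> is the same as continuity of \<open>x \<mapsto> f' x\<close>
  in the operator norm.
\<close>

primrec Ck_on :: "nat \<Rightarrow> ('a::euclidean_space \<Rightarrow> 'b::real_normed_vector) \<Rightarrow> 'a set \<Rightarrow> bool" where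
  "Ck_on 0 f U \<longleftrightarrow> continuous_on U f"
| "Ck_on (Suc k) f U \<longleftrightarrow>
     (\<exists>f'. (\<forall>x\<in>U. (f has_derivative f' x) (at x)) \<and> (\<forall>v. Ck_on k (\<lambda>x. f' x v) U))"

definition C_on :: "enat \<Rightarrow> ('a::euclidean_space \<Rightarrow> 'b::real_normed_vector) \<Rightarrow> 'a set \<Rightarrow> bool" where
  "C_on r f U \<longleftrightarrow> (\<forall>k. enat k \<le> r \<longrightarrow> Ck_on k f U)"

section \<open>Domains and their boundaries\<close>

definition domain :: "'a::topological_space set \<Rightarrow> bool" where
  "domain \<Omega> \<longleftrightarrow> open \<Omega> \<and> connected \<Omega>"

definition local_defining_function ::
    "enat \<Rightarrow> 'a::euclidean_space set \<Rightarrow> 'a \<Rightarrow> 'a set \<Rightarrow> ('a \<Rightarrow> real) \<Rightarrow> bool" where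
  "local_defining_function r \<Omega> p U \<rho> \<longleftrightarrow>
     open U \<and> p \<in> U \<and> C_on r \<rho> U \<and>
     (\<forall>z\<in>U. frechet_derivative \<rho> (at z) \<noteq> (\<lambda>v. 0)) \<and>
     \<Omega> \<inter> U = {z\<in>U. \<rho> z < 0}"

definition has_C_boundary :: "enat \<Rightarrow> 'a::euclidean_space set \<Rightarrow> bool" where
  "has_C_boundary r \<Omega> \<longleftrightarrow> (\<forall>p\<in>frontier \<Omega>. \<exists>U \<rho>. local_defining_function r \<Omega> p U \<rho>)"

definition smoothly_bounded :: "'a::euclidean_space set \<Rightarrow> bool" where
  "smoothly_bounded \<Omega> \<longleftrightarrow> bounded \<Omega> \<and> has_C_boundary \<infinity> \<Omega>"

section \<open>Strict pseudoconvexity\<close>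

text \<open>
  The Wirtinger derivatives \<open>\<partial>/\<partial>z\<^sub>j = (\<partial>/\<partial>x\<^sub>j - i \<partial>/\<partial>y\<^sub>j) / 2\<close> and
  \<open>\<partial>/\<partial>\<bar>z\<^sub>j = (\<partial>/\<partial>x\<^sub>j + i \<partial>/\<partial>y\<^sub>j) / 2\<close>.
\<close>

definition wirtinger :: "'n \<Rightarrow> (complex ^ 'n \<Rightarrow> complex) \<Rightarrow> complex ^ 'n::finite \<Rightarrow> complex" where
  "wirtinger j f z =
     (frechet_derivative f (at z) (axis j 1) - \<i> * frechet_derivative f (at z) (axis j \<i>)) / 2"

definition wirtinger_bar :: "'n \<Rightarrow> (complex ^ 'n \<Rightarrow> complex) \<Rightarrow> complex ^ 'n::finite \<Rightarrow> complex" where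
  "wirtinger_bar j f z =
     (frechet_derivative f (at z) (axis j 1) + \<i> * frechet_derivative f (at z) (axis j \<i>)) / 2"

text \<open>For real-valued \<open>\<rho>\<close> of class \<open>C\<^sup>2\<close> this Hermitian form takes real values.\<close>

definition levi_form :: "(complex ^ 'n::finite \<Rightarrow> real) \<Rightarrow> complex ^ 'n \<Rightarrow> complex ^ 'n \<Rightarrow> complex" where
  "levi_form \<rho> p v =
     (\<Sum>j\<in>UNIV. \<Sum>k\<in>UNIV.
        wirtinger j (wirtinger_bar k (\<lambda>z. complex_of_real (\<rho> z))) p * (v $ j) * cnj (v $ k))"

definition complex_tangent :: "(complex ^ 'n::finite \<Rightarrow> real) \<Rightarrow> complex ^ 'n \<Rightarrow> (complex ^ 'n) set" where
  "complex_tangent \<rho> p =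
     {v. (\<Sum>j\<in>UNIV. wirtinger j (\<lambda>z. complex_of_real (\<rho> z)) p * (v $ j)) = 0}"

text \<open>
  The condition at \<open>p\<close> does not depend on the local defining function.
\<close>

definition strictly_pseudoconvex :: "(complex ^ 'n::finite) set \<Rightarrow> bool" where
  "strictly_pseudoconvex \<Omega> \<longleftrightarrow>
     (\<forall>p\<in>frontier \<Omega>. \<exists>U \<rho>. local_defining_function \<infinity> \<Omega> p U \<rho> \<and>
        (\<forall>v\<in>complex_tangent \<rho> p. v \<noteq> 0 \<longrightarrow> Re (levi_form \<rho> p v) > 0))"

section \<open>Polynomial and rational convexity\<close>

text \<open>
  A polynomial in \<open>\<complex>[z\<^sub>1,\<dots>,z\<^sub>n]\<close> is a finitely supported family of coefficients indexed by
  exponent vectors.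
\<close>

type_synonym 'n cpoly = "('n \<Rightarrow>\<^sub>0 nat) \<Rightarrow>\<^sub>0 complex"

definition cpoly_eval :: "'n::finite cpoly \<Rightarrow> complex ^ 'n \<Rightarrow> complex" where
  "cpoly_eval P z =
     (\<Sum>m\<in>Poly_Mapping.keys P.
        Poly_Mapping.lookup P m * (\<Prod>i\<in>UNIV. (z $ i) ^ Poly_Mapping.lookup m i))"

text \<open>
  The hulls are meant for compact \<open>K\<close>, where the supremum is a maximum if \<open>K\<close> is nonempty.
  For \<open>K = {}\<close> the real supremum is an unspecified number, but since large constants violate
  the bound the hull is empty.
\<close>

definition polynomial_hull :: "(complex ^ 'n::finite) set \<Rightarrow> (complex ^ 'n) set" where
  "polynomial_hull K = {z. \<forall>P. norm (cpoly_eval P z) \<le> (SUP w\<in>K. norm (cpoly_eval P w))}"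

text \<open>
  A rational function regular on \<open>K\<close> is a quotient \<open>P/Q\<close> with \<open>Q\<close> zero-free on \<open>K\<close> (take it in
  lowest terms). A pole at \<open>z\<close> counts as \<open>\<bar>R(z)\<bar> = \<infinity>\<close>; if \<open>Q\<close> vanishes at \<open>z\<close> but not on \<open>K\<close>,
  then \<open>1/Q\<close> has such a pole, so \<open>z\<close> is not in the hull.
\<close>

definition rational_hull :: "(complex ^ 'n::finite) set \<Rightarrow> (complex ^ 'n) set" where
  "rational_hull K =
     {z. \<forall>P Q. (\<forall>w\<in>K. cpoly_eval Q w \<noteq> 0) \<longrightarrow>
           cpoly_eval Q z \<noteq> 0 \<and>
           norm (cpoly_eval P z / cpoly_eval Q z)
             \<le> (SUP w\<in>K. norm (cpoly_eval P w / cpoly_eval Q w))}"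

definition polynomially_convex :: "(complex ^ 'n::finite) set \<Rightarrow> bool" where
  "polynomially_convex K \<longleftrightarrow> compact K \<and> polynomial_hull K = K"

definition rationally_convex :: "(complex ^ 'n::finite) set \<Rightarrow> bool" where
  "rationally_convex K \<longleftrightarrow> compact K \<and> rational_hull K = K"

section \<open>Ambient \<open>C\<^sup>1\<close> isotopies\<close>

definition C1_diffeomorphism :: "('a::euclidean_space \<Rightarrow> 'a) \<Rightarrow> bool" where
  "C1_diffeomorphism h \<longleftrightarrow> bij h \<and> C_on 1 h UNIV \<and> C_on 1 (inv h) UNIV"

text \<open>
  The family \<open>s \<mapsto> h s\<close> is continuous into the \<open>C\<^sup>1\<close> diffeomorphisms with the
  \<open>C\<^sup>1\<close> compact-open topology, i.e. \<open>h s z\<close> and its \<open>z\<close>-derivative are jointly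
  continuous in \<open>(s, z)\<close>.
\<close>

definition ambient_C1_isotopy ::
    "(real \<Rightarrow> 'a::euclidean_space \<Rightarrow> 'a) \<Rightarrow> 'a set \<Rightarrow> 'a set \<Rightarrow> bool" where
  "ambient_C1_isotopy h \<Omega> \<Omega>' \<longleftrightarrow>
     (\<forall>s\<in>{0..1}. C1_diffeomorphism (h s)) \<and>
     continuous_on ({0..1} \<times> UNIV) (\<lambda>(s, z). h s z) \<and>
     (\<forall>v. continuous_on ({0..1} \<times> UNIV) (\<lambda>(s, z). frechet_derivative (h s) (at z) v)) \<and>
     h 0 = id \<and> h 1 ` \<Omega> = \<Omega>'"

end

(*
  If K is the closure of Omega, the cores {z. cball z eta \<subseteq> K} are intersections of translates
  of K and so inherit its convexity. Convexity of a core separates it from the points near the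
  boundary, so raising to high powers gives a finite family of polynomials or rational functions
  f_j for which phi = sum |f_j|^2 is tiny deep inside K and huge in a thin shell along the boundary.
  Average phi against the C^1 kernel G(a) = max(0, eta^2 - |a|^2)^2: in the gradient of
  F(z) = integral phi(z + a) G(a) da the derivative can be moved to G, and if F(z) = 1 only those a
  matter for which z + a is close to the boundary, that is a close to eta times the unit normal.
  Hence the level set {F = 1} is C^1-close to the boundary, and {F < 1} is the image of Omega under
  a small isotopy z + s g(z), where g comes from solving F(z + T(z) V(z)) = 1 along a polynomial
  vector field V transverse to the boundary.
  Replacing the integral by a Riemann sum keeps all this and makes F a finite sum of squares
  sum |f_l|^2 of polynomials or rational functions: it is smooth, its Levi form sum |df_l(v)|^2 is
  positive definite, and the polarisations w \<mapsto> sum cnj (f_l z) f_l w show that {F \<le> 1} is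
  convex in the required sense.
*)
theory Submission
  imports Defs "HOL-Complex_Analysis.Cauchy_Integral_Formula"
begin

section \<open>Gradients and bump functions\<close>

text \<open>The boundary is only C^1, and the function that bounds the new domain has to be built
  from polynomials or from functions regular on K. Mollifying a defining function would give
  smoothness but no convexity. The separating sum phi has the right form, but nothing is known about
  its gradient. Averaging helps because after the integration by parts only the size of phi enters,
  and two bounds suffice: small deep inside, large in the shell. How fast phi grows remains out of
  control, so gradients are compared only up to a positive factor, in the shape
  \<open>norm (G x - c *\<^sub>R N x) \<le> \<alpha> * c\<close>; this factor cancels in the
  implicit derivative of T. The order of choices matters: the isotopy lemma takes its tolerances
  from \<open>\<rho>\<close> and the allowed displacement, the averaging lemma then fixes the
  radius, the depth and the two bounds on phi, and only after that is the family of functions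
  chosen. In the rational case a separating function must have no poles on K, which rules out
  translating 1/f; a Taylor coefficient of 1/f takes its place.\<close>

text \<open>Class C^1 with the gradient as explicit data, because the estimates compare gradients of
  different functions as vectors. Nothing is claimed off \<open>U\<close>, so arbitrary values of
  \<open>f\<close> and \<open>N\<close> there do no harm.\<close>

definition has_gradient_on ::
    "('a::euclidean_space \<Rightarrow> real) \<Rightarrow> ('a \<Rightarrow> 'a) \<Rightarrow> 'a set \<Rightarrow> bool" where
  "has_gradient_on f N U \<longleftrightarrow>
     (\<forall>x\<in>U. (f has_derivative (\<lambda>v. N x \<bullet> v)) (at x)) \<and> continuous_on U N"

lemma has_gradient_onD:
  assumes "has_gradient_on f N U" "x \<in> U"
  shows "(f has_derivative (\<lambda>v. N x \<bullet> v)) (at x)"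
  using assms by (auto simp: has_gradient_on_def)

lemma has_gradient_on_continuous:
  assumes "has_gradient_on f N U"
  shows "continuous_on U f" "continuous_on U N"
proof -
  show "continuous_on U f"
    using has_gradient_onD[OF assms] has_derivative_continuous
    by (intro continuous_at_imp_continuous_on ballI) blast
  show "continuous_on U N" using assms by (simp add: has_gradient_on_def)
qed

lemma has_gradient_on_subset:
  "has_gradient_on f N U \<Longrightarrow> V \<subseteq> U \<Longrightarrow> has_gradient_on f N V"
  by (auto simp: has_gradient_on_def intro: continuous_on_subset)

lemma has_gradient_on_mult:
  assumes "has_gradient_on f N U" "has_gradient_on g M U"
  shows "has_gradient_on (\<lambda>x. f x * g x) (\<lambda>x. f x *\<^sub>R M x + g x *\<^sub>R N x) U"
  unfolding has_gradient_on_def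
proof (intro conjI ballI)
  fix x assume x: "x \<in> U"
  show "((\<lambda>x. f x * g x) has_derivative (\<lambda>v. (f x *\<^sub>R M x + g x *\<^sub>R N x) \<bullet> v)) (at x)"
    by (rule has_derivative_eq_rhs[OF has_derivative_mult[OF has_gradient_onD[OF assms(1) x]
          has_gradient_onD[OF assms(2) x]]])
      (auto simp: inner_add_left inner_scaleR_left algebra_simps)
qed (auto intro!: continuous_intros has_gradient_on_continuous[OF assms(1)]
      has_gradient_on_continuous[OF assms(2)])

lemma has_gradient_on_sum:
  assumes "\<And>i. i \<in> I \<Longrightarrow> has_gradient_on (f i) (N i) U"
  shows "has_gradient_on (\<lambda>x. \<Sum>i\<in>I. f i x) (\<lambda>x. \<Sum>i\<in>I. N i x) U"
  unfolding has_gradient_on_def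
proof (intro conjI ballI)
  fix x assume x: "x \<in> U"
  show "((\<lambda>x. \<Sum>i\<in>I. f i x) has_derivative (\<lambda>v. (\<Sum>i\<in>I. N i x) \<bullet> v)) (at x)"
    unfolding inner_sum_left
    by (intro has_derivative_sum has_gradient_onD[OF assms] x)
qed (auto intro!: continuous_intros has_gradient_on_continuous[OF assms])

lemma has_gradient_on_add:
  assumes "has_gradient_on f N U" "has_gradient_on g M U"
  shows "has_gradient_on (\<lambda>x. f x + g x) (\<lambda>x. N x + M x) U"
  unfolding has_gradient_on_def
proof (intro conjI ballI)
  fix x assume x: "x \<in> U"
  show "((\<lambda>x. f x + g x) has_derivative (\<lambda>v. (N x + M x) \<bullet> v)) (at x)"
    unfolding inner_add_left
    by (rule has_derivative_add[OF has_gradient_onD[OF assms(1) x] has_gradient_onD[OF assms(2) x]])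
qed (intro continuous_on_add has_gradient_on_continuous(2)[OF assms(1)]
      has_gradient_on_continuous(2)[OF assms(2)])

lemma has_gradient_on_diff:
  assumes "has_gradient_on f N U" "has_gradient_on g M U"
  shows "has_gradient_on (\<lambda>x. f x - g x) (\<lambda>x. N x - M x) U"
  unfolding has_gradient_on_def
proof (intro conjI ballI)
  fix x assume x: "x \<in> U"
  show "((\<lambda>x. f x - g x) has_derivative (\<lambda>v. (N x - M x) \<bullet> v)) (at x)"
    unfolding inner_diff_left
    by (rule has_derivative_diff[OF has_gradient_onD[OF assms(1) x] has_gradient_onD[OF assms(2) x]])
qed (intro continuous_on_diff has_gradient_on_continuous(2)[OF assms(1)]
      has_gradient_on_continuous(2)[OF assms(2)])

lemma has_gradient_on_const: "has_gradient_on (\<lambda>x. c) (\<lambda>x. 0) U"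
  by (auto simp: has_gradient_on_def)

lemma has_gradient_on_cmult:
  assumes "has_gradient_on f N U"
  shows "has_gradient_on (\<lambda>x. c * f x) (\<lambda>x. c *\<^sub>R N x) U"
  using has_gradient_on_mult[OF has_gradient_on_const[of c] assms] by simp

lemma has_gradient_on_compose_real:
  assumes "has_gradient_on f N U"
    and k: "\<And>y. (k has_real_derivative k' y) (at y)" and ck: "continuous_on UNIV k'"
  shows "has_gradient_on (\<lambda>x. k (f x)) (\<lambda>x. k' (f x) *\<^sub>R N x) U"
  unfolding has_gradient_on_def
proof (intro conjI ballI)
  fix x assume x: "x \<in> U"
  have "(k has_derivative (\<lambda>h. k' (f x) * h)) (at (f x))"
    using k[of "f x"] by (simp add: has_field_derivative_def)
  from has_derivative_compose[OF has_gradient_onD[OF assms(1) x] this]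
  show "((\<lambda>x. k (f x)) has_derivative (\<lambda>v. (k' (f x) *\<^sub>R N x) \<bullet> v)) (at x)"
    by simp
qed (auto intro!: continuous_intros has_gradient_on_continuous[OF assms(1)]
      continuous_on_compose2[OF ck])

lemma has_gradient_on_shift:
  assumes "has_gradient_on f N U"
  shows "has_gradient_on (\<lambda>x. f (x + a)) (\<lambda>x. N (x + a)) {x. x + a \<in> U}"
  unfolding has_gradient_on_def
proof (intro conjI ballI)
  fix x assume "x \<in> {x. x + a \<in> U}"
  then have "(f has_derivative (\<lambda>v. N (x + a) \<bullet> v)) (at (x + a))"
    using has_gradient_onD[OF assms] by auto
  then show "((\<lambda>x. f (x + a)) has_derivative (\<lambda>v. N (x + a) \<bullet> v)) (at x)"
    by (rule has_derivative_compose[rotated]) (auto intro!: derivative_eq_intros)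
qed (rule continuous_on_compose2[OF has_gradient_on_continuous(2)[OF assms]],
    auto intro!: continuous_intros)

lemma has_derivative_imp_gradient:
  fixes f :: "'a::euclidean_space \<Rightarrow> real"
  assumes "(f has_derivative D) (at x)"
  shows "D = (\<lambda>v. (\<Sum>b\<in>Basis. D b *\<^sub>R b) \<bullet> v)"
proof
  fix v
  interpret linear D using assms has_derivative_linear by blast
  have "D v = D (\<Sum>b\<in>Basis. (v \<bullet> b) *\<^sub>R b)" by (simp add: euclidean_representation)
  also have "\<dots> = (\<Sum>b\<in>Basis. (v \<bullet> b) * D b)" by (simp add: sum scale)
  finally show "D v = (\<Sum>b\<in>Basis. D b *\<^sub>R b) \<bullet> v"
    by (simp add: inner_sum_left inner_commute[of v] mult.commute)
qed

lemma C_on_1_imp_gradient: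
  fixes f :: "'a::euclidean_space \<Rightarrow> real"
  assumes "Ck_on 1 f U"
  obtains N where "has_gradient_on f N U"
proof -
  from assms obtain D where D: "\<forall>x\<in>U. (f has_derivative D x) (at x)"
    "\<forall>v. continuous_on U (\<lambda>x. D x v)" by auto
  have "has_gradient_on f (\<lambda>x. \<Sum>b\<in>Basis. D x b *\<^sub>R b) U"
    unfolding has_gradient_on_def
  proof (intro conjI ballI)
    fix x assume "x \<in> U"
    then show "(f has_derivative (\<lambda>v. (\<Sum>b\<in>Basis. D x b *\<^sub>R b) \<bullet> v)) (at x)"
      using D(1) has_derivative_imp_gradient by metis
  qed (use D(2) in \<open>auto intro!: continuous_intros\<close>)
  then show ?thesis using that by blast
qed

text \<open>\<open>U\<close> and \<open>- S\<close> are open and cover the space: on the first this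
  is the product rule, on the second product and gradient are identically 0. Values of
  \<open>f\<close> and \<open>N\<close> beyond \<open>U\<close> only ever meet the factor 0.\<close>

lemma has_gradient_on_cutoff:
  assumes f: "has_gradient_on f N U" and b: "has_gradient_on b M UNIV"
    and "open U" "closed S" "S \<subseteq> U" and out: "\<And>x. x \<notin> S \<Longrightarrow> b x = 0 \<and> M x = 0"
  shows "has_gradient_on (\<lambda>x. b x * f x) (\<lambda>x. b x *\<^sub>R N x + f x *\<^sub>R M x) UNIV"
proof -
  let ?G = "\<lambda>x. b x *\<^sub>R N x + f x *\<^sub>R M x"
  have U: "has_gradient_on (\<lambda>x. b x * f x) ?G U"
    by (rule has_gradient_on_mult[OF has_gradient_on_subset[OF b] f]) auto
  have der: "((\<lambda>x. b x * f x) has_derivative (\<lambda>v. ?G x \<bullet> v)) (at x)" if "x \<notin> S" for x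
  proof -
    have "((\<lambda>x. 0) has_derivative (\<lambda>v. ?G x \<bullet> v)) (at x)"
      using out[OF that] by simp
    then show ?thesis
      by (rule has_derivative_transform_within_open[of _ _ _ _ "-S"])
        (use that out \<open>closed S\<close> in auto)
  qed
  have "continuous_on (-S) ?G"
    by (rule continuous_on_eq[OF continuous_on_const[of _ 0]]) (use out in auto)
  then have "continuous_on (U \<union> -S) ?G"
    using U \<open>open U\<close> \<open>closed S\<close> has_gradient_on_continuous(2)
    by (intro continuous_on_open_Un) auto
  moreover have "U \<union> -S = UNIV" using \<open>S \<subseteq> U\<close> by auto
  ultimately show ?thesis
    using der has_gradient_onD[OF U] \<open>S \<subseteq> U\<close> unfolding has_gradient_on_def by auto
qed

section \<open>Cutoff functions of class C^1\<close>

lemma has_real_derivative_max_power2: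
  "((\<lambda>x::real. (max 0 x)\<^sup>2) has_real_derivative 2 * max 0 x) (at x)"
proof (cases "x = 0")
  case True
  have "((\<lambda>x::real. (max 0 x)\<^sup>2) has_real_derivative 0) (at 0)"
    unfolding has_field_derivative_iff
  proof (rule Lim_null_comparison)
    show "\<forall>\<^sub>F y in at (0::real). norm (((max 0 y)\<^sup>2 - (max 0 0)\<^sup>2) / (y - 0)) \<le> \<bar>y\<bar>"
      by (intro always_eventually allI)
         (auto simp: max_def power2_eq_square abs_mult divide_simps)
    show "((\<lambda>y::real. \<bar>y\<bar>) \<longlongrightarrow> 0) (at 0)"
      by (rule tendsto_eq_intros refl | simp)+
  qed
  then show ?thesis using True by simp
next
  case False
  show ?thesis
  proof (cases "x > 0")
    case True
    have "((\<lambda>x. x\<^sup>2) has_real_derivative 2 * max 0 x) (at x)"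
      using True by (auto intro!: derivative_eq_intros)
    then show ?thesis
      by (rule has_field_derivative_transform_within_open[of _ _ _ "{0<..}"]) (use True in auto)
  next
    case F: False
    have "((\<lambda>x. 0) has_real_derivative 2 * max 0 x) (at x)"
      using F by auto
    then show ?thesis
      by (rule has_field_derivative_transform_within_open[of _ _ _ "{..<0}"]) (use F False in auto)
  qed
qed

lemma has_gradient_on_max_power2:
  assumes "has_gradient_on f N U"
  shows "has_gradient_on (\<lambda>x. (max 0 (f x))\<^sup>2) (\<lambda>x. (2 * max 0 (f x)) *\<^sub>R N x) U"
  by (rule has_gradient_on_compose_real[OF assms has_real_derivative_max_power2])
     (auto intro!: continuous_intros)

lemma has_gradient_on_norm_power2:
  fixes p :: "'a::euclidean_space"
  shows "has_gradient_on (\<lambda>x. c - (norm (x - p))\<^sup>2) (\<lambda>x. (-2) *\<^sub>R (x - p)) U"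
  unfolding has_gradient_on_def power2_norm_eq_inner
  by (auto intro!: derivative_eq_intros continuous_intros simp: inner_commute algebra_simps)

text \<open>It serves both as weight for gluing local defining functions and, with centre 0 and
  radius \<eta>, as the averaging kernel. Being the square of a positive part it is C^1, and its
  gradient still carries that positive part as a factor, which keeps a nonnegative weight after
  integration by parts.\<close>

definition bump :: "'a::euclidean_space \<Rightarrow> real \<Rightarrow> 'a \<Rightarrow> real" where
  "bump p r x = (max 0 (r\<^sup>2 - (norm (x - p))\<^sup>2))\<^sup>2"

definition bump_grad :: "'a::euclidean_space \<Rightarrow> real \<Rightarrow> 'a \<Rightarrow> 'a" where
  "bump_grad p r x = (- 4 * max 0 (r\<^sup>2 - (norm (x - p))\<^sup>2)) *\<^sub>R (x - p)"

lemma has_gradient_on_bump: "has_gradient_on (bump p r) (bump_grad p r) U"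
proof -
  have "bump p r = (\<lambda>x. (max 0 (r\<^sup>2 - (norm (x - p))\<^sup>2))\<^sup>2)"
    by (rule ext) (rule bump_def)
  moreover have "bump_grad p r = (\<lambda>x. (2 * max 0 (r\<^sup>2 - (norm (x - p))\<^sup>2)) *\<^sub>R ((-2) *\<^sub>R (x - p)))"
    by (rule ext) (simp only: bump_grad_def scaleR_scaleR, simp add: mult.commute)
  ultimately show ?thesis
    using has_gradient_on_max_power2[OF has_gradient_on_norm_power2[of "r\<^sup>2" p U]] by metis
qed

lemma bump_nonneg: "bump p r x \<ge> 0"
  by (simp add: bump_def)

lemma bump_pos_iff:
  assumes "r > 0"
  shows "bump p r x > 0 \<longleftrightarrow> x \<in> ball p r"
proof -
  have "bump p r x > 0 \<longleftrightarrow> r\<^sup>2 - (norm (x - p))\<^sup>2 > 0"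
    unfolding bump_def by (cases "r\<^sup>2 - (norm (x - p))\<^sup>2 > 0") (simp_all add: max_absorb1 max_absorb2)
  also have "\<dots> \<longleftrightarrow> (norm (x - p))\<^sup>2 < r\<^sup>2" by simp
  also have "\<dots> \<longleftrightarrow> norm (x - p) < r"
    using assms power_mono_iff[of r "norm (x - p)" 2] by (simp add: linorder_not_le[symmetric])
  finally show ?thesis by (simp add: dist_norm norm_minus_commute)
qed

lemma bump_outside: "r > 0 \<Longrightarrow> x \<notin> ball p r \<Longrightarrow> bump p r x = 0 \<and> bump_grad p r x = 0"
proof -
  assume "r > 0" "x \<notin> ball p r"
  then have "norm (x - p) \<ge> r" by (simp add: dist_norm norm_minus_commute)
  then have "r\<^sup>2 \<le> (norm (x - p))\<^sup>2" using \<open>r > 0\<close> by (simp add: power_mono)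
  then show ?thesis by (simp add: bump_def bump_grad_def)
qed

section \<open>A global defining function\<close>

text \<open>\<open>g\<close> is positive on the compact set \<open>K - U\<close>, hence bounded
  below there by a positive number. This turns a property of a zero set into one of a whole
  collar.\<close>

lemma compact_sublevel:
  fixes g :: "'a::euclidean_space \<Rightarrow> real"
  assumes "compact K" "continuous_on K g" "open U" "\<And>x. x \<in> K \<Longrightarrow> g x \<le> 0 \<Longrightarrow> x \<in> U"
  obtains r where "r > 0" "\<And>x. x \<in> K \<Longrightarrow> g x \<le> r \<Longrightarrow> x \<in> U"
proof -
  have cp: "compact (K - U)" using assms by (simp add: compact_diff)
  show ?thesis
  proof (cases "K - U = {}")
    case True then show ?thesis using that[of 1] by auto
  next
    case False
    have "continuous_on (K - U) g" using assms(2) continuous_on_subset by blast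
    from continuous_attains_inf[OF cp False this] obtain x0 where
      x0: "x0 \<in> K - U" "\<And>x. x \<in> K - U \<Longrightarrow> g x0 \<le> g x" by blast
    have pos: "g x0 > 0" using x0(1) assms(4)[of x0] by (meson Diff_iff not_le)
    show ?thesis
    proof (rule that[of "g x0 / 2"])
      fix x assume "x \<in> K" "g x \<le> g x0 / 2"
      with pos have "\<not> g x0 \<le> g x" by linarith
      with x0(2) \<open>x \<in> K\<close> show "x \<in> U" by blast
    qed (use pos in linarith)
  qed
qed

text \<open>The gradient matters only at a zero: going along \<open>- N x\<close> makes
  \<open>f\<close> negative at once, so \<open>x\<close> is a limit of points of \<Omega>. Where
  \<open>f\<close> is nonzero its sign is constant nearby.\<close>

lemma frontier_pos_neg:
  fixes f :: "'a::euclidean_space \<Rightarrow> real"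
  assumes U: "open U" and f: "has_gradient_on f N U" and nz: "\<And>x. x \<in> U \<Longrightarrow> N x \<noteq> 0"
    and \<Omega>: "\<Omega> \<inter> U = {x\<in>U. f x < 0}" and x: "x \<in> U"
  shows "x \<in> \<Omega> \<longleftrightarrow> f x < 0" "x \<in> frontier \<Omega> \<longleftrightarrow> f x = 0"
proof -
  show 1: "x \<in> \<Omega> \<longleftrightarrow> f x < 0" using \<Omega> x by blast
  note cf = has_gradient_on_continuous(1)[OF f]
  have "open (f -` {..<0} \<inter> U)" "open (f -` {0<..} \<inter> U)"
    using iffD1[OF continuous_on_open_vimage[OF U] cf] open_lessThan open_greaterThan by metis+
  moreover have "f -` {..<0} \<inter> U = {x\<in>U. f x < 0}" "f -` {0<..} \<inter> U = {x\<in>U. f x > 0}" by auto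
  ultimately have oU: "open {x\<in>U. f x < 0}" "open {x\<in>U. f x > 0}" by simp_all
  show "x \<in> frontier \<Omega> \<longleftrightarrow> f x = 0"
  proof
    assume fr: "x \<in> frontier \<Omega>"
    consider "f x < 0" | "f x > 0" | "f x = 0" by linarith
    then show "f x = 0"
    proof cases
      case 1
      have "x \<in> interior \<Omega>"
        by (rule interiorI[OF oU(1)]) (use 1 x \<Omega> in auto)
      with fr show ?thesis by (simp add: frontier_def)
    next
      case 2
      have "{x\<in>U. f x > 0} \<inter> \<Omega> = {}" using \<Omega> by force
      then have "{x\<in>U. f x > 0} \<inter> closure \<Omega> = {}"
        using open_Int_closure_eq_empty[OF oU(2)] by blast
      with fr 2 x show ?thesis by (auto simp: frontier_def)
    qed
  next
    assume 0: "f x = 0"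
    have "x \<notin> interior \<Omega>" using 1 0 interior_subset by force
    moreover have "x \<in> closure \<Omega>"
    proof -
      have "((\<lambda>t. f (x - t *\<^sub>R N x)) has_real_derivative - (N x \<bullet> N x)) (at 0)"
      proof -
        have "((\<lambda>t. x - t *\<^sub>R N x) has_derivative (\<lambda>t. - (t *\<^sub>R N x))) (at 0)"
          by (auto intro!: derivative_eq_intros)
        from has_derivative_compose[OF this, of f "\<lambda>v. N x \<bullet> v"] has_gradient_onD[OF f x]
        have "((\<lambda>t. f (x - t *\<^sub>R N x)) has_derivative (\<lambda>t. N x \<bullet> (- (t *\<^sub>R N x)))) (at 0)" by simp
        then show ?thesis unfolding has_field_derivative_def
          by (rule has_derivative_eq_rhs) (auto simp: fun_eq_iff)
      qed
      from has_real_derivative_neg_dec_right[OF this] nz[OF x]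
      obtain d where d: "d > 0" "\<And>h. h > 0 \<Longrightarrow> h < d \<Longrightarrow> f (x - h *\<^sub>R N x) < 0"
        using 0 by auto
      have "((\<lambda>h. x - h *\<^sub>R N x) \<longlongrightarrow> x - 0 *\<^sub>R N x) (at_right 0)"
        by (intro tendsto_intros)
      then have lim: "((\<lambda>h. x - h *\<^sub>R N x) \<longlongrightarrow> x) (at_right 0)" by simp
      have "eventually (\<lambda>h. x - h *\<^sub>R N x \<in> U) (at_right 0)"
        by (rule topological_tendstoD[OF lim U x])
      moreover have "eventually (\<lambda>h::real. h \<in> {0<..<d}) (at_right 0)"
        by (rule eventually_at_right_real) (rule d)
      ultimately have "eventually (\<lambda>h. x - h *\<^sub>R N x \<in> \<Omega>) (at_right 0)"
        by eventually_elim (use d \<Omega> in auto)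
      then have "eventually (\<lambda>h. x - h *\<^sub>R N x \<in> closure \<Omega>) (at_right 0)"
        by eventually_elim (use closure_subset in auto)
      then show ?thesis
        using Lim_in_closed_set[OF closed_closure _ _ lim] by simp
    qed
    ultimately show "x \<in> frontier \<Omega>" by (simp add: frontier_def)
  qed
qed

text \<open>With positive slope for \<open>g\<close>, a short step along \<open>v\<close> would make
  \<open>f\<close> negative and \<open>g\<close> positive. For two local defining functions of one
  set this means that positive combinations of their gradients cannot cancel.\<close>

lemma inner_gradient_nonpos:
  assumes "(f has_derivative (\<lambda>v. a \<bullet> v)) (at x)" "(g has_derivative (\<lambda>v. b \<bullet> v)) (at x)"
    and "open W" "x \<in> W" and sub: "\<And>y. y \<in> W \<Longrightarrow> f y < 0 \<Longrightarrow> g y < (0::real)"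
    and 0: "f x = 0" "g x = 0" and v: "a \<bullet> v < (0::real)"
  shows "b \<bullet> v \<le> 0"
proof (rule ccontr)
  assume neg: "\<not> b \<bullet> v \<le> 0"
  have line: "((\<lambda>t. h (x + t *\<^sub>R v)) has_real_derivative c \<bullet> v) (at 0)"
    if h: "(h has_derivative (\<lambda>v. c \<bullet> v)) (at x)" for h :: "'a \<Rightarrow> real" and c
  proof -
    have "((\<lambda>t. x + t *\<^sub>R v) has_derivative (\<lambda>t. t *\<^sub>R v)) (at 0)"
      by (auto intro!: derivative_eq_intros)
    from has_derivative_compose[OF this, of h "\<lambda>v. c \<bullet> v"] h
    have "((\<lambda>t. h (x + t *\<^sub>R v)) has_derivative (\<lambda>t. c \<bullet> (t *\<^sub>R v))) (at 0)" by simp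
    then show ?thesis unfolding has_field_derivative_def
      by (rule has_derivative_eq_rhs) (auto simp: fun_eq_iff)
  qed
  obtain d where d: "d > 0" "\<And>h. h > 0 \<Longrightarrow> h < d \<Longrightarrow> f (x + h *\<^sub>R v) < 0"
    using has_real_derivative_neg_dec_right[OF line[OF assms(1)] v] 0 by auto
  obtain e where e: "e > 0" "\<And>h. h > 0 \<Longrightarrow> h < e \<Longrightarrow> g (x + h *\<^sub>R v) > 0"
    using has_real_derivative_pos_inc_right[OF line[OF assms(2)]] neg 0 by auto
  have "((\<lambda>h. x + h *\<^sub>R v) \<longlongrightarrow> x + 0 *\<^sub>R v) (at_right 0)"
    by (intro tendsto_intros)
  then have "eventually (\<lambda>h. x + h *\<^sub>R v \<in> W) (at_right 0)"
    using topological_tendstoD[OF _ \<open>open W\<close> \<open>x \<in> W\<close>] by fastforce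
  moreover have "eventually (\<lambda>h::real. h \<in> {0<..<min d e}) (at_right 0)"
    by (rule eventually_at_right_real) (use d e in auto)
  ultimately have "eventually (\<lambda>h. False) (at_right (0::real))"
  proof eventually_elim
    case (elim h)
    with d(2)[of h] e(2)[of h] sub[of "x + h *\<^sub>R v"] show ?case by auto
  qed
  then show False by simp
qed

text \<open>All local defining functions agree in sign, so a sum of them with nonnegative weights
  has the right sign. At a boundary point the local functions vanish, so the gradient of the sum is
  the weighted sum of their gradients, and these lie in a common half space.\<close>

lemma global_defining_function:
  fixes \<Omega> :: "'a::euclidean_space set"
  assumes o: "open \<Omega>" and bd: "bounded \<Omega>" and ne: "\<Omega> \<noteq> {}" and C1: "has_C_boundary 1 \<Omega>"
  obtains \<rho> N r0 where "has_gradient_on \<rho> N UNIV" "\<Omega> = {x. \<rho> x < 0}"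
    "closure \<Omega> = {x. \<rho> x \<le> 0}" "\<And>x. \<rho> x = 0 \<Longrightarrow> N x \<noteq> 0"
    "r0 > 0" "compact {x. \<bar>\<rho> x\<bar> \<le> r0}"
proof -
  define Z where "Z = frontier \<Omega>"
  have Zc: "compact Z" unfolding Z_def using bd by (simp add: compact_frontier_bounded)
  have Zne: "Z \<noteq> {}"
    unfolding Z_def using ne bd frontier_eq_empty[of \<Omega>] not_bounded_UNIV by auto
  define \<Phi> where "\<Phi> p U f N r \<longleftrightarrow> open U \<and> has_gradient_on f N U \<and> (\<forall>x\<in>U. N x \<noteq> 0)
      \<and> \<Omega> \<inter> U = {x\<in>U. f x < 0} \<and> 0 < r \<and> cball p r \<subseteq> U" for p :: 'a and U f N and r :: real
  have "\<exists>U f N r. \<Phi> p U f N r" if p: "p \<in> Z" for p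
  proof -
    obtain U f where U: "local_defining_function 1 \<Omega> p U f"
      using C1 p unfolding has_C_boundary_def Z_def by blast
    then have Uo: "open U" "p \<in> U" and c: "C_on 1 f U"
      and nz: "\<And>z. z \<in> U \<Longrightarrow> frechet_derivative f (at z) \<noteq> (\<lambda>v. 0)"
      and S: "\<Omega> \<inter> U = {z\<in>U. f z < 0}"
      by (auto simp: local_defining_function_def)
    have "Ck_on 1 f U" using c unfolding C_on_def by (auto simp: one_enat_def)
    then obtain N where N: "has_gradient_on f N U" by (rule C_on_1_imp_gradient)
    have "N x \<noteq> 0" if x: "x \<in> U" for x
    proof
      assume "N x = 0"
      with has_gradient_onD[OF N x] have "(f has_derivative (\<lambda>v. 0)) (at x)" by simp
      then show False using frechet_derivative_at nz[OF x] by metis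
    qed
    moreover obtain r where "r > 0" "cball p r \<subseteq> U"
      using Uo open_contains_cball by blast
    ultimately show ?thesis using Uo N S unfolding \<Phi>_def by blast
  qed
  then obtain U f G r where "\<And>p. p \<in> Z \<Longrightarrow> \<Phi> p (U p) (f p) (G p) (r p)"
    by metis
  then have
    Uo: "\<And>p. p \<in> Z \<Longrightarrow> open (U p)" and G: "\<And>p. p \<in> Z \<Longrightarrow> has_gradient_on (f p) (G p) (U p)"
    and Gnz: "\<And>p x. p \<in> Z \<Longrightarrow> x \<in> U p \<Longrightarrow> G p x \<noteq> 0"
    and S: "\<And>p. p \<in> Z \<Longrightarrow> \<Omega> \<inter> U p = {x\<in>U p. f p x < 0}"
    and r: "\<And>p. p \<in> Z \<Longrightarrow> r p > 0" "\<And>p. p \<in> Z \<Longrightarrow> cball p (r p) \<subseteq> U p"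
    unfolding \<Phi>_def by blast+
  have "Z \<subseteq> (\<Union>p\<in>Z. ball p (r p))" using r by force
  then obtain P where P: "P \<subseteq> Z" "finite P" and cov: "Z \<subseteq> (\<Union>p\<in>P. ball p (r p))"
    using compactE_image[OF Zc, of Z "\<lambda>p. ball p (r p)"] by blast
  have loc: "x \<in> \<Omega> \<longleftrightarrow> f p x < 0" "x \<in> Z \<longleftrightarrow> f p x = 0" if p: "p \<in> Z" "x \<in> U p" for p x
    using frontier_pos_neg[OF Uo[OF p(1)] G[OF p(1)] Gnz[OF p(1)] S[OF p(1)] p(2)]
    unfolding Z_def by blast+
  define B where "B x = (\<Sum>p\<in>P. bump p (r p) x)" for x
  have B0: "B x \<ge> 0" for x unfolding B_def by (intro sum_nonneg bump_nonneg)
  have Bpos: "B x > 0 \<longleftrightarrow> (\<exists>p\<in>P. x \<in> ball p (r p))" for x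
  proof -
    have "B x = 0 \<longleftrightarrow> (\<forall>p\<in>P. bump p (r p) x = 0)"
      unfolding B_def by (intro sum_nonneg_eq_0_iff P(2) bump_nonneg)
    then have "B x > 0 \<longleftrightarrow> (\<exists>p\<in>P. bump p (r p) x > 0)"
      using B0[of x] by (simp add: less_le bump_nonneg)
    then show ?thesis using bump_pos_iff r(1) P(1) by blast
  qed
  have gB: "has_gradient_on B (\<lambda>x. \<Sum>p\<in>P. bump_grad p (r p) x) UNIV"
    unfolding B_def by (intro has_gradient_on_sum has_gradient_on_bump)
  \<comment> \<open>Half the minimum of \<open>B\<close> on the boundary, so that
    \<open>\<beta>\<close> below, which lives where \<open>B x < c\<close>, vanishes near the
    boundary.\<close>
  obtain c where c: "c > 0" "\<And>x. x \<in> Z \<Longrightarrow> c < B x"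
  proof -
    obtain x0 where "x0 \<in> Z" "\<And>x. x \<in> Z \<Longrightarrow> B x0 \<le> B x"
      using continuous_attains_inf[OF Zc Zne, of B] has_gradient_on_continuous(1)[OF gB]
        continuous_on_subset by blast
    moreover have "B x0 > 0" using cov Bpos \<open>x0 \<in> Z\<close> by blast
    ultimately show ?thesis using that[of "B x0 / 2"] by (smt (verit) field_sum_of_halves)
  qed
  define \<beta> where "\<beta> x = (max 0 (c - B x))\<^sup>2" for x
  define \<beta>' where "\<beta>' x = (2 * max 0 (c - B x)) *\<^sub>R (0 - (\<Sum>p\<in>P. bump_grad p (r p) x))" for x
  have g\<beta>: "has_gradient_on \<beta> \<beta>' UNIV"
    unfolding \<beta>_def \<beta>'_def
    by (rule has_gradient_on_max_power2[OF has_gradient_on_diff[OF has_gradient_on_const gB]])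
  \<comment> \<open>It supplies the sign where the bumps die out. Its jump across the boundary is
    hidden by \<open>\<beta>\<close>.\<close>
  define sg :: "'a \<Rightarrow> real" where "sg x = (if x \<in> \<Omega> then -1 else 1)" for x
  have gsg: "has_gradient_on sg (\<lambda>x. 0) (- Z)"
    unfolding has_gradient_on_def
  proof (intro conjI ballI)
    fix x assume x: "x \<in> - Z"
    show "(sg has_derivative (\<lambda>v. 0 \<bullet> v)) (at x)"
    proof (cases "x \<in> \<Omega>")
      case True
      have "((\<lambda>x. -1) has_derivative (\<lambda>v. 0 \<bullet> v)) (at x)" by simp
      then show ?thesis
        by (rule has_derivative_transform_within_open[OF _ o True]) (simp add: sg_def)
    next
      case False
      then have "x \<in> - closure \<Omega>" using x o by (simp add: Z_def frontier_def interior_open)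
      have "((\<lambda>x. 1) has_derivative (\<lambda>v. 0 \<bullet> v)) (at x)" by simp
      then show ?thesis
        by (rule has_derivative_transform_within_open[OF _ _ \<open>x \<in> - closure \<Omega>\<close>])
           (use closure_subset in \<open>auto simp: sg_def\<close>)
    qed
  qed simp
  define \<rho> where "\<rho> x = (\<Sum>p\<in>P. bump p (r p) x * f p x) + \<beta> x * sg x" for x
  define N where "N x = (\<Sum>p\<in>P. bump p (r p) x *\<^sub>R G p x + f p x *\<^sub>R bump_grad p (r p) x)
      + (\<beta> x *\<^sub>R 0 + sg x *\<^sub>R \<beta>' x)" for x
  have \<beta>Z: "\<beta> x = 0 \<and> \<beta>' x = 0" if "c < B x" for x
    using that by (simp add: \<beta>_def \<beta>'_def)
  have "closed {x. B x \<le> c}"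
    using has_gradient_on_continuous(1)[OF gB] by (intro closed_Collect_le continuous_intros)
  then have g2: "has_gradient_on (\<lambda>x. \<beta> x * sg x) (\<lambda>x. \<beta> x *\<^sub>R 0 + sg x *\<^sub>R \<beta>' x) UNIV"
    using c(2) \<beta>Z Zc
    by (intro has_gradient_on_cutoff[OF gsg g\<beta>, of "{x. B x \<le> c}"])
       (force simp: compact_imp_closed)+
  have gN: "has_gradient_on \<rho> N UNIV"
    unfolding \<rho>_def N_def
  proof (intro has_gradient_on_add[OF has_gradient_on_sum g2])
    fix p assume "p \<in> P"
    then have p: "p \<in> Z" using P by auto
    show "has_gradient_on (\<lambda>x. bump p (r p) x * f p x)
      (\<lambda>x. bump p (r p) x *\<^sub>R G p x + f p x *\<^sub>R bump_grad p (r p) x) UNIV"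
      by (rule has_gradient_on_cutoff[OF G[OF p] has_gradient_on_bump Uo[OF p] closed_cball r(2)[OF p]])
         (simp add: bump_outside[OF r(1)[OF p]])
  qed
  have inU: "x \<in> U p" if "p \<in> P" "bump p (r p) x > 0" for p x
    using bump_pos_iff[OF r(1)] r(2) that P(1) by fastforce
  have neg: "\<rho> x < 0" if x: "x \<in> \<Omega>" for x
  proof -
    have nz: "bump p (r p) x * f p x \<le> 0" if "p \<in> P" for p
      using loc(1)[of p x] inU[OF that] bump_nonneg[of p "r p" x] P(1) that x
      by (smt (verit) in_mono mult_nonneg_nonpos mult_eq_0_iff)
    show ?thesis
    proof (cases "B x > 0")
      case True
      then obtain p where p: "p \<in> P" "x \<in> ball p (r p)" using Bpos by blast
      then have "bump p (r p) x > 0" using bump_pos_iff r(1) P(1) by blast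
      then have "bump p (r p) x * f p x < 0"
        using loc(1)[of p x] inU[OF p(1)] p P(1) x by (meson in_mono mult_pos_neg)
      then have "(\<Sum>p\<in>P. bump p (r p) x * f p x) < 0"
        using nz p P(2) sum_strict_mono_ex1[OF P(2), of "\<lambda>p. bump p (r p) x * f p x" "\<lambda>p. 0"] by auto
      moreover have "\<rho> x = (\<Sum>p\<in>P. bump p (r p) x * f p x) - \<beta> x" using x by (simp add: \<rho>_def sg_def)
      moreover have "\<beta> x \<ge> 0" by (simp add: \<beta>_def)
      ultimately show ?thesis by linarith
    next
      case False
      then have "B x = 0" using B0[of x] by simp
      then have "\<beta> x * sg x < 0" using x c(1) by (simp add: \<beta>_def sg_def)
      then show ?thesis unfolding \<rho>_def using nz sum_nonpos[of P "\<lambda>p. bump p (r p) x * f p x"] by fastforce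
    qed
  qed
  have pos: "\<rho> x > 0" if x: "x \<notin> closure \<Omega>" for x
  proof -
    have xn: "x \<notin> \<Omega>" "x \<notin> Z" using x closure_subset by (auto simp: Z_def frontier_def)
    have fp: "f p x > 0" if "p \<in> Z" "x \<in> U p" for p
      using loc[OF that] xn by (meson linorder_neqE)
    have nz: "bump p (r p) x * f p x \<ge> 0" if "p \<in> P" for p
      using fp[of p] inU[OF that] bump_nonneg[of p "r p" x] P(1) that
      by (smt (verit) in_mono mult_nonneg_nonneg mult_eq_0_iff)
    show ?thesis
    proof (cases "B x > 0")
      case True
      then obtain p where p: "p \<in> P" "x \<in> ball p (r p)" using Bpos by blast
      then have "bump p (r p) x > 0" using bump_pos_iff r(1) P(1) by blast
      then have "bump p (r p) x * f p x > 0"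
        using fp[of p] inU[OF p(1)] p P(1) by (meson in_mono mult_pos_pos)
      then have "(\<Sum>p\<in>P. bump p (r p) x * f p x) > 0"
        using nz p P(2) sum_strict_mono_ex1[OF P(2), of "\<lambda>p. 0" "\<lambda>p. bump p (r p) x * f p x"] by auto
      moreover have "\<rho> x = (\<Sum>p\<in>P. bump p (r p) x * f p x) + \<beta> x" using xn by (simp add: \<rho>_def sg_def)
      moreover have "\<beta> x \<ge> 0" by (simp add: \<beta>_def)
      ultimately show ?thesis by linarith
    next
      case False
      then have "B x = 0" using B0[of x] by simp
      then have "\<beta> x * sg x > 0" using xn c(1) by (simp add: \<beta>_def sg_def)
      then show ?thesis unfolding \<rho>_def using nz sum_nonneg[of P "\<lambda>p. bump p (r p) x * f p x"] by fastforce
    qed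
  qed
  have onZ: "bump p (r p) x * f p x = 0" if "p \<in> P" "x \<in> Z" for p x
    using loc(2)[of p x] inU[OF that(1), of x] bump_nonneg[of p "r p" x] P(1) that
    by (smt (verit) in_mono mult_eq_0_iff)
  have zero: "\<rho> x = 0" if x: "x \<in> Z" for x
    unfolding \<rho>_def using \<beta>Z[OF c(2)[OF x]] sum.neutral[of P "\<lambda>p. bump p (r p) x * f p x"] onZ[OF _ x]
    by (metis add.right_neutral mult_zero_left)
  have cl: "closure \<Omega> = \<Omega> \<union> Z" "\<Omega> \<inter> Z = {}"
    using o by (auto simp: Z_def frontier_def interior_open closure_subset[THEN subsetD])
  have tri: "x \<in> \<Omega> \<and> \<rho> x < 0 \<or> x \<in> Z \<and> \<rho> x = 0 \<or> x \<notin> closure \<Omega> \<and> \<rho> x > 0" for x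
    using neg pos zero cl by blast
  have nz: "N x \<noteq> 0" if "\<rho> x = 0" for x
  proof
    assume N0: "N x = 0"
    have x: "x \<in> Z" using tri[of x] that by auto
    have "f p x *\<^sub>R bump_grad p (r p) x = 0" if p: "p \<in> P" for p
    proof (cases "x \<in> ball p (r p)")
      case True
      then have "x \<in> U p" using r(2)[of p] p P(1) by force
      then show ?thesis using loc(2)[of p x] p P(1) x by auto
    next
      case False then show ?thesis using bump_outside r(1) p P(1) by (metis scaleR_zero_right subsetD)
    qed
    then have Nx: "N x = (\<Sum>p\<in>P. bump p (r p) x *\<^sub>R G p x)"
      unfolding N_def using \<beta>Z[OF c(2)[OF x]] by (simp del: scaleR_eq_0_iff)
    obtain q where q: "q \<in> P" "x \<in> ball q (r q)" using cov x by blast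
    then have qZ: "q \<in> Z" and xq: "x \<in> U q" using P(1) r(2)[of q] by force+
    \<comment> \<open>Every term of the gradient sum has nonpositive slope along this direction, and
      the term of \<open>q\<close> strictly negative slope.\<close>
    let ?v = "- G q x"
    have "bump p (r p) x * (G p x \<bullet> ?v) \<le> 0" if p: "p \<in> P" for p
    proof (cases "x \<in> ball p (r p)")
      case True
      have pZ: "p \<in> Z" and xp: "x \<in> U p" using P(1) r(2)[of p] p True by force+
      have "G p x \<bullet> ?v \<le> 0"
      proof (rule inner_gradient_nonpos[OF has_gradient_onD[OF G[OF qZ] xq] has_gradient_onD[OF G[OF pZ] xp],
          where W="U p \<inter> U q"])
        show "open (U p \<inter> U q)" "x \<in> U p \<inter> U q" using Uo pZ qZ xp xq by auto
        show "f p y < 0" if "y \<in> U p \<inter> U q" "f q y < 0" for y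
          using S[OF pZ] S[OF qZ] that by blast
        show "f q x = 0" "f p x = 0" using loc(2)[of q x] loc(2)[of p x] pZ qZ xp xq x by auto
        show "G q x \<bullet> ?v < 0" using Gnz[OF qZ xq] by simp
      qed
      then show ?thesis using bump_nonneg[of p "r p" x] by (simp add: mult_nonneg_nonpos)
    next
      case False then show ?thesis using bump_outside r(1) p P(1) by (metis mult_zero_left order_refl subsetD)
    qed
    moreover have "bump q (r q) x * (G q x \<bullet> ?v) < 0"
      using q bump_pos_iff[of "r q" q x] r(1)[OF qZ] Gnz[OF qZ xq] by (simp add: mult_pos_neg)
    ultimately have "(\<Sum>p\<in>P. bump p (r p) x * (G p x \<bullet> ?v)) < 0"
      using q P(2) sum_strict_mono_ex1[OF P(2), of "\<lambda>p. bump p (r p) x * (G p x \<bullet> ?v)" "\<lambda>p. 0"] by auto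
    then have "N x \<bullet> ?v < 0" unfolding Nx by (simp add: inner_sum_left sum_negf)
    with N0 show False by simp
  qed
  \<comment> \<open>Where all bumps vanish, \<open>\<bar>\<rho> x\<bar>\<close> equals
    \<open>c\<^sup>2\<close>; half of this level confines \<open>x\<close> to finitely many
    balls.\<close>
  have cpt: "compact {x. \<bar>\<rho> x\<bar> \<le> c\<^sup>2 / 2}"
  proof -
    have "{x. \<bar>\<rho> x\<bar> \<le> c\<^sup>2 / 2} \<subseteq> (\<Union>p\<in>P. cball p (r p))"
    proof
      fix x assume x: "x \<in> {x. \<bar>\<rho> x\<bar> \<le> c\<^sup>2 / 2}"
      have "B x > 0"
      proof (rule ccontr)
        assume "\<not> B x > 0"
        then have B: "B x = 0" using B0[of x] by simp
        have "bump p (r p) x = 0" if "p \<in> P" for p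
          using B that unfolding B_def by (simp add: sum_nonneg_eq_0_iff P(2) bump_nonneg)
        then have "\<rho> x = c\<^sup>2 * sg x" using B c(1) by (simp add: \<rho>_def \<beta>_def)
        then have "\<bar>\<rho> x\<bar> = c\<^sup>2" by (simp add: sg_def)
        with x c(1) show False by simp
      qed
      then show "x \<in> (\<Union>p\<in>P. cball p (r p))" using Bpos by force
    qed
    moreover have "bounded (\<Union>p\<in>P. cball p (r p))" using P(2) by auto
    ultimately have "bounded {x. \<bar>\<rho> x\<bar> \<le> c\<^sup>2 / 2}" using bounded_subset by blast
    moreover have "closed {x. \<bar>\<rho> x\<bar> \<le> c\<^sup>2 / 2}"
      using has_gradient_on_continuous(1)[OF gN] by (intro closed_Collect_le continuous_intros)
    ultimately show ?thesis by (simp add: compact_eq_bounded_closed)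
  qed
  show ?thesis
  proof (rule that[OF gN _ _ nz _ cpt])
    show "\<Omega> = {x. \<rho> x < 0}"
      using neg tri by (intro set_eqI) (metis less_asym less_irrefl mem_Collect_eq)
    show "closure \<Omega> = {x. \<rho> x \<le> 0}"
    proof (intro set_eqI)
      fix x
      show "x \<in> closure \<Omega> \<longleftrightarrow> x \<in> {x. \<rho> x \<le> 0}"
        using neg[of x] zero[of x] pos[of x] cl(1) by force
    qed
  qed (use c in auto)
qed

section \<open>Small isotopies\<close>

lemma C_on_1I:
  assumes "\<And>x. x \<in> U \<Longrightarrow> (f has_derivative f' x) (at x)" "\<And>v. continuous_on U (\<lambda>x. f' x v)"
  shows "C_on 1 f U"
proof -
  have "continuous_on U f"
    using assms(1) has_derivative_continuous by (intro continuous_at_imp_continuous_on ballI) blast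
  then have 0: "Ck_on 0 f U" by simp
  have 1: "Ck_on (Suc 0) f U" using assms by auto
  show ?thesis
    unfolding C_on_def
  proof (intro allI impI)
    fix k assume "enat k \<le> 1"
    then have "k = 0 \<or> k = Suc 0" by (auto simp: one_enat_def)
    then show "Ck_on k f U" using 0 1 by blast
  qed
qed

text \<open>The derivative bound makes \<open>g\<close> a contraction with constant 1/2:
  \<open>x \<mapsto> y - g x\<close> has a unique fixed point, and \<open>x + g x\<close> shrinks
  distances at most by the factor 2. The same factor bounds the inverse derivatives, which makes the
  inverse map C^1.\<close>

lemma near_identity_diffeomorphism:
  fixes g :: "'a::euclidean_space \<Rightarrow> 'a"
  assumes g: "\<And>x. (g has_derivative g' x) (at x)" and cg: "\<And>v. continuous_on UNIV (\<lambda>x. g' x v)"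
    and bd: "\<And>x v. norm (g' x v) \<le> 1/2 * norm v"
  shows "C1_diffeomorphism (\<lambda>x. x + g x)"
proof -
  define h where "h x = x + g x" for x
  have lip: "norm (g x - g y) \<le> 1/2 * norm (x - y)" for x y
  proof (rule differentiable_bound[of UNIV g g'])
    show "onorm (g' x) \<le> 1/2" for x by (rule onorm_bound) (use bd in auto)
  qed (use g has_derivative_at_withinI in auto)
  have exp: "norm (x - y) \<le> 2 * norm (h x - h y)" for x y
  proof -
    have "x - y = (h x - h y) - (g x - g y)" by (simp add: h_def)
    then have "norm (x - y) \<le> norm (h x - h y) + norm (g x - g y)"
      using norm_triangle_ineq4 by metis
    with lip[of x y] show ?thesis by linarith
  qed
  have inj: "inj h"
  proof (rule injI)
    fix x y assume "h x = h y"
    with exp[of x y] show "x = y" by simp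
  qed
  have "\<exists>x. h x = y" for y
  proof -
    have "\<exists>!x. y - g x = x"
    proof (rule banach_fix_type[of "1/2"])
      show "\<forall>x z. dist (y - g x) (y - g z) \<le> 1/2 * dist x z"
        using lip by (simp add: dist_norm norm_minus_commute)
    qed auto
    then obtain x where "y - g x = x" by auto
    then show ?thesis by (intro exI[of _ x]) (simp add: h_def algebra_simps)
  qed
  then have bij: "bij h" using inj unfolding bij_def surj_def by metis
  define h' where "h' x v = v + g' x v" for x v
  have dh: "(h has_derivative h' x) (at x)" for x
    unfolding h_def h'_def by (intro derivative_intros g)
  have lin: "linear (h' x)" for x
    using dh has_derivative_linear by blast
  have exp': "norm v \<le> 2 * norm (h' x v)" for x v
  proof -
    have "v = h' x v - g' x v" by (simp add: h'_def)
    then have "norm v \<le> norm (h' x v) + norm (g' x v)" using norm_triangle_ineq4 by metis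
    with bd[of x v] show ?thesis by linarith
  qed
  have injh': "inj (h' x)" for x
    unfolding linear_injective_0[OF lin] using exp'[of _ x] by (metis mult_zero_right norm_le_zero_iff norm_zero)
  then have surjh': "surj (h' x)" for x
    using linear_injective_imp_surjective[OF lin] by blast
  define k where "k = inv h"
  have hk: "h (k y) = y" and kh: "k (h x) = x" for x y
    using bij by (simp_all add: k_def bij_is_inj bij_is_surj surj_f_inv_f)
  have klip: "norm (k x - k y) \<le> 2 * norm (x - y)" for x y
    using exp[of "k x" "k y"] by (simp add: hk)
  have ck: "continuous_on UNIV k"
  proof -
    have "2-lipschitz_on UNIV k"
      using klip by (intro lipschitz_onI) (auto simp: dist_norm)
    then show ?thesis by (rule lipschitz_on_continuous_on)
  qed
  define L where "L y = inv (h' (k y))" for y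
  have L1: "h' (k y) (L y v) = v" for y v
    unfolding L_def by (rule surj_f_inv_f[OF surjh'])
  have L2: "L y (h' (k y) v) = v" for y v
    unfolding L_def by (rule inv_f_f[OF injh'])
  have linL: "linear (L y)" for y
  proof (rule linearI)
    interpret l: linear "h' (k y)" by (rule lin)
    show "L y (a + b) = L y a + L y b" for a b
      using L2[of y "L y a + L y b"] by (simp add: l.add L1)
    show "L y (r *\<^sub>R a) = r *\<^sub>R L y a" for r a
      using L2[of y "r *\<^sub>R L y a"] by (simp add: l.scale L1)
  qed
  have dk: "(k has_derivative L y) (at y)" for y
  proof (rule has_derivative_inverse_basic[where f=h and f'="h' (k y)" and T=UNIV])
    show "bounded_linear (L y)" using linL by (simp add: linear_conv_bounded_linear)
    show "L y \<circ> h' (k y) = id" by (auto simp: L2)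
    show "continuous (at y) k" using ck by (simp add: continuous_on_eq_continuous_at)
  qed (auto simp: hk dh)
  have cL: "continuous_on UNIV (\<lambda>y. L y v)" for v
    unfolding continuous_on_def
  proof (intro ballI)
    fix y0
    have "((\<lambda>y. g' (k y) (L y0 v)) \<longlongrightarrow> g' (k y0) (L y0 v)) (at y0)"
      using continuous_on_compose2[OF cg[of "L y0 v"] ck] by (simp add: continuous_on_def)
    then have lim: "((\<lambda>y. norm (g' (k y0) (L y0 v) - g' (k y) (L y0 v)) * 2) \<longlongrightarrow> 0) (at y0)"
      by (auto intro!: tendsto_eq_intros)
    \<comment> \<open>Applying \<open>h' (k y)\<close> to the difference leaves only the change of
      \<open>g'\<close> at the fixed vector \<open>L y0 v\<close>, which is continuous by
      hypothesis. The factor 2 is that of \<open>exp'\<close>.\<close>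
    have le: "norm (L y v - L y0 v) \<le> norm (g' (k y0) (L y0 v) - g' (k y) (L y0 v)) * 2" for y
    proof -
      interpret l: linear "h' (k y)" by (rule lin)
      have "h' (k y) (L y v - L y0 v) = v - h' (k y) (L y0 v)"
        by (simp add: l.diff L1)
      also have "\<dots> = h' (k y0) (L y0 v) - h' (k y) (L y0 v)" by (simp add: L1)
      also have "\<dots> = g' (k y0) (L y0 v) - g' (k y) (L y0 v)" by (simp add: h'_def)
      finally show ?thesis using exp'[of "L y v - L y0 v" "k y"] by simp
    qed
    have "((\<lambda>y. L y v - L y0 v) \<longlongrightarrow> 0) (at y0)"
      by (rule Lim_null_comparison[OF always_eventually lim]) (use le in auto)
    then show "((\<lambda>y. L y v) \<longlongrightarrow> L y0 v) (at y0 within UNIV)"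
      using LIM_zero_iff by auto
  qed
  have "continuous_on UNIV (\<lambda>x. h' x v)" for v
    unfolding h'_def by (intro continuous_intros cg)
  then show ?thesis
    using bij C_on_1I[of UNIV h h'] dh C_on_1I[of UNIV k L] dk cL
    unfolding C1_diffeomorphism_def k_def h_def[abs_def] by simp
qed

text \<open>Scaling by s in [0,1] preserves the bound 1/2, so the straight-line family consists of
  diffeomorphisms. Surjectivity of the last one turns the pointwise equivalence into equality of the
  image of \<open>A\<close> with \<open>B\<close>.\<close>

lemma small_isotopy:
  fixes g :: "'a::euclidean_space \<Rightarrow> 'a"
  assumes g: "\<And>x. (g has_derivative g' x) (at x)" and cg: "\<And>v. continuous_on UNIV (\<lambda>x. g' x v)"
    and bd: "\<And>x v. norm (g' x v) \<le> 1/2 * norm v"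
    and inv: "\<And>x. x + g x \<in> B \<longleftrightarrow> x \<in> A"
  shows "ambient_C1_isotopy (\<lambda>s x. x + s *\<^sub>R g x) A B"
proof -
  have dg: "((\<lambda>x. s *\<^sub>R g x) has_derivative (\<lambda>v. s *\<^sub>R g' x v)) (at x)" for s x
    by (intro derivative_intros g)
  have diffeo: "C1_diffeomorphism (\<lambda>x. x + s *\<^sub>R g x)" if "s \<in> {0..1}" for s
  proof (rule near_identity_diffeomorphism[OF dg])
    show "continuous_on UNIV (\<lambda>x. s *\<^sub>R g' x v)" for v by (intro continuous_intros cg)
    show "norm (s *\<^sub>R g' x v) \<le> 1/2 * norm v" for x v
    proof -
      have "norm (s *\<^sub>R g' x v) \<le> 1 * norm (g' x v)"
        unfolding norm_scaleR by (rule mult_right_mono) (use that in auto)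
      with bd[of x v] show ?thesis by linarith
    qed
  qed
  have cgg: "continuous_on UNIV g"
    using g has_derivative_continuous by (intro continuous_at_imp_continuous_on ballI) blast
  have fd: "frechet_derivative (\<lambda>x. x + s *\<^sub>R g x) (at z) = (\<lambda>v. v + s *\<^sub>R g' z v)" for s z
    by (rule frechet_derivative_at[symmetric]) (intro derivative_intros dg)
  show ?thesis
    unfolding ambient_C1_isotopy_def
  proof (intro conjI ballI allI)
    show "continuous_on ({0..1} \<times> UNIV) (\<lambda>(s, z). z + s *\<^sub>R g z)"
      unfolding case_prod_beta
      by (intro continuous_intros continuous_on_compose2[OF cgg]) auto
    show "continuous_on ({0..1} \<times> UNIV) (\<lambda>(s, z). frechet_derivative (\<lambda>x. x + s *\<^sub>R g x) (at z) v)" for v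
      unfolding fd case_prod_beta
      by (intro continuous_intros continuous_on_compose2[OF cg[of v]]) auto
    show "(\<lambda>x. x + 0 *\<^sub>R g x) = id" by auto
    have "surj (\<lambda>x. x + 1 *\<^sub>R g x)"
      using diffeo[of 1] by (simp add: C1_diffeomorphism_def bij_is_surj)
    then have "\<exists>x. y = x + g x" for y unfolding surj_def by simp
    then show "(\<lambda>x. x + 1 *\<^sub>R g x) ` A = B"
      using inv by (auto simp: image_iff) metis
  qed (use diffeo in auto)
qed

section \<open>Polynomial maps and implicit differentiation\<close>

lemma real_polynomial_function_C1:
  fixes p :: "'a::euclidean_space \<Rightarrow> real"
  assumes "real_polynomial_function p"
  shows "\<exists>p'. (\<forall>x. (p has_derivative p' x) (at x)) \<and> (\<forall>v. continuous_on UNIV (\<lambda>x. p' x v))"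
  using assms
proof induction
  case (linear f)
  then have "(f has_derivative f) (at x)" for x
    using bounded_linear.has_derivative[OF linear, of "\<lambda>x. x" "\<lambda>x. x"] by auto
  then show ?case by (intro exI[of _ "\<lambda>x. f"]) auto
next
  case (const c)
  show ?case by (rule exI[of _ "\<lambda>x v. 0"]) auto
next
  case (add f g)
  then obtain f' g' where fg: "\<And>x. (f has_derivative f' x) (at x)" "\<And>v. continuous_on UNIV (\<lambda>x. f' x v)"
    "\<And>x. (g has_derivative g' x) (at x)" "\<And>v. continuous_on UNIV (\<lambda>x. g' x v)" by blast
  show ?case
    by (rule exI[of _ "\<lambda>x v. f' x v + g' x v"]) (auto intro!: derivative_intros continuous_intros fg)
next
  case (mult f g)
  then obtain f' g' where fg: "\<And>x. (f has_derivative f' x) (at x)" "\<And>v. continuous_on UNIV (\<lambda>x. f' x v)"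
    "\<And>x. (g has_derivative g' x) (at x)" "\<And>v. continuous_on UNIV (\<lambda>x. g' x v)" by blast
  have c: "continuous_on UNIV f" "continuous_on UNIV g"
    using fg(1,3) has_derivative_continuous by (intro continuous_at_imp_continuous_on ballI; blast)+
  show ?case
    by (rule exI[of _ "\<lambda>x v. f x * g' x v + f' x v * g x"])
       (auto intro!: has_derivative_mult continuous_intros fg c)
qed

lemma polynomial_function_C1:
  fixes p :: "'a::euclidean_space \<Rightarrow> 'b::euclidean_space"
  assumes "polynomial_function p"
  obtains p' where "\<And>x. (p has_derivative p' x) (at x)" "\<And>v. continuous_on UNIV (\<lambda>x. p' x v)"
proof -
  have "real_polynomial_function (\<lambda>x. p x \<bullet> b)" for b
    using assms unfolding polynomial_function_def
    by (auto simp: o_def dest!: spec[of _ "\<lambda>x. x \<bullet> b"] intro: bounded_linear_inner_left)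
  then have "\<exists>p'. (\<forall>x. ((\<lambda>x. p x \<bullet> b) has_derivative p' x) (at x)) \<and> (\<forall>v. continuous_on UNIV (\<lambda>x. p' x v))" for b
    by (rule real_polynomial_function_C1)
  then obtain p' where p': "\<And>b x. ((\<lambda>x. p x \<bullet> b) has_derivative p' b x) (at x)"
    "\<And>b v. continuous_on UNIV (\<lambda>x. p' b x v)" by metis
  have "((\<lambda>x. \<Sum>b\<in>Basis. (p x \<bullet> b) *\<^sub>R b) has_derivative (\<lambda>v. \<Sum>b\<in>Basis. p' b x v *\<^sub>R b)) (at x)" for x
    by (intro derivative_intros p')
  then have "(p has_derivative (\<lambda>v. \<Sum>b\<in>Basis. p' b x v *\<^sub>R b)) (at x)" for x
    by (simp add: euclidean_representation)
  moreover have "continuous_on UNIV (\<lambda>x. \<Sum>b\<in>Basis. p' b x v *\<^sub>R b)" for v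
    by (intro continuous_intros p')
  ultimately show ?thesis by (rule that)
qed

text \<open>Only the differentiability part of the implicit function theorem: the solution
  \<open>T\<close> and its continuity are found by hand along lines. The differentiability estimate
  for \<Phi> first gives a Lipschitz bound for \<open>T\<close> at \<open>x0\<close>, and with it
  the same estimate yields the derivative.\<close>

lemma implicit_has_derivative:
  fixes \<Phi> :: "'a::euclidean_space \<times> real \<Rightarrow> real"
  assumes D: "(\<Phi> has_derivative D) (at (x0, T x0))" and cT: "continuous (at x0) T"
    and ev: "eventually (\<lambda>x. \<Phi> (x, T x) = \<Phi> (x0, T x0)) (nhds x0)" and nz: "D (0, 1) \<noteq> 0"
  shows "(T has_derivative (\<lambda>u. - D (u, 0) / D (0, 1))) (at x0)"
proof -
  define l where "l = D (0, 1)"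
  interpret D: bounded_linear D using D by (rule has_derivative_bounded_linear)
  have Dsplit: "D (u, t) = D (u, 0) + t * l" for u t
  proof -
    have "D (u, t) = D ((u, 0) + t *\<^sub>R (0, 1))" by simp
    then show ?thesis unfolding D.add D.scale l_def by simp
  qed
  obtain M where M: "M > 0" "\<And>x. norm (D x) \<le> norm x * M" using D.pos_bounded by blast
  have M': "\<bar>D (u, 0)\<bar> \<le> M * norm u" for u using M(2)[of "(u, 0)"] by (simp add: norm_Pair mult.commute)
  have l0: "\<bar>l\<bar> > 0" using nz by (simp add: l_def)
  \<comment> \<open>The constant of the Lipschitz bound; it arises when
    \<open>\<bar>l\<bar> / 2 * \<bar>t\<bar>\<close> is moved to the left of \<open>\<bar>t\<bar> *
    \<bar>l\<bar> \<le> (M + \<bar>l\<bar>) * norm u + \<bar>l\<bar> / 2 *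
    \<bar>t\<bar>\<close>.\<close>
  define C where "C = 2 / \<bar>l\<bar> * (M + \<bar>l\<bar>)"
  have C0: "C \<ge> 0" using M(1) by (simp add: C_def)
  have bl: "bounded_linear (\<lambda>u. - D (u, 0) / D (0, 1))"
    unfolding divide_inverse
    by (intro bounded_linear_mult_const bounded_linear_minus bounded_linear_compose[OF D.bounded_linear_axioms]
        bounded_linear_Pair bounded_linear_ident bounded_linear_zero)
  show ?thesis
    unfolding has_derivative_at_alt
  proof (intro conjI allI impI bl)
    fix e :: real assume e: "e > 0"
    \<comment> \<open>The first entry permits that absorption; the second turns the error
      \<open>e' * (1 + C) * norm u\<close> into \<open>e * norm u\<close> after division by
      \<open>l\<close>.\<close>
    define e' where "e' = min (\<bar>l\<bar> / 2) (e * \<bar>l\<bar> / (1 + C))"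
    have e': "e' > 0" "e' \<le> \<bar>l\<bar> / 2" "e' \<le> e * \<bar>l\<bar> / (1 + C)"
      unfolding e'_def using e l0 C0 by (simp_all only: min.cobounded1 min.cobounded2) (simp add: min_def)
    then have e'3: "e' * (1 + C) \<le> e * \<bar>l\<bar>"
      using C0 by (simp add: pos_le_divide_eq)
    obtain d where d: "d > 0" "\<And>y. norm (y - (x0, T x0)) < d \<Longrightarrow>
        norm (\<Phi> y - \<Phi> (x0, T x0) - D (y - (x0, T x0))) \<le> e' * norm (y - (x0, T x0))"
      using D e'(1) unfolding has_derivative_at_alt by blast
    have "((\<lambda>x. (x, T x)) \<longlongrightarrow> (x0, T x0)) (nhds x0)"
      using cT by (intro tendsto_Pair) (auto simp: continuous_within tendsto_at_iff_tendsto_nhds filterlim_ident)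
    then have "eventually (\<lambda>x. dist (x, T x) (x0, T x0) < d) (nhds x0)"
      using d(1) tendstoD by blast
    with ev have "eventually (\<lambda>x. dist (x, T x) (x0, T x0) < d \<and> \<Phi> (x, T x) = \<Phi> (x0, T x0)) (nhds x0)"
      by eventually_elim auto
    then obtain k where k: "k > 0" "\<And>x. dist x x0 < k \<Longrightarrow>
        dist (x, T x) (x0, T x0) < d \<and> \<Phi> (x, T x) = \<Phi> (x0, T x0)"
      unfolding eventually_nhds_metric by blast
    show "\<exists>d>0. \<forall>y. norm (y - x0) < d \<longrightarrow>
        norm (T y - T x0 - - D (y - x0, 0) / D (0, 1)) \<le> e * norm (y - x0)"
    proof (rule exI[of _ k], intro conjI allI impI k(1))
      fix y assume y: "norm (y - x0) < k"
      define u where "u = y - x0"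
      define t where "t = T y - T x0"
      from k(2)[of y] y d(2)[of "(y, T y)"]
      have "\<bar>D (u, t)\<bar> \<le> e' * norm (u, t)" by (simp add: dist_norm u_def t_def)
      moreover have "norm (u, t) \<le> norm u + \<bar>t\<bar>"
        using norm_Pair_le[of u t] by simp
      ultimately have 1: "\<bar>D (u, 0) + t * l\<bar> \<le> e' * (norm u + \<bar>t\<bar>)"
        using Dsplit[of u t] e'(1) by (smt (verit) mult_left_mono)
      have "\<bar>t\<bar> * \<bar>l\<bar> \<le> M * norm u + e' * norm u + e' * \<bar>t\<bar>"
        using 1 M'[of u] by (simp add: abs_mult[symmetric] algebra_simps)
      also have "\<dots> \<le> M * norm u + \<bar>l\<bar> * norm u + \<bar>l\<bar> / 2 * \<bar>t\<bar>"
        using e'(2) l0 by (intro add_mono mult_right_mono order_refl) auto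
      finally have "\<bar>t\<bar> \<le> C * norm u"
        using l0 unfolding C_def by (simp add: field_simps)
      then have "e' * (norm u + \<bar>t\<bar>) \<le> e' * (norm u + C * norm u)"
        using e'(1) by (intro mult_left_mono) auto
      also have "\<dots> = (e' * (1 + C)) * norm u" by (simp add: algebra_simps)
      also have "\<dots> \<le> (e * \<bar>l\<bar>) * norm u" using e'3 by (rule mult_right_mono) simp
      finally have 2: "\<bar>D (u, 0) + t * l\<bar> \<le> e * norm u * \<bar>l\<bar>" using 1 by (simp add: mult_ac)
      have "t - - D (u, 0) / l = (D (u, 0) + t * l) / l" using l0 by (simp add: field_simps)
      then have "\<bar>t - - D (u, 0) / l\<bar> \<le> e * norm u"
        using 2 l0 by (simp add: abs_divide pos_divide_le_eq)
      then show "norm (T y - T x0 - - D (y - x0, 0) / D (0, 1)) \<le> e * norm (y - x0)"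
        by (simp add: t_def u_def l_def)
    qed
  qed
qed

section \<open>Isotopies along a transverse field\<close>

lemma norm_le_of_inner_bound:
  fixes a :: "'a::real_inner"
  assumes "\<bar>a \<bullet> a\<bar> \<le> k * norm a" "k \<ge> 0"
  shows "norm a \<le> k"
proof (cases "a = 0")
  case True
  then show ?thesis using assms by simp
next
  case False
  have "norm a * norm a \<le> k * norm a"
    using assms(1) by (simp add: power2_norm_eq_inner[symmetric] power2_eq_square)
  then show ?thesis using False by simp
qed

lemma abs_inner_le: "norm a \<le> k \<Longrightarrow> \<bar>a \<bullet> b\<bar> \<le> k * norm b"
  by (meson Cauchy_Schwarz_ineq2 mult_right_mono norm_ge_zero order_trans)

text \<open>\<open>\<rho>\<close> falls at nearly unit speed along \<open>V\<close>, so each short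
  line through the collar enters \<open>{F < 1}\<close> at a single time \<open>T z\<close>, which
  is C^1-close to \<open>\<rho> z\<close>. Sliding \<open>x\<close> along \<open>V x\<close> by
  \<open>T x - \<rho> x\<close>, cut off away from the boundary, carries the one set to the other.
  In the bound on \<alpha>, \<open>6 + 26 * C\<close> estimates the gradient of the sliding time per
  unit of \<alpha>, the further \<open>C\<close> is the length of \<open>V\<close>, and 5 accounts
  for the derivative of \<open>V\<close>.\<close>

lemma isotopy_along_transverse_field:
  fixes \<rho> :: "'a::euclidean_space \<Rightarrow> real" and V :: "'a \<Rightarrow> 'a"
  assumes \<rho>: "has_gradient_on \<rho> N UNIV"
    and V: "\<And>x. (V has_derivative V' x) (at x)" "\<And>v. continuous_on UNIV (\<lambda>x. V' x v)"
    and r: "r > 0" and \<alpha>: "\<alpha> > 0" "\<alpha> * ((6 + 26 * C) * C + 5) \<le> 1/2" and C: "C \<ge> 2"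
    and NV: "\<And>z t. \<bar>\<rho> z\<bar> \<le> 2 * r \<Longrightarrow> \<bar>t\<bar> \<le> 4 * r \<Longrightarrow> \<bar>N (z + t *\<^sub>R V z) \<bullet> V z + 1\<bar> \<le> \<alpha>"
    and NN: "\<And>z t. \<bar>\<rho> z\<bar> \<le> 2 * r \<Longrightarrow> \<bar>t\<bar> \<le> 4 * r \<Longrightarrow> norm (N (z + t *\<^sub>R V z) - N z) \<le> \<alpha>"
    and NC: "\<And>z. \<bar>\<rho> z\<bar> \<le> 2 * r \<Longrightarrow> norm (N z) \<le> C"
    and VC: "\<And>z. \<bar>\<rho> z\<bar> \<le> 2 * r \<Longrightarrow> norm (V z) \<le> C"
    and V'L: "\<And>z u. \<bar>\<rho> z\<bar> \<le> 2 * r \<Longrightarrow> norm (V' z u) \<le> L * norm u" and L: "4 * r * L \<le> \<alpha>" "L \<ge> 0"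
    and D: "open D" "\<And>x. x \<in> D \<Longrightarrow> \<rho> x < 0" and F: "has_gradient_on F G D"
    and deep: "\<And>x. \<rho> x \<le> - (\<alpha> * r) \<Longrightarrow> x \<in> D \<and> F x < 1"
    and cl: "closed {x\<in>D. F x \<le> 1}"
    and close: "\<And>x. x \<in> D \<Longrightarrow> F x = 1 \<Longrightarrow> \<exists>c>0. norm (G x - c *\<^sub>R N x) \<le> \<alpha> / C * c"
  obtains g g' where "\<And>x. (g has_derivative g' x) (at x)" "\<And>v. continuous_on UNIV (\<lambda>x. g' x v)"
    "\<And>x v. norm (g' x v) \<le> 1/2 * norm v" "\<And>x. x + g x \<in> {x\<in>D. F x < 1} \<longleftrightarrow> \<rho> x < 0"
    "\<And>x. norm (g x) \<le> r * C"
proof -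
  \<comment> \<open>The numerical slack for all later comparisons: \<open>C \<ge> 2\<close> makes
    the bracket in the bound on \<alpha> at least 100.\<close>
  have \<alpha>s: "\<alpha> \<le> 1/200"
  proof -
    have "100 \<le> (6 + 26 * C) * C + 5"
      using mult_mono[of 58 "6 + 26 * C" 2 C] C by simp
    then have "\<alpha> * 100 \<le> \<alpha> * ((6 + 26 * C) * C + 5)" using \<alpha>(1) by (intro mult_left_mono) auto
    with \<alpha>(2) show ?thesis by linarith
  qed
  define A where "A = {z. \<bar>\<rho> z\<bar> < 2 * r}"
  define \<Omega>' where "\<Omega>' = {x\<in>D. F x < 1}"
  define S where "S z t = z + t *\<^sub>R V z" for z t
  have c\<rho>: "continuous_on UNIV \<rho>" and cN: "continuous_on UNIV N"
    using has_gradient_on_continuous[OF \<rho>] by auto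
  have cF: "continuous_on D F" and cG: "continuous_on D G"
    using has_gradient_on_continuous[OF F] by auto
  have cV: "continuous_on UNIV V"
    using V(1) has_derivative_continuous by (intro continuous_at_imp_continuous_on ballI) blast
  have oA: "open A" unfolding A_def by (intro open_Collect_less continuous_intros c\<rho>)
  have opF: "open (F -` B \<inter> D)" if "open B" for B
    using iffD1[OF continuous_on_open_vimage[OF D(1)] cF] that by blast
  have "\<Omega>' = F -` {..<1} \<inter> D" by (auto simp: \<Omega>'_def)
  then have o\<Omega>': "open \<Omega>'" using opF by simp
  have cl\<Omega>': "closure \<Omega>' \<subseteq> {x\<in>D. F x \<le> 1}"
    by (rule closure_minimal[OF _ cl]) (auto simp: \<Omega>'_def)
  have \<Omega>'neg: "\<rho> x < 0" if "x \<in> \<Omega>'" for x using that D(2) by (auto simp: \<Omega>'_def)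
  have cS: "continuous_on UNIV (S z)" for z unfolding S_def by (intro continuous_intros)
  have dS: "(S z has_derivative (\<lambda>t. t *\<^sub>R V z)) (at t)" for z t
    unfolding S_def by (auto intro!: derivative_eq_intros)
  have limS: "(S z \<longlongrightarrow> S z t) (at t within B)" for z t B
  proof -
    have "(S z \<longlongrightarrow> S z t) (at t within UNIV)" using cS[of z] unfolding continuous_on_def by blast
    then show ?thesis by (rule tendsto_within_subset) simp
  qed
  have d\<rho>S: "((\<lambda>t. \<rho> (S z t)) has_real_derivative N (S z t) \<bullet> V z) (at t)" for z t
  proof -
    from has_derivative_compose[OF dS has_gradient_onD[OF \<rho>]]
    have "((\<lambda>t. \<rho> (S z t)) has_derivative (\<lambda>s. N (S z t) \<bullet> (s *\<^sub>R V z))) (at t)" by simp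
    then show ?thesis unfolding has_field_derivative_def
      by (rule has_derivative_eq_rhs) (auto simp: fun_eq_iff)
  qed
  have dFS: "((\<lambda>t. F (S z t)) has_real_derivative G (S z t) \<bullet> V z) (at t)" if "S z t \<in> D" for z t
  proof -
    from has_derivative_compose[OF dS has_gradient_onD[OF F that]]
    have "((\<lambda>t. F (S z t)) has_derivative (\<lambda>s. G (S z t) \<bullet> (s *\<^sub>R V z))) (at t)" by simp
    then show ?thesis unfolding has_field_derivative_def
      by (rule has_derivative_eq_rhs) (auto simp: fun_eq_iff)
  qed
  have slope: "(1 - \<alpha>) * (s - t) \<le> \<rho> (S z t) - \<rho> (S z s)" "\<rho> (S z t) - \<rho> (S z s) \<le> (1 + \<alpha>) * (s - t)"
    if z: "\<bar>\<rho> z\<bar> \<le> 2 * r" and ts: "- 4 * r \<le> t" "t \<le> s" "s \<le> 4 * r" for z s t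
  proof -
    have "(1 - \<alpha>) * (s - t) \<le> \<rho> (S z t) - \<rho> (S z s) \<and> \<rho> (S z t) - \<rho> (S z s) \<le> (1 + \<alpha>) * (s - t)"
    proof (cases "t = s")
      case False
      then have "t < s" using ts by simp
      then obtain x where x: "t < x" "x < s" "\<rho> (S z s) - \<rho> (S z t) = (s - t) * (N (S z x) \<bullet> V z)"
        using MVT2[of t s "\<lambda>t. \<rho> (S z t)" "\<lambda>t. N (S z t) \<bullet> V z"] d\<rho>S by blast
      have "\<bar>N (S z x) \<bullet> V z + 1\<bar> \<le> \<alpha>" unfolding S_def using x ts by (intro NV z) auto
      then have b: "1 - \<alpha> \<le> - (N (S z x) \<bullet> V z)" "- (N (S z x) \<bullet> V z) \<le> 1 + \<alpha>" by linarith+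
      have "\<rho> (S z t) - \<rho> (S z s) = - (N (S z x) \<bullet> V z) * (s - t)" using x(3) by (simp add: algebra_simps)
      then show ?thesis using mult_right_mono[OF b(1), of "s - t"] mult_right_mono[OF b(2), of "s - t"] \<open>t < s\<close> by simp
    qed simp
    then show "(1 - \<alpha>) * (s - t) \<le> \<rho> (S z t) - \<rho> (S z s)" "\<rho> (S z t) - \<rho> (S z s) \<le> (1 + \<alpha>) * (s - t)" by auto
  qed
  \<comment> \<open>The time \<open>4 * r\<close> suffices to cross the collar from any
    \<open>z\<close> with \<open>\<bar>\<rho> z\<bar> \<le> 2 * r\<close> and to reach the depth
    where \<open>deep\<close> applies.\<close>
  have right: "S z (4 * r) \<in> \<Omega>'" if z: "\<bar>\<rho> z\<bar> \<le> 2 * r" for z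
  proof -
    have "(1 - \<alpha>) * (4 * r) \<le> \<rho> (S z 0) - \<rho> (S z (4 * r))" using slope(1)[OF z, of 0 "4 * r"] r by simp
    moreover have "(199/200) * (4 * r) \<le> (1 - \<alpha>) * (4 * r)" using \<alpha>s r by (intro mult_right_mono) auto
    moreover have "\<alpha> * r \<le> (1/200) * r" using \<alpha>s r by (intro mult_right_mono) auto
    moreover have "\<rho> (S z 0) = \<rho> z" by (simp add: S_def)
    ultimately have "\<rho> (S z (4 * r)) \<le> - (\<alpha> * r)" using z r by linarith
    then show ?thesis using deep by (auto simp: \<Omega>'_def)
  qed
  have left: "\<rho> (S z (- 4 * r)) > 0" if z: "\<bar>\<rho> z\<bar> \<le> 2 * r" for z
  proof -
    have "(1 - \<alpha>) * (4 * r) \<le> \<rho> (S z (- 4 * r)) - \<rho> (S z 0)" using slope(1)[OF z, of "- 4 * r" 0] r by simp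
    moreover have "(199/200) * (4 * r) \<le> (1 - \<alpha>) * (4 * r)" using \<alpha>s r by (intro mult_right_mono) auto
    moreover have "\<rho> (S z 0) = \<rho> z" by (simp add: S_def)
    ultimately show ?thesis using z r by linarith
  qed
  \<comment> \<open>The last time outside \<open>{F < 1}\<close>; that it is also the only crossing
    is shown in \<open>T\<close> below.\<close>
  define T where "T z = Sup {t \<in> {- 4 * r..4 * r}. S z t \<notin> \<Omega>'}" for z
  have bdry: "S z t \<in> D \<and> F (S z t) = 1" if "S z t \<in> closure \<Omega>'" "S z t \<notin> \<Omega>'" for z t
    using that cl\<Omega>' by (auto simp: \<Omega>'_def)
  \<comment> \<open>\<open>V\<close> is transverse to the level set of \<open>F\<close>: the
    tolerance \<open>\<alpha> / C\<close> on the gradient times the length \<open>C\<close> of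
    \<open>V\<close> costs \<alpha>, and the deviation of \<open>N\<close> along \<open>V\<close>
    costs \<alpha> again.\<close>
  have GV: "\<exists>c>0. norm (G (S z t) - c *\<^sub>R N (S z t)) \<le> \<alpha> / C * c \<and>
      \<bar>G (S z t) \<bullet> V z + c\<bar> \<le> 2 * \<alpha> * c"
    if z: "\<bar>\<rho> z\<bar> \<le> 2 * r" and t: "\<bar>t\<bar> \<le> 4 * r" and q: "S z t \<in> D" "F (S z t) = 1" for z t
  proof -
    obtain c where c: "c > 0" "norm (G (S z t) - c *\<^sub>R N (S z t)) \<le> \<alpha> / C * c"
      using close[OF q] by blast
    have "\<bar>(G (S z t) - c *\<^sub>R N (S z t)) \<bullet> V z\<bar> \<le> \<alpha> / C * c * norm (V z)" by (rule abs_inner_le[OF c(2)])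
    also have "\<dots> \<le> \<alpha> / C * c * C" using c(1) \<alpha> C VC[OF z] by (intro mult_left_mono) auto
    also have "\<dots> = \<alpha> * c" using C by simp
    finally have 1: "\<bar>G (S z t) \<bullet> V z - c * (N (S z t) \<bullet> V z)\<bar> \<le> \<alpha> * c" by (simp add: inner_diff_left)
    have "\<bar>N (S z t) \<bullet> V z + 1\<bar> \<le> \<alpha>" unfolding S_def by (rule NV[OF z t])
    then have "c * \<bar>N (S z t) \<bullet> V z + 1\<bar> \<le> c * \<alpha>" using c(1) by (intro mult_left_mono) auto
    then have "\<bar>c * (N (S z t) \<bullet> V z) + c\<bar> \<le> \<alpha> * c"
    proof -
      have "c * (N (S z t) \<bullet> V z) + c = c * (N (S z t) \<bullet> V z + 1)" by (simp add: algebra_simps)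
      with \<open>c * \<bar>N (S z t) \<bullet> V z + 1\<bar> \<le> c * \<alpha>\<close> show ?thesis
        using c(1) by (simp add: abs_mult mult.commute)
    qed
    with 1 have "\<bar>G (S z t) \<bullet> V z + c\<bar> \<le> 2 * \<alpha> * c" by linarith
    with c show ?thesis by blast
  qed
  have GVneg: "G (S z t) \<bullet> V z < 0"
    if z: "\<bar>\<rho> z\<bar> \<le> 2 * r" "\<bar>t\<bar> \<le> 4 * r" "S z t \<in> D" "F (S z t) = 1" for z t
  proof -
    obtain c where "c > 0" "\<bar>G (S z t) \<bullet> V z + c\<bar> \<le> 2 * \<alpha> * c" using GV[OF z] by blast
    moreover have "2 * \<alpha> * c < 1 * c" using \<alpha>s \<open>c > 0\<close> by (intro mult_strict_right_mono) auto
    ultimately show ?thesis by linarith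
  qed
  \<comment> \<open>\<open>F\<close> strictly decreases along \<open>V\<close> at each crossing.
    Both uniqueness and continuity of the crossing time rest on this.\<close>
  have before: "\<exists>d>0. \<forall>s. t - d < s \<and> s < t \<longrightarrow> S z s \<in> D \<and> F (S z s) > 1"
    if z: "\<bar>\<rho> z\<bar> \<le> 2 * r" "\<bar>t\<bar> \<le> 4 * r" "S z t \<in> D" "F (S z t) = 1" for z t
  proof -
    from has_real_derivative_neg_dec_left[OF dFS[OF z(3)] GVneg[OF z]]
    obtain d where d: "d > 0" "\<And>h. 0 < h \<Longrightarrow> h < d \<Longrightarrow> F (S z t) < F (S z (t - h))" by blast
    have "open (S z -` D)" using cS D(1) open_vimage by blast
    then obtain d' where d': "d' > 0" "ball t d' \<subseteq> S z -` D" using z(3) openE by blast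
    have "S z s \<in> D \<and> F (S z s) > 1" if "t - min d d' < s" "s < t" for s
      using d(2)[of "t - s"] z(4) that d'(2) by (auto simp: dist_real_def subset_iff)
    then show ?thesis using d(1) d'(1) by (intro exI[of _ "min d d'"]) auto
  qed
  have T: "- 4 * r < T z \<and> T z < 4 * r \<and> S z (T z) \<in> D \<and> F (S z (T z)) = 1 \<and>
      (\<forall>t\<in>{- 4 * r..4 * r}. S z t \<in> \<Omega>' \<longleftrightarrow> T z < t)"
    if z: "\<bar>\<rho> z\<bar> \<le> 2 * r" for z
  proof -
    define X where "X = {t \<in> {- 4 * r..4 * r}. S z t \<notin> \<Omega>'}"
    have clS: "closed (S z -` (- \<Omega>'))" using cS o\<Omega>' closed_vimage by (metis closed_Compl)
    have "X = {- 4 * r..4 * r} \<inter> S z -` (- \<Omega>')" by (auto simp: X_def)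
    then have cX: "compact X" using clS by (simp add: compact_Int_closed)
    have X0: "- 4 * r \<in> X" using left[OF z] \<Omega>'neg r by (force simp: X_def)
    have TX: "T z \<in> X"
      unfolding T_def X_def[symmetric] using closed_contains_Sup[of X] cX X0
      by (auto simp: compact_eq_bounded_closed bounded_imp_bdd_above)
    have le: "t \<le> T z" if "t \<in> X" for t
      unfolding T_def X_def[symmetric] using cX that
      by (intro cSup_upper bounded_imp_bdd_above) (auto simp: compact_eq_bounded_closed)
    have T4: "T z < 4 * r" using TX right[OF z] by (cases "T z = 4 * r") (auto simp: X_def)
    have gt: "S z t \<in> \<Omega>'" if "T z < t" "t \<le> 4 * r" for t
      using le[of t] that TX by (auto simp: X_def)
    have Tcl: "S z (T z) \<in> closure \<Omega>'"
    proof -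
  have ev: "eventually (\<lambda>t. S z t \<in> closure \<Omega>') (at_right (T z))"
        using eventually_at_right_real[OF T4]
        by (rule eventually_mono) (use gt closure_subset[of \<Omega>'] T4 in auto)
      show ?thesis
        by (rule Lim_in_closed_set[OF closed_closure ev]) (simp, rule limS)
    qed
    have TF: "S z (T z) \<in> D" "F (S z (T z)) = 1"
      using bdry[OF Tcl] TX by (auto simp: X_def)
    have Tm: "- 4 * r < T z"
      using TX left[OF z] D(2)[OF TF(1)] by (cases "T z = - 4 * r") (auto simp: X_def)
    \<comment> \<open>If the line were inside at an earlier time, the first later time outside would
      be a level point approached from inside, against \<open>before\<close>.\<close>
    have lt: "S z t \<notin> \<Omega>'" if t: "- 4 * r \<le> t" "t \<le> T z" for t
    proof
      assume tin: "S z t \<in> \<Omega>'"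
      define Y where "Y = X \<inter> {t..}"
      have cY: "compact Y" unfolding Y_def using cX by (simp add: compact_Int_closed)
      have Yne: "T z \<in> Y" using TX t by (simp add: Y_def)
      define u where "u = Inf Y"
      have uY: "u \<in> Y" unfolding u_def using closed_contains_Inf[of Y] cY Yne
        by (auto simp: compact_eq_bounded_closed bounded_imp_bdd_below)
      have ule: "u \<le> y" if "y \<in> Y" for y
        unfolding u_def using cY that by (intro cInf_lower bounded_imp_bdd_below) (auto simp: compact_eq_bounded_closed)
      have tu: "t < u" using uY tin by (cases "t = u") (auto simp: Y_def X_def)
      have u4: "\<bar>u\<bar> \<le> 4 * r" using uY by (auto simp: Y_def X_def)
      have inn: "S z s \<in> \<Omega>'" if "t \<le> s" "s < u" for s
      proof -
        have "- 4 * r \<le> s" "s \<le> 4 * r" using that t u4 by linarith+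
        then show ?thesis using ule[of s] that by (force simp: Y_def X_def)
      qed
      have ucl: "S z u \<in> closure \<Omega>'"
      proof -
  have ev: "eventually (\<lambda>t. S z t \<in> closure \<Omega>') (at_left u)"
        using eventually_at_left_real[OF tu]
        by (rule eventually_mono) (use inn closure_subset[of \<Omega>'] in auto)
      show ?thesis
        by (rule Lim_in_closed_set[OF closed_closure ev]) (simp, rule limS)
      qed
      have uF: "S z u \<in> D" "F (S z u) = 1" using bdry[OF ucl] uY by (auto simp: Y_def X_def)
      obtain d where d: "d > 0" "\<And>s. u - d < s \<Longrightarrow> s < u \<Longrightarrow> F (S z s) > 1"
        using before[OF z u4 uF] by blast
      define s where "s = max t (u - d / 2)"
      have "t \<le> s" "s < u" "u - d < s" using tu d(1) by (auto simp: s_def)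
      then show False using d(2)[of s] inn[of s] by (auto simp: \<Omega>'_def)
    qed
    show ?thesis using T4 Tm TF gt lt by (force simp: not_less)
  qed
  have Tabs: "\<bar>T z\<bar> \<le> 4 * r" if "\<bar>\<rho> z\<bar> \<le> 2 * r" for z using T[OF that] by linarith
  \<comment> \<open>At the crossing \<open>\<rho>\<close> is between \<open>- (\<alpha> * r)\<close>
    and 0, which costs \<open>\<alpha> * r\<close>; the speed error over a time of at most
    \<open>4 * r\<close> costs \<open>4 * r * \<alpha>\<close>.\<close>
  have T\<rho>: "\<bar>T z - \<rho> z\<bar> \<le> 5 * r * \<alpha>" if z: "\<bar>\<rho> z\<bar> \<le> 2 * r" for z
  proof -
    have b: "- (\<alpha> * r) < \<rho> (S z (T z))" "\<rho> (S z (T z)) < 0"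
      using T[OF z] deep[of "S z (T z)"] D(2) by force+
    have T4: "\<bar>T z\<bar> \<le> 4 * r" using T[OF z] by auto
    have "\<alpha> * \<bar>T z\<bar> \<le> \<alpha> * (4 * r)" using T4 \<alpha>(1) by (intro mult_left_mono) auto
    moreover have "\<bar>\<rho> z - \<rho> (S z (T z)) - T z\<bar> \<le> \<alpha> * \<bar>T z\<bar>"
    proof (cases "T z \<ge> 0")
      case True
      then show ?thesis using slope[OF z, of 0 "T z"] T4 r by (simp add: S_def algebra_simps abs_le_iff)
    next
      case False
      then show ?thesis using slope[OF z, of "T z" 0] T4 r by (simp add: S_def algebra_simps abs_le_iff)
    qed
    ultimately show ?thesis using b by (simp add: algebra_simps abs_le_iff)
  qed
  \<comment> \<open>The lower bound on nearby times comes from \<open>before\<close>, since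
    \<open>F > 1\<close> is an open condition; the upper bound from openness of
    \<open>{F < 1}\<close>.\<close>
  have cT: "continuous (at z) T" if z: "z \<in> A" for z
  proof -
    have z2: "\<bar>\<rho> z\<bar> \<le> 2 * r" using z by (simp add: A_def)
    have cSt: "continuous (at z) (\<lambda>z. S z t)" for t
      unfolding S_def using cV by (intro continuous_intros) (simp add: continuous_on_eq_continuous_at)
    have "(T \<longlongrightarrow> T z) (at z)"
      unfolding order_tendsto_iff
    proof (intro conjI allI impI)
      have evA: "eventually (\<lambda>y. y \<in> A) (at z)" using oA z by (simp add: eventually_at_in_open')
      fix l
      {
        assume l: "l < T z"
        obtain d where d: "d > 0" "\<And>s. T z - d < s \<Longrightarrow> s < T z \<Longrightarrow> S z s \<in> D \<and> F (S z s) > 1"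
          using before[OF z2 Tabs[OF z2]] T[OF z2] by blast
        define s where "s = max (max l (- 4 * r)) (T z - d / 2)"
        have s: "l \<le> s" "- 4 * r \<le> s" "s < T z" "T z - d < s" using l d(1) T[OF z2] by (auto simp: s_def)
        have "S z s \<in> F -` {1<..} \<inter> D" using d(2)[of s] s by auto
        then have "eventually (\<lambda>y. S y s \<in> F -` {1<..} \<inter> D) (at z)"
          using cSt[of s] opF[of "{1<..}"] by (auto simp: continuous_within dest: topological_tendstoD)
        with evA show "eventually (\<lambda>y. l < T y) (at z)"
        proof eventually_elim
          case (elim y)
          then have "S y s \<notin> \<Omega>'" by (auto simp: \<Omega>'_def)
          moreover have "s \<in> {- 4 * r..4 * r}" using s T[OF z2] by auto
          ultimately have "\<not> T y < s" using T[of y] elim(1) by (auto simp: A_def)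
          moreover have "T y \<noteq> s" using T[of y] elim by (auto simp: A_def)
          ultimately show ?case using s by linarith
        qed
      next
        assume l: "T z < l"
        define s where "s = min ((T z + l) / 2) (4 * r)"
        have "s \<le> (T z + l) / 2" unfolding s_def by (rule min.cobounded1)
        then have sl: "s < l" using l by (simp add: field_simps)
        have s: "s < l" "s \<le> 4 * r" "T z < s" using sl l T[OF z2] by (auto simp: s_def)
        then have "S z s \<in> \<Omega>'" using T[OF z2] by auto
        then have "eventually (\<lambda>y. S y s \<in> \<Omega>') (at z)"
          using cSt[of s] o\<Omega>' by (auto simp: continuous_within dest: topological_tendstoD)
        with evA show "eventually (\<lambda>y. T y < l) (at z)"
        proof eventually_elim
          case (elim y)
          have "s \<in> {- 4 * r..4 * r}" using s T[OF z2] by auto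
          then have "T y < s" using T[of y] elim by (auto simp: A_def)
          then show ?case using s by linarith
        qed
      }
    qed
    then show ?thesis by (simp add: continuous_within)
  qed
  \<comment> \<open>Implicit differentiation of \<open>F (z + T z *\<^sub>R V z) = 1\<close> in the
    direction \<open>u\<close>.\<close>
  define \<theta> where "\<theta> z u = - (G (S z (T z)) \<bullet> (u + T z *\<^sub>R V' z u)) / (G (S z (T z)) \<bullet> V z)" for z u
  have dT: "(T has_derivative \<theta> z) (at z)" if z: "z \<in> A" for z
  proof -
    have z2: "\<bar>\<rho> z\<bar> \<le> 2 * r" using z by (simp add: A_def)
    define \<Phi> where "\<Phi> = (\<lambda>(z, t). F (S z t))"
    define E where "E = (\<lambda>(u, t). G (S z (T z)) \<bullet> (u + (T z *\<^sub>R V' z u + t *\<^sub>R V z)))"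
    have "((\<lambda>p. V (fst p)) has_derivative (\<lambda>p. V' z (fst p))) (at (z, T z))"
      by (rule has_derivative_compose[of fst fst]) (auto intro!: derivative_eq_intros V(1))
    then have "((\<lambda>p. fst p + snd p *\<^sub>R V (fst p)) has_derivative
        (\<lambda>p. fst p + (T z *\<^sub>R V' z (fst p) + snd p *\<^sub>R V z))) (at (z, T z))"
      by (auto intro!: derivative_eq_intros)
    moreover have "(F has_derivative (\<lambda>v. G (S z (T z)) \<bullet> v)) (at (fst (z, T z) + snd (z, T z) *\<^sub>R V (fst (z, T z))))"
      using has_gradient_onD[OF F, of "S z (T z)"] T[OF z2] by (simp add: S_def)
    ultimately have "((\<lambda>p. F (fst p + snd p *\<^sub>R V (fst p))) has_derivative
        (\<lambda>p. G (S z (T z)) \<bullet> (fst p + (T z *\<^sub>R V' z (fst p) + snd p *\<^sub>R V z)))) (at (z, T z))"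
      by (rule has_derivative_compose)
    then have "(\<Phi> has_derivative E) (at (z, T z))"
      by (simp add: \<Phi>_def E_def S_def case_prod_beta')
    moreover have "eventually (\<lambda>x. \<Phi> (x, T x) = \<Phi> (z, T z)) (nhds z)"
      using eventually_nhds_in_open[OF oA z]
    proof eventually_elim
      case (elim x)
      then show ?case using T[of x] T[OF z2] by (auto simp: \<Phi>_def A_def)
    qed
    moreover interpret V': linear "V' z" using V(1) has_derivative_linear by blast
    have "E (0, 1) = G (S z (T z)) \<bullet> V z" by (simp add: E_def V'.zero)
    moreover have "G (S z (T z)) \<bullet> V z < 0" using GVneg[OF z2 Tabs[OF z2]] T[OF z2] by auto
    ultimately have "(T has_derivative (\<lambda>u. - E (u, 0) / E (0, 1))) (at z)"
      using cT[OF z] by (intro implicit_has_derivative) auto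
    then show ?thesis using \<open>E (0, 1) = _\<close> by (simp add: E_def \<theta>_def[abs_def])
  qed
  define P where "P z = (\<Sum>b\<in>Basis. \<theta> z b *\<^sub>R b)" for z
  have P\<theta>: "P z \<bullet> v = \<theta> z v" if "z \<in> A" for z v
    unfolding P_def using has_derivative_imp_gradient[OF dT[OF that]] by metis
  have gT: "has_gradient_on T P A"
    unfolding has_gradient_on_def
  proof (intro conjI ballI)
    show "(T has_derivative (\<lambda>v. P z \<bullet> v)) (at z)" if "z \<in> A" for z
      using dT[OF that] P\<theta>[OF that] by (simp add: fun_eq_iff has_derivative_eq_rhs)
    have cTA: "continuous_on A T" using cT by (auto intro: continuous_at_imp_continuous_on)
    have cST: "continuous_on A (\<lambda>z. S z (T z))"
      unfolding S_def by (intro continuous_intros cTA continuous_on_subset[OF cV]) auto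
    have "continuous_on A (\<lambda>z. G (S z (T z)))"
      by (rule continuous_on_compose2[OF cG cST]) (use T in \<open>auto simp: A_def\<close>)
    moreover have "G (S z (T z)) \<bullet> V z \<noteq> 0" if "z \<in> A" for z
      using GVneg[of z "T z"] T[of z] Tabs[of z] that by (auto simp: A_def)
    ultimately show "continuous_on A P"
      unfolding P_def \<theta>_def
      by (intro continuous_intros cTA continuous_on_subset[OF cV] continuous_on_subset[OF V(2)]) auto
  qed
  \<comment> \<open>With equal normals, unit speed and constant \<open>V\<close> the vector
    \<open>P z\<close> would be \<open>N z\<close>. The errors in the numerator add up to
    \<open>c * \<alpha> * (3 + 3 * C)\<close>, the denominator is at least \<open>c / 2\<close>, and
    the unknown factor \<open>c\<close> cancels.\<close>
  have est: "norm (P z - N z) \<le> \<alpha> * (6 + 6 * C)" if z: "z \<in> A" for z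
  proof -
    have z2: "\<bar>\<rho> z\<bar> \<le> 2 * r" using z by (simp add: A_def)
    have T4: "\<bar>T z\<bar> \<le> 4 * r" by (rule Tabs[OF z2])
    let ?q = "S z (T z)"
    obtain c where c: "c > 0" "norm (G ?q - c *\<^sub>R N ?q) \<le> \<alpha> / C * c"
      "\<bar>G ?q \<bullet> V z + c\<bar> \<le> 2 * \<alpha> * c"
      using GV[OF z2 T4] T[OF z2] by blast
    have bnd: "\<bar>(P z - N z) \<bullet> u\<bar> \<le> \<alpha> * (6 + 6 * C) * norm u" for u
    proof -
      let ?y = "u + T z *\<^sub>R V' z u"
      let ?d = "- (G ?q \<bullet> V z)"
      have yu: "norm (?y - u) \<le> \<alpha> * norm u"
      proof -
        have "norm (?y - u) = \<bar>T z\<bar> * norm (V' z u)" by simp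
        also have "\<dots> \<le> 4 * r * (L * norm u)" using T4 V'L[OF z2] r by (intro mult_mono) auto
        also have "\<dots> = (4 * r * L) * norm u" by simp
        also have "\<dots> \<le> \<alpha> * norm u" using L by (intro mult_right_mono) auto
        finally show ?thesis .
      qed
      moreover have "\<alpha> * norm u \<le> 1 * norm u" using \<alpha>s by (intro mult_right_mono) auto
      ultimately have y2: "norm ?y \<le> 2 * norm u"
        using norm_triangle_sub[of ?y u] by linarith
      have "\<bar>(N ?q - N z) \<bullet> ?y\<bar> \<le> \<alpha> * norm ?y"
        by (rule abs_inner_le) (use NN[OF z2 T4] in \<open>simp add: S_def\<close>)
      also have "\<dots> \<le> \<alpha> * (2 * norm u)" using y2 \<alpha> by (intro mult_left_mono) auto
      finally have 1: "\<bar>(N ?q - N z) \<bullet> ?y\<bar> \<le> 2 * \<alpha> * norm u" by simp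
      have "\<bar>N z \<bullet> (?y - u)\<bar> \<le> C * norm (?y - u)" by (rule abs_inner_le[OF NC[OF z2]])
      also have "\<dots> \<le> C * (\<alpha> * norm u)" using yu C by (intro mult_left_mono) auto
      finally have 2: "\<bar>N z \<bullet> (?y - u)\<bar> \<le> \<alpha> * C * norm u" by (simp add: mult_ac)
      have "N ?q \<bullet> y - N z \<bullet> u = (N ?q - N z) \<bullet> y + N z \<bullet> (y - u)" for y
        by (simp add: inner_diff_left inner_diff_right)
      then have "N ?q \<bullet> ?y - N z \<bullet> u = (N ?q - N z) \<bullet> ?y + N z \<bullet> (?y - u)" .
      with 1 2 have "\<bar>N ?q \<bullet> ?y - N z \<bullet> u\<bar> \<le> \<alpha> * (2 + C) * norm u" by (simp add: algebra_simps)
      then have "c * \<bar>N ?q \<bullet> ?y - N z \<bullet> u\<bar> \<le> c * (\<alpha> * (2 + C) * norm u)"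
        using c(1) by (intro mult_left_mono) auto
      then have 3: "\<bar>c * (N ?q \<bullet> ?y - N z \<bullet> u)\<bar> \<le> c * (\<alpha> * (2 + C) * norm u)"
        using c(1) by (simp add: abs_mult)
      have "\<bar>(G ?q - c *\<^sub>R N ?q) \<bullet> ?y\<bar> \<le> \<alpha> / C * c * norm ?y" by (rule abs_inner_le[OF c(2)])
      also have "\<dots> \<le> \<alpha> / C * c * (2 * norm u)" using y2 \<alpha> C c by (intro mult_left_mono) auto
      also have "\<dots> = \<alpha> * c * norm u * (2 / C)" by simp
      also have "\<dots> \<le> \<alpha> * c * norm u * 1" using C c(1) \<alpha>(1) by (intro mult_left_mono) auto
      finally have 4: "\<bar>(G ?q - c *\<^sub>R N ?q) \<bullet> ?y\<bar> \<le> c * (\<alpha> * norm u)" by (simp add: mult_ac)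
      have "\<bar>c - ?d\<bar> * \<bar>N z \<bullet> u\<bar> \<le> (2 * \<alpha> * c) * (C * norm u)"
        using c abs_inner_le[OF NC[OF z2], of u] by (intro mult_mono) auto
      then have 5: "\<bar>(c - ?d) * (N z \<bullet> u)\<bar> \<le> c * (2 * \<alpha> * C * norm u)" by (simp add: abs_mult mult_ac)
      have "G ?q \<bullet> ?y - ?d * (N z \<bullet> u) = c * (N ?q \<bullet> ?y - N z \<bullet> u) + (G ?q - c *\<^sub>R N ?q) \<bullet> ?y + (c - ?d) * (N z \<bullet> u)"
        by (simp add: inner_diff_left algebra_simps)
      with 3 4 5 have X: "\<bar>G ?q \<bullet> ?y - ?d * (N z \<bullet> u)\<bar> \<le> c * (\<alpha> * (3 + 3 * C) * norm u)"
        by (simp add: algebra_simps)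
      have d: "?d \<ge> c / 2"
      proof -
        have "2 * \<alpha> * c \<le> (1/2) * c" using \<alpha>s c(1) by (intro mult_right_mono) auto
        with c(3) show ?thesis by linarith
      qed
      then have d0: "?d > 0" using c(1) by linarith
      have "(P z - N z) \<bullet> u = (G ?q \<bullet> ?y) / ?d - N z \<bullet> u"
        by (simp add: inner_diff_left P\<theta>[OF z] \<theta>_def)
      also have "\<dots> = (G ?q \<bullet> ?y - ?d * (N z \<bullet> u)) / ?d"
        using d0 by (simp add: field_simps)
      finally have "\<bar>(P z - N z) \<bullet> u\<bar> = \<bar>G ?q \<bullet> ?y - ?d * (N z \<bullet> u)\<bar> / ?d"
        using d0 by (simp add: abs_divide)
      also have "\<dots> \<le> c * (\<alpha> * (3 + 3 * C) * norm u) / (c / 2)"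
        using X d c(1) \<alpha>(1) C by (intro frac_le) auto
      also have "\<dots> = \<alpha> * (6 + 6 * C) * norm u" using c(1) by (simp add: field_simps)
      finally show ?thesis .
    qed
    show ?thesis by (rule norm_le_of_inner_bound[OF bnd]) (use \<alpha> C in auto)
  qed
  \<comment> \<open>Equal to 1 on the boundary and different from 1 only to second order in
    \<open>\<rho> z / r\<close>; \<open>key\<close> below exploits this flatness.\<close>
  define kap where "kap z = (max 0 (1 - (1 / r\<^sup>2) * (\<rho> z * \<rho> z)))\<^sup>2" for z
  define kap' where "kap' z = (2 * max 0 (1 - (1 / r\<^sup>2) * (\<rho> z * \<rho> z))) *\<^sub>R (0 - (1 / r\<^sup>2) *\<^sub>R (\<rho> z *\<^sub>R N z + \<rho> z *\<^sub>R N z))" for z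
  have gkap: "has_gradient_on kap kap' UNIV"
    unfolding kap_def kap'_def
    by (intro has_gradient_on_max_power2 has_gradient_on_diff has_gradient_on_const has_gradient_on_cmult
        has_gradient_on_mult \<rho>)
  define S0 where "S0 = {z. \<bar>\<rho> z\<bar> \<le> r}"
  have clS0: "closed S0" unfolding S0_def by (intro closed_Collect_le continuous_intros c\<rho>)
  have S0A: "S0 \<subseteq> A" using r by (auto simp: S0_def A_def)
  have out: "kap z = 0 \<and> kap' z = 0" if "z \<notin> S0" for z
  proof -
    have "r\<^sup>2 \<le> \<bar>\<rho> z\<bar>\<^sup>2" using that r by (intro power_mono) (auto simp: S0_def)
    then have "(1 / r\<^sup>2) * (\<rho> z * \<rho> z) \<ge> 1" using r by (simp add: power2_eq_square)
    then show ?thesis by (simp add: kap_def kap'_def)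
  qed
  define u where "u z = kap z * (T z - \<rho> z)" for z
  define u' where "u' z = kap z *\<^sub>R (P z - N z) + (T z - \<rho> z) *\<^sub>R kap' z" for z
  have gu: "has_gradient_on u u' UNIV"
    unfolding u_def u'_def
    by (rule has_gradient_on_cutoff[OF has_gradient_on_diff[OF gT has_gradient_on_subset[OF \<rho>]] gkap oA clS0 S0A out]) auto
  have kap01: "0 \<le> kap z" "kap z \<le> 1" for z
    unfolding kap_def using r by (auto simp: power_le_one_iff max_def)
  have u0: "u z = 0" "u' z = 0" if "z \<notin> S0" for z using out[OF that] by (auto simp: u_def u'_def)
  have ub: "\<bar>u z\<bar> \<le> 5 * r * \<alpha>" if "z \<in> S0" for z
  proof -
    have "\<bar>u z\<bar> \<le> 1 * \<bar>T z - \<rho> z\<bar>"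
      unfolding u_def abs_mult using kap01[of z] by (intro mult_right_mono) auto
    also have "\<bar>T z - \<rho> z\<bar> \<le> 5 * r * \<alpha>" by (rule T\<rho>) (use that r in \<open>auto simp: S0_def\<close>)
    finally show ?thesis by simp
  qed
  \<comment> \<open>\<open>6 + 6 * C\<close> is \<open>est\<close>; the other \<open>20 * C\<close>
    is the bound \<open>5 * r * \<alpha>\<close> on \<open>T z - \<rho> z\<close> times the bound
    \<open>4 * C / r\<close> on the gradient of the cutoff, in which \<open>r\<close>
    cancels.\<close>
  have u'b: "norm (u' z) \<le> \<alpha> * (6 + 26 * C)" if z: "z \<in> S0" for z
  proof -
    have z2: "\<bar>\<rho> z\<bar> \<le> 2 * r" using z r by (auto simp: S0_def)
    have "norm (kap z *\<^sub>R (P z - N z)) \<le> 1 * (\<alpha> * (6 + 6 * C))"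
      unfolding norm_scaleR using kap01[of z] est[of z] S0A z by (intro mult_mono) auto
    moreover have "norm (kap' z) \<le> 4 * C / r"
    proof -
      have "kap' z = (2 * max 0 (1 - (1 / r\<^sup>2) * (\<rho> z * \<rho> z))) *\<^sub>R ((- 2 * \<rho> z / r\<^sup>2) *\<^sub>R N z)"
        unfolding kap'_def by (simp add: scaleR_add_left[symmetric])
      then have "norm (kap' z) = (2 * max 0 (1 - (1 / r\<^sup>2) * (\<rho> z * \<rho> z))) * (2 * \<bar>\<rho> z\<bar> / r\<^sup>2 * norm (N z))"
        by (simp add: abs_mult)
      also have "\<dots> \<le> 2 * (2 * r / r\<^sup>2 * C)"
        using z r NC[OF z2] C by (intro mult_mono divide_right_mono) (auto simp: S0_def)
      finally show ?thesis using r by (simp add: power2_eq_square field_simps)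
    qed
    then have "norm ((T z - \<rho> z) *\<^sub>R kap' z) \<le> (5 * r * \<alpha>) * (4 * C / r)"
      unfolding norm_scaleR using T\<rho>[OF z2] r \<alpha> by (intro mult_mono) auto
    then have "norm ((T z - \<rho> z) *\<^sub>R kap' z) \<le> \<alpha> * (20 * C)" using r by (simp add: mult_ac)
    ultimately show ?thesis unfolding u'_def
      using norm_triangle_ineq[of "kap z *\<^sub>R (P z - N z)" "(T z - \<rho> z) *\<^sub>R kap' z"] by (simp add: algebra_simps)
  qed
  define g where "g z = u z *\<^sub>R V z" for z
  define g' where "g' z v = u z *\<^sub>R V' z v + (u' z \<bullet> v) *\<^sub>R V z" for z v
  have "(g has_derivative g' x) (at x)" for x
    unfolding g_def g'_def by (intro has_derivative_scaleR has_gradient_onD[OF gu] V(1)) simp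
  moreover have "continuous_on UNIV (\<lambda>x. g' x v)" for v
    unfolding g'_def by (intro continuous_intros has_gradient_on_continuous[OF gu] V(2) cV)
  moreover have "norm (g' x v) \<le> 1/2 * norm v" for x v
  proof (cases "x \<in> S0")
    case False
    then show ?thesis by (simp add: g'_def u0)
  next
    case True
    then have x2: "\<bar>\<rho> x\<bar> \<le> 2 * r" using r by (auto simp: S0_def)
    have "norm (u x *\<^sub>R V' x v) \<le> (5 * r * \<alpha>) * (L * norm v)"
      unfolding norm_scaleR using ub[OF True] V'L[OF x2] r \<alpha> by (intro mult_mono) auto
    also have "\<dots> = \<alpha> * ((5 * r * L) * norm v)" by simp
    also have "\<dots> \<le> \<alpha> * (5 * norm v)"
      using L \<alpha> \<alpha>s r by (intro mult_left_mono mult_right_mono) auto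
    finally have 1: "norm (u x *\<^sub>R V' x v) \<le> \<alpha> * 5 * norm v" by simp
    have "norm ((u' x \<bullet> v) *\<^sub>R V x) \<le> (\<alpha> * (6 + 26 * C) * norm v) * C"
      unfolding norm_scaleR using abs_inner_le[OF u'b[OF True], of v] VC[OF x2] \<alpha> C by (intro mult_mono) auto
    with 1 have "norm (g' x v) \<le> (\<alpha> * ((6 + 26 * C) * C + 5)) * norm v"
      unfolding g'_def using norm_triangle_ineq[of "u x *\<^sub>R V' x v" "(u' x \<bullet> v) *\<^sub>R V x"] by (simp add: algebra_simps)
    also have "\<dots> \<le> 1/2 * norm v" using \<alpha>(2) by (rule mult_right_mono) simp
    finally show ?thesis .
  qed
  moreover have "x + g x \<in> {x\<in>D. F x < 1} \<longleftrightarrow> \<rho> x < 0" for x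
  proof (cases "x \<in> S0")
    case False
    have "\<rho> x < 0 \<Longrightarrow> \<rho> x \<le> - (\<alpha> * r)"
    proof -
      assume "\<rho> x < 0"
      then have "\<rho> x < - r" using False by (auto simp: S0_def)
      moreover have "\<alpha> * r \<le> 1 * r" using \<alpha>s r by (intro mult_right_mono) auto
      ultimately show ?thesis by linarith
    qed
    then show ?thesis using False deep[of x] D(2)[of x] by (auto simp: g_def u0)
  next
    case True
    then have x2: "\<bar>\<rho> x\<bar> \<le> 2 * r" using r by (auto simp: S0_def)
    define m where "m = 5 * r * \<alpha>"
    have m: "\<bar>T x - \<rho> x\<bar> \<le> m" unfolding m_def by (rule T\<rho>[OF x2])
    have mr: "m \<le> r / 3" using mult_left_mono[OF \<alpha>s, of "5 * r"] r by (simp add: m_def)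
    have "\<bar>u x\<bar> \<le> 4 * r" using ub[OF True] mr r unfolding m_def by linarith
    then have "u x \<in> {- 4 * r..4 * r}" by auto
    then have "x + g x \<in> {x\<in>D. F x < 1} \<longleftrightarrow> T x < u x"
      using T[OF x2] by (simp add: g_def S_def \<Omega>'_def)
    also have "\<dots> \<longleftrightarrow> \<rho> x < 0"
    proof -
      have eq: "u x - T x = - ((1 - kap x) * T x) - kap x * \<rho> x" by (simp add: u_def algebra_simps)
      \<comment> \<open>The two terms of \<open>eq\<close> compete only if \<open>T x\<close> and
        \<open>\<rho> x\<close> differ in sign. Then both are at most \<open>m \<le> r / 3\<close>
        in size, and \<open>1 - kap x\<close> is quadratically small.\<close>
      have key: "(1 - kap x) * \<bar>T x\<bar> < kap x * \<bar>\<rho> x\<bar>" if "\<bar>\<rho> x\<bar> \<le> m" "\<bar>T x\<bar> \<le> m" "\<rho> x \<noteq> 0"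
      proof -
        define s where "s = \<bar>\<rho> x\<bar> / r"
        have s: "0 < s" "s \<le> 1/3" using that mr r by (auto simp: s_def field_simps)
        have s2: "s * s \<le> 1/3 * (1/3)" using s by (intro mult_mono) auto
        have "(1 / r\<^sup>2) * (\<rho> x * \<rho> x) = s * s" by (simp add: s_def power2_eq_square)
        then have chi: "kap x = (1 - s * s)\<^sup>2" unfolding kap_def using s2 by (simp add: max_def)
        have c1: "1 - kap x \<le> 2 * (s * s)" 
        proof -
          have "1 - (1 - s * s)\<^sup>2 = 2 * (s * s) - (s * s) * (s * s)" by (simp add: power2_eq_square algebra_simps)
          moreover have "0 \<le> (s * s) * (s * s)" by simp
          ultimately show ?thesis unfolding chi by linarith
        qed
        then have c2: "kap x \<ge> 7/9" using s2 by linarith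
        have "(1 - kap x) * \<bar>T x\<bar> \<le> (2 * (s * s)) * (r / 3)"
          using c1 that(2) mr kap01[of x] s by (intro mult_mono) auto
        also have "\<dots> = (2/3 * s) * (s * r)" by simp
        also have "\<dots> \<le> (2/9) * (s * r)" using s r by (intro mult_right_mono) auto
        also have "\<dots> < (7/9) * (s * r)" using s r by simp
        also have "\<dots> \<le> kap x * (s * r)" using c2 s r by (intro mult_right_mono) auto
        finally show ?thesis using r by (simp add: s_def)
      qed
      consider "\<rho> x = 0" | "\<rho> x < 0" "T x < 0" | "\<rho> x > 0" "T x > 0" | "\<rho> x < 0" "T x \<ge> 0" | "\<rho> x > 0" "T x \<le> 0"
        by linarith
      then show ?thesis
      proof cases
        case 1
        then show ?thesis by (simp add: u_def kap_def)
      next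
        case 2
        have "(1 - kap x) * T x \<le> 0" using 2 kap01[of x] by (simp add: mult_nonneg_nonpos)
        moreover have "kap x * \<rho> x \<le> 0" using 2 kap01[of x] by (simp add: mult_nonneg_nonpos)
        moreover have "kap x = 0 \<or> kap x * \<rho> x < 0" using 2 kap01[of x] by (auto simp: mult_less_0_iff)
        ultimately have "T x < u x" using eq 2(2) by (elim disjE) (simp, linarith)
        then show ?thesis using 2 by simp
      next
        case 3
        have "(1 - kap x) * T x \<ge> 0" "kap x * \<rho> x \<ge> 0" using 3 kap01[of x] by auto
        then show ?thesis using eq 3 by linarith
      next
        case 4
        then have "(1 - kap x) * \<bar>T x\<bar> < kap x * \<bar>\<rho> x\<bar>" using m by (intro key) auto
        then have "(1 - kap x) * T x < - (kap x * \<rho> x)" using 4 by simp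
        then show ?thesis using eq 4 by linarith
      next
        case 5
        then have "(1 - kap x) * \<bar>T x\<bar> < kap x * \<bar>\<rho> x\<bar>" using m by (intro key) auto
        then have "- ((1 - kap x) * T x) < kap x * \<rho> x" using 5 by simp
        then show ?thesis using eq 5 by linarith
      qed
    qed
    finally show ?thesis .
  qed
  moreover have "norm (g x) \<le> r * C" for x
  proof (cases "x \<in> S0")
    case False then show ?thesis using r C by (simp add: g_def u0)
  next
    case True
    have "5 * r * \<alpha> \<le> r" using mult_left_mono[OF \<alpha>s, of "5 * r"] r by simp
    then have "\<bar>u x\<bar> \<le> r" using ub[OF True] by linarith
    then show ?thesis unfolding g_def norm_scaleR
      using VC[of x] True r C by (intro mult_mono) (auto simp: S0_def)
  qed
  ultimately show ?thesis by (rule that)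
qed

text \<open>All constants are found from \<open>\<rho>\<close> and \<epsilon> before
  \<open>D\<close>, \<open>F\<close> and \<open>G\<close> appear, because the approximating
  functions are selected later in dependence on them. The conditions on \<open>N\<close> and
  \<open>V\<close> in \<open>isotopy_along_transverse_field\<close> hold strictly on the boundary at
  time 0, so by compactness they persist in a collar for short times.\<close>

lemma isotopy_of_close_hypersurface:
  fixes \<rho> :: "'a::euclidean_space \<Rightarrow> real"
  assumes \<rho>: "has_gradient_on \<rho> N UNIV" and nz: "\<forall>x. \<rho> x = 0 \<longrightarrow> N x \<noteq> 0"
    and r0: "r0 > 0" "compact {x. \<bar>\<rho> x\<bar> \<le> r0}" and \<epsilon>: "\<epsilon> > 0"
  shows "\<exists>\<alpha>>0. \<exists>r1>0. \<forall>D F G. open D \<longrightarrow> (\<forall>x\<in>D. \<rho> x < 0) \<longrightarrow> has_gradient_on F G D \<longrightarrow>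
      (\<forall>x. \<rho> x \<le> - r1 \<longrightarrow> x \<in> D \<and> F x < 1) \<longrightarrow> closed {x\<in>D. F x \<le> 1} \<longrightarrow>
      (\<forall>x\<in>D. F x = 1 \<longrightarrow> (\<exists>c>0. norm (G x - c *\<^sub>R N x) \<le> \<alpha> * c)) \<longrightarrow>
      (\<exists>h. ambient_C1_isotopy h {x. \<rho> x < 0} {x\<in>D. F x < 1} \<and>
         (\<forall>s\<in>{0..1}. \<forall>z. norm (h s z - z) < \<epsilon>))"
proof -
  define M0 where "M0 = {x. \<bar>\<rho> x\<bar> \<le> r0}"
  define Z where "Z = {x. \<rho> x = 0}"
  have c\<rho>: "continuous_on UNIV \<rho>" and cN: "continuous_on UNIV N"
    using has_gradient_on_continuous[OF \<rho>] by auto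
  have "closed Z" unfolding Z_def by (intro closed_Collect_eq continuous_intros c\<rho>)
  moreover have ZM: "Z \<subseteq> M0" using r0 by (auto simp: Z_def M0_def)
  ultimately have Zc: "compact Z" using r0(2) unfolding M0_def by (metis compact_Int_closed inf.absorb_iff2)
  \<comment> \<open>The normal scaled to slope -1, the ideal choice of \<open>V\<close>. It is only
    continuous, whereas the isotopy needs a C^1 field; hence the polynomial approximation
    below.\<close>
  define W where "W x = (- 1 / (N x \<bullet> N x)) *\<^sub>R N x" for x
  have cW: "continuous_on Z W"
    unfolding W_def by (intro continuous_intros continuous_on_subset[OF cN]) (use nz in \<open>auto simp: Z_def\<close>)
  have NW: "N x \<bullet> W x = - 1" if "x \<in> Z" for x
    using nz[rule_format, of x] that by (simp add: W_def Z_def)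
  have "bounded (N ` M0)" "bounded (W ` Z)"
    using r0(2) Zc cW continuous_on_subset[OF cN] by (auto simp: M0_def intro!: compact_imp_bounded compact_continuous_image)
  then obtain C1 C2 where C12: "\<And>x. x \<in> M0 \<Longrightarrow> norm (N x) \<le> C1" "\<And>x. x \<in> Z \<Longrightarrow> norm (W x) \<le> C2"
    unfolding bounded_iff by (metis imageI)
  \<comment> \<open>The reserve of 2 over the bound for \<open>W\<close> leaves room for its
    approximation \<open>V\<close>.\<close>
  define C where "C = \<bar>C1\<bar> + \<bar>C2\<bar> + 2"
  have C: "C \<ge> 2" "\<And>x. x \<in> M0 \<Longrightarrow> norm (N x) \<le> C" "\<And>x. x \<in> Z \<Longrightarrow> norm (W x) \<le> C - 2"
    using C12 by (force simp: C_def)+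
  define k where "k = (6 + 26 * C) * C + 5"
  have k: "k \<ge> 5" using C(1) by (simp add: k_def)
  define \<alpha> where "\<alpha> = 1 / (2 * k)"
  have \<alpha>: "\<alpha> > 0" "\<alpha> * k \<le> 1/2" "\<alpha> \<le> 1" using k by (auto simp: \<alpha>_def field_simps)
  obtain V where pV: "polynomial_function V" and V: "\<And>x. x \<in> Z \<Longrightarrow> norm (W x - V x) < \<alpha> / (2 * C)"
    using Stone_Weierstrass_polynomial_function[OF Zc cW, of "\<alpha> / (2 * C)"] \<alpha> C by auto
  obtain V' where V': "\<And>x. (V has_derivative V' x) (at x)" "\<And>v. continuous_on UNIV (\<lambda>x. V' x v)"
    using polynomial_function_C1[OF pV] by blast
  have cV: "continuous_on UNIV V"
    using V'(1) has_derivative_continuous by (intro continuous_at_imp_continuous_on ballI) blast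
  have "\<exists>B. \<forall>x\<in>M0. norm (V' x b) \<le> B" for b
  proof -
    have "bounded ((\<lambda>x. V' x b) ` M0)"
      using r0(2) continuous_on_subset[OF V'(2)] by (auto simp: M0_def intro!: compact_imp_bounded compact_continuous_image)
    then show ?thesis unfolding bounded_iff by blast
  qed
  then obtain B where B: "\<And>x b. x \<in> M0 \<Longrightarrow> norm (V' x b) \<le> B b" by metis
  define L where "L = (\<Sum>b\<in>Basis. \<bar>B b\<bar>)"
  have L0: "L \<ge> 0" unfolding L_def by (intro sum_nonneg) simp
  have L: "norm (V' x u) \<le> L * norm u" if x: "x \<in> M0" for x u
  proof -
    interpret V': linear "V' x" using V'(1) has_derivative_linear by blast
    have "V' x u = V' x (\<Sum>b\<in>Basis. (u \<bullet> b) *\<^sub>R b)" by (simp add: euclidean_representation)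
    also have "\<dots> = (\<Sum>b\<in>Basis. (u \<bullet> b) *\<^sub>R V' x b)" by (simp add: V'.sum V'.scale)
    finally have "norm (V' x u) \<le> (\<Sum>b\<in>Basis. norm ((u \<bullet> b) *\<^sub>R V' x b))" by (metis norm_sum)
    also have "\<dots> \<le> (\<Sum>b\<in>Basis. norm u * \<bar>B b\<bar>)"
    proof (rule sum_mono)
      fix b :: 'a assume b: "b \<in> Basis"
      have "norm (V' x b) \<le> \<bar>B b\<bar>" using B[OF x, of b] by linarith
      then show "norm ((u \<bullet> b) *\<^sub>R V' x b) \<le> norm u * \<bar>B b\<bar>"
        unfolding norm_scaleR using Basis_le_norm[OF b, of u] by (intro mult_mono) auto
    qed
    finally show ?thesis by (simp add: L_def sum_distrib_left mult.commute)
  qed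
  have ZV: "\<bar>N z \<bullet> V z + 1\<bar> < \<alpha>" "norm (V z) < C" if z: "z \<in> Z" for z
  proof -
    have zM: "z \<in> M0" using z ZM by auto
    have "\<bar>N z \<bullet> (W z - V z)\<bar> \<le> C * norm (W z - V z)" by (rule abs_inner_le[OF C(2)[OF zM]])
    also have "\<dots> \<le> C * (\<alpha> / (2 * C))" using V[OF z] C by (intro mult_left_mono) auto
    also have "\<dots> < \<alpha>" using C(1) \<alpha> by simp
    finally show "\<bar>N z \<bullet> V z + 1\<bar> < \<alpha>" using NW[OF z] by (simp add: inner_diff_right abs_minus_commute)
    have "\<alpha> / (2 * C) \<le> 1" using C(1) \<alpha> by (simp add: divide_simps)
    then show "norm (V z) < C" using V[OF z] C(3)[OF z] norm_triangle_sub[of "V z" "W z"] norm_minus_commute[of "V z" "W z"] by linarith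
  qed
  \<comment> \<open>The conditions on \<open>V\<close> at the point \<open>fst p\<close> and the
    time \<open>snd p\<close>, as an open set of pairs. It contains the boundary at time 0, and
    \<open>compact_sublevel\<close> provides the collar.\<close>
  define Q where "Q = {p. \<bar>N (fst p + snd p *\<^sub>R V (fst p)) \<bullet> V (fst p) + 1\<bar> < \<alpha>} \<inter>
      {p. norm (V (fst p)) < C} \<inter> {p. norm (N (fst p + snd p *\<^sub>R V (fst p)) - N (fst p)) < \<alpha>}"
  have oQ: "open Q"
    unfolding Q_def
    by (intro open_Int open_Collect_less continuous_intros continuous_on_compose2[OF cN] continuous_on_compose2[OF cV]) auto
  obtain q where q: "q > 0" "\<And>p. p \<in> M0 \<times> {-1..1} \<Longrightarrow> max \<bar>\<rho> (fst p)\<bar> \<bar>snd p\<bar> \<le> q \<Longrightarrow> p \<in> Q"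
  proof (rule compact_sublevel[OF _ _ oQ, of "M0 \<times> {-1..1}" "\<lambda>p. max \<bar>\<rho> (fst p)\<bar> \<bar>snd p\<bar>"])
    show "compact (M0 \<times> {- 1..1::real})" using r0(2) unfolding M0_def by (intro compact_Times) auto
    show "continuous_on (M0 \<times> {- 1..1}) (\<lambda>p. max \<bar>\<rho> (fst p)\<bar> \<bar>snd p\<bar>)"
      by (intro continuous_intros continuous_on_compose2[OF c\<rho>]) auto
    show "p \<in> Q" if "p \<in> M0 \<times> {- 1..1}" "max \<bar>\<rho> (fst p)\<bar> \<bar>snd p\<bar> \<le> 0" for p
    proof -
      have "fst p \<in> Z" "snd p = 0" using that by (auto simp: Z_def)
      then show ?thesis using ZV \<alpha> by (simp add: Q_def)
    qed
  qed (use that in blast)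
  \<comment> \<open>The entries in order: stay in the compact collar, stay in \<open>Q\<close>, keep
    times within [-1, 1], make the variation of \<open>V\<close> small, keep the displacement
    \<open>r * C\<close> below \<epsilon>.\<close>
  define r where "r = Min {r0 / 2, q / 4, 1/4, \<alpha> / (4 * (L + 1)), \<epsilon> / (2 * C)}"
  have r: "r > 0"
    unfolding r_def using r0(1) q(1) \<alpha>(1) L0 \<epsilon> C(1) by (subst Min_gr_iff) auto
  have r: "r > 0" "r \<le> r0 / 2" "r \<le> q / 4" "r \<le> 1/4" "r \<le> \<alpha> / (4 * (L + 1))" "r \<le> \<epsilon> / (2 * C)"
    by (rule r) (auto simp only: r_def intro!: Min_le)
  have rL: "4 * r * L \<le> \<alpha>"
  proof -
    have "4 * r * L \<le> 4 * r * (L + 1)" using r(1) by (intro mult_left_mono) auto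
    also have "\<dots> \<le> \<alpha>" using r(5) L0 by (simp add: pos_le_divide_eq mult_ac)
    finally show ?thesis .
  qed
  have rC: "r * C < \<epsilon>"
  proof -
    have "r * C \<le> \<epsilon> / 2" using r(6) C(1) by (simp add: pos_le_divide_eq mult_ac)
    with \<epsilon> show ?thesis by linarith
  qed
  have inM: "z \<in> M0" if "\<bar>\<rho> z\<bar> \<le> 2 * r" for z using that r(2) by (auto simp: M0_def)
  have inQ: "(z, t) \<in> Q" if "\<bar>\<rho> z\<bar> \<le> 2 * r" "\<bar>t\<bar> \<le> 4 * r" for z t
    using that inM[of z] r by (intro q(2)) (auto simp: abs_le_iff)
  have p: "\<alpha> / C > 0" "\<alpha> * r > 0" using \<alpha> C(1) r(1) by auto
  show ?thesis
  proof (rule exI[of _ "\<alpha> / C"], rule conjI, rule p(1), rule exI[of _ "\<alpha> * r"], rule conjI, rule p(2), intro allI impI)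
    fix D F G
    assume D: "open D" "\<forall>x\<in>D. \<rho> x < 0" and F: "has_gradient_on F G D"
      and deep: "\<forall>x. \<rho> x \<le> - (\<alpha> * r) \<longrightarrow> x \<in> D \<and> F x < 1" and cl: "closed {x\<in>D. F x \<le> 1}"
      and close: "\<forall>x\<in>D. F x = 1 \<longrightarrow> (\<exists>c>0. norm (G x - c *\<^sub>R N x) \<le> \<alpha> / C * c)"
    have "\<exists>g g'. (\<forall>x. (g has_derivative g' x) (at x)) \<and> (\<forall>v. continuous_on UNIV (\<lambda>x. g' x v)) \<and>
      (\<forall>x v. norm (g' x v) \<le> 1/2 * norm v) \<and> (\<forall>x. x + g x \<in> {x\<in>D. F x < 1} \<longleftrightarrow> \<rho> x < 0) \<and>
      (\<forall>x. norm (g x) \<le> r * C)"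
    proof (rule isotopy_along_transverse_field[OF \<rho> V' r(1) \<alpha>(1) \<alpha>(2)[unfolded k_def] C(1) _ _ _ _ _ rL L0 D(1) D(2)[rule_format] F
          deep[rule_format] cl close[rule_format]])
      show "\<bar>N (z + t *\<^sub>R V z) \<bullet> V z + 1\<bar> \<le> \<alpha>" "norm (N (z + t *\<^sub>R V z) - N z) \<le> \<alpha>"
        if "\<bar>\<rho> z\<bar> \<le> 2 * r" "\<bar>t\<bar> \<le> 4 * r" for z t
        using inQ[OF that] by (auto simp: Q_def)
      show "norm (N z) \<le> C" "norm (V z) \<le> C" "norm (V' z u) \<le> L * norm u" if "\<bar>\<rho> z\<bar> \<le> 2 * r" for z u
        using inM[OF that] C(2) inQ[OF that, of 0] r(1) L by (auto simp: Q_def)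
    qed blast+
    then obtain g g' where g: "\<And>x. (g has_derivative g' x) (at x)" "\<And>v. continuous_on UNIV (\<lambda>x. g' x v)"
      "\<And>x v. norm (g' x v) \<le> 1/2 * norm v" "\<And>x. x + g x \<in> {x\<in>D. F x < 1} \<longleftrightarrow> \<rho> x < 0"
      "\<And>x. norm (g x) \<le> r * C" by blast
    have "ambient_C1_isotopy (\<lambda>s x. x + s *\<^sub>R g x) {x. \<rho> x < 0} {x\<in>D. F x < 1}"
      by (rule small_isotopy[OF g(1-3)]) (use g(4) in auto)
    moreover have "norm (z + s *\<^sub>R g z - z) < \<epsilon>" if "s \<in> {0..1}" for s z
    proof -
      have "norm (s *\<^sub>R g z) \<le> 1 * norm (g z)"
        unfolding norm_scaleR by (rule mult_right_mono) (use that in auto)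
      with g(5)[of z] rC show ?thesis by simp
    qed
    ultimately show "\<exists>h. ambient_C1_isotopy h {x. \<rho> x < 0} {x\<in>D. F x < 1} \<and>
        (\<forall>s\<in>{0..1}. \<forall>z. norm (h s z - z) < \<epsilon>)" by blast
  qed
qed

section \<open>Averaging\<close>

lemma continuous_on_cutoff:
  fixes f :: "'a::topological_space \<Rightarrow> 'b::real_normed_vector"
  assumes "closed X" "closed S" "closed T" "X \<subseteq> S \<union> T"
    and "continuous_on (X \<inter> S) f" "continuous_on X b" "\<And>x. x \<in> X \<inter> T \<Longrightarrow> b x = (0::real)"
  shows "continuous_on X (\<lambda>x. b x *\<^sub>R f x)"
proof -
  have "continuous_on (X \<inter> S) (\<lambda>x. b x *\<^sub>R f x)"
    using assms(5) continuous_on_subset[OF assms(6)] by (intro continuous_intros) auto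
  moreover have "continuous_on (X \<inter> T) (\<lambda>x. b x *\<^sub>R f x)"
    by (rule continuous_on_eq[OF continuous_on_const[of _ 0]]) (use assms(7) in auto)
  ultimately have "continuous_on ((X \<inter> S) \<union> (X \<inter> T)) (\<lambda>x. b x *\<^sub>R f x)"
    using assms by (intro continuous_on_closed_Un closed_Int)
  moreover have "(X \<inter> S) \<union> (X \<inter> T) = X" using assms(4) by auto
  ultimately show ?thesis by simp
qed

text \<open>By translation invariance the integral of \<open>\<psi> (a + t *\<^sub>R v)\<close> does
  not depend on \<open>t\<close>; differentiate under the integral at \<open>t = 0\<close>. Applied
  to the product of kernel and \<phi>, this is what moves the derivative to the kernel.\<close>

lemma integral_gradient_compact_support:
  fixes \<psi> :: "'a::euclidean_space \<Rightarrow> real"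
  assumes \<psi>: "has_gradient_on \<psi> \<Psi> UNIV" and sub: "S \<subseteq> cbox c d"
    and out: "\<And>x. x \<notin> S \<Longrightarrow> \<psi> x = 0 \<and> \<Psi> x = 0"
  shows "integral (cbox c d) (\<lambda>a. \<Psi> a \<bullet> v) = 0"
proof -
  have cont: "continuous_on A \<psi>" "continuous_on A \<Psi>" for A
    using has_gradient_on_continuous[OF \<psi>] continuous_on_subset by blast+
  have "bounded S" using sub bounded_subset bounded_cbox by blast
  then obtain k where k: "\<And>x. x \<in> S \<Longrightarrow> norm x \<le> k" unfolding bounded_iff by blast
  \<comment> \<open>A box so large that it contains \<open>S\<close> even when shifted by
    \<open>t *\<^sub>R v\<close> with \<open>\<bar>t\<bar> \<le> 1\<close>.\<close>
  define m where "m = (\<bar>k\<bar> + norm v) *\<^sub>R (One::'a)"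
  have big: "S \<subseteq> cbox (- m + t *\<^sub>R v) (m + t *\<^sub>R v)" if t: "\<bar>t\<bar> \<le> 1" for t
  proof
    fix x assume x: "x \<in> S"
    have "\<bar>x \<bullet> b\<bar> \<le> \<bar>k\<bar>" "\<bar>(t *\<^sub>R v) \<bullet> b\<bar> \<le> norm v" if b: "b \<in> Basis" for b
    proof -
      show "\<bar>x \<bullet> b\<bar> \<le> \<bar>k\<bar>" using Basis_le_norm[OF b, of x] k[OF x] by linarith
      have "\<bar>(t *\<^sub>R v) \<bullet> b\<bar> \<le> norm (t *\<^sub>R v)" by (rule Basis_le_norm[OF b])
      also have "\<dots> \<le> 1 * norm v" unfolding norm_scaleR using t by (intro mult_right_mono) auto
      finally show "\<bar>(t *\<^sub>R v) \<bullet> b\<bar> \<le> norm v" by simp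
    qed
    then show "x \<in> cbox (- m + t *\<^sub>R v) (m + t *\<^sub>R v)"
      unfolding mem_box
    proof (intro ballI)
      fix b :: 'a assume b: "b \<in> Basis"
      have "m \<bullet> b = \<bar>k\<bar> + norm v" using b by (simp add: m_def)
      with \<open>\<And>b. b \<in> Basis \<Longrightarrow> \<bar>x \<bullet> b\<bar> \<le> \<bar>k\<bar>\<close>[OF b] \<open>\<And>b. b \<in> Basis \<Longrightarrow> \<bar>(t *\<^sub>R v) \<bullet> b\<bar> \<le> norm v\<close>[OF b]
      show "(- m + t *\<^sub>R v) \<bullet> b \<le> x \<bullet> b \<and> x \<bullet> b \<le> (m + t *\<^sub>R v) \<bullet> b"
        unfolding inner_add_left inner_minus_left by linarith
    qed
  qed
  have int: "(\<psi> has_integral integral (cbox a b) \<psi>) (cbox a b)" for a b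
    by (intro integrable_integral integrable_continuous cont)
  have shift: "integral (cbox (- m) m) (\<lambda>a. \<psi> (a + t *\<^sub>R v)) = integral UNIV \<psi>" if t: "\<bar>t\<bar> \<le> 1" for t
  proof -
    have "(\<psi> has_integral integral (cbox (- m + t *\<^sub>R v) (m + t *\<^sub>R v)) \<psi>) UNIV"
      by (rule has_integral_on_superset[OF int]) (use big[OF t] out in auto)
    from integral_unique[OF this]
    have "integral (cbox (- m + t *\<^sub>R v) (m + t *\<^sub>R v)) \<psi> = integral UNIV \<psi>" by simp
    moreover have sh: "((\<lambda>x. \<psi> (x + t *\<^sub>R v)) has_integral integral (cbox (- m + t *\<^sub>R v) (m + t *\<^sub>R v)) \<psi>)
        (cbox (- m + t *\<^sub>R v - t *\<^sub>R v) (m + t *\<^sub>R v - t *\<^sub>R v))"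
      by (rule has_integral_shift_cbox[OF int])
    ultimately show ?thesis using integral_unique[OF sh] by simp
  qed
  have "((\<lambda>t. integral (cbox (- m) m) (\<lambda>a. \<psi> (a + t *\<^sub>R v))) has_real_derivative
      integral (cbox (- m) m) (\<lambda>a. \<Psi> (a + 0 *\<^sub>R v) \<bullet> v)) (at 0 within {-1<..<1})"
  proof (rule leibniz_rule_field_derivative)
    fix t a
    have "((\<lambda>t. a + t *\<^sub>R v) has_derivative (\<lambda>t. t *\<^sub>R v)) (at t)"
      by (auto intro!: derivative_eq_intros)
    from has_derivative_compose[OF this has_gradient_onD[OF \<psi>]]
    have "((\<lambda>t. \<psi> (a + t *\<^sub>R v)) has_derivative (\<lambda>s. \<Psi> (a + t *\<^sub>R v) \<bullet> (s *\<^sub>R v))) (at t)" by simp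
    then have "((\<lambda>t. \<psi> (a + t *\<^sub>R v)) has_real_derivative \<Psi> (a + t *\<^sub>R v) \<bullet> v) (at t)"
      unfolding has_field_derivative_def by (rule has_derivative_eq_rhs) (auto simp: fun_eq_iff)
    then show "((\<lambda>t. \<psi> (a + t *\<^sub>R v)) has_real_derivative \<Psi> (a + t *\<^sub>R v) \<bullet> v) (at t within {-1<..<1})"
      by (rule has_field_derivative_at_within)
    show "(\<lambda>a. \<psi> (a + t *\<^sub>R v)) integrable_on cbox (- m) m"
      by (intro integrable_continuous continuous_on_compose2[OF cont(1)] continuous_intros) auto
  next
    show "continuous_on ({- 1<..<1} \<times> cbox (- m) m) (\<lambda>(t, a). \<Psi> (a + t *\<^sub>R v) \<bullet> v)"
      unfolding case_prod_beta
      by (intro continuous_intros continuous_on_compose2[OF cont(2)[of UNIV]]) auto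
  qed auto
  then have "((\<lambda>t. integral (cbox (- m) m) (\<lambda>a. \<psi> (a + t *\<^sub>R v))) has_real_derivative
      integral (cbox (- m) m) (\<lambda>a. \<Psi> a \<bullet> v)) (at 0)"
    by (simp add: at_within_open[of 0 "{-1<..<1::real}"])
  moreover have "((\<lambda>t. integral (cbox (- m) m) (\<lambda>a. \<psi> (a + t *\<^sub>R v))) has_real_derivative 0) (at 0)"
  proof (rule has_field_derivative_transform_within_open[of "\<lambda>t. integral UNIV \<psi>" _ _ "{-1<..<1}"])
    show "integral UNIV \<psi> = integral (cbox (- m) m) (\<lambda>a. \<psi> (a + t *\<^sub>R v))" if "t \<in> {-1<..<1}" for t
      using shift[of t] that by (simp add: abs_le_iff)
  qed auto
  ultimately have 0: "integral (cbox (- m) m) (\<lambda>a. \<Psi> a \<bullet> v) = 0" by (rule DERIV_unique)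
  have int\<Psi>: "((\<lambda>a. \<Psi> a \<bullet> v) has_integral integral (cbox a b) (\<lambda>a. \<Psi> a \<bullet> v)) (cbox a b)" for a b
    by (intro integrable_integral integrable_continuous continuous_intros cont)
  have out': "\<Psi> x \<bullet> v = 0" if "x \<notin> S" for x using out[OF that] by simp
  have "((\<lambda>a. \<Psi> a \<bullet> v) has_integral integral (cbox (- m) m) (\<lambda>a. \<Psi> a \<bullet> v)) UNIV"
    by (rule has_integral_on_superset[OF int\<Psi> out']) (use big[of 0] in auto)
  then have "((\<lambda>a. \<Psi> a \<bullet> v) has_integral 0) UNIV" unfolding 0 .
  moreover have "((\<lambda>a. \<Psi> a \<bullet> v) has_integral integral (cbox c d) (\<lambda>a. \<Psi> a \<bullet> v)) UNIV"
    by (rule has_integral_on_superset[OF int\<Psi> out']) (use sub in auto)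
  ultimately show ?thesis using has_integral_unique by blast
qed

text \<open>Uniform continuity provides one division fine enough for all \<open>z\<close> at once,
  so weights and nodes do not depend on \<open>z\<close> and the average becomes a fixed finite sum.
  Its index set consists of pairs of node and cell.\<close>

lemma uniform_Riemann_sum:
  fixes H :: "'z::euclidean_space \<times> 'a::euclidean_space \<Rightarrow> 'b::euclidean_space"
  assumes H: "continuous_on (C \<times> cbox c d) H" and C: "compact C" and e: "e > 0"
  obtains p :: "('a \<times> 'a set) set" where "finite p" "\<And>i. i \<in> p \<Longrightarrow> fst i \<in> cbox c d"
    "\<And>z. z \<in> C \<Longrightarrow> norm (integral (cbox c d) (\<lambda>a. H (z, a)) - (\<Sum>i\<in>p. measure lborel (snd i) *\<^sub>R H (z, fst i))) \<le> e"
proof -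
  \<comment> \<open>The 1 in the denominator guards against a box of measure 0.\<close>
  define e' where "e' = e / (measure lborel (cbox c d) + 1)"
  have pos: "measure lborel (cbox c d) + 1 > 0" using measure_nonneg[of lborel "cbox c d"] by linarith
  then have e'0: "e' > 0" unfolding e'_def using e by (rule divide_pos_pos[rotated])
  have "e' * measure lborel (cbox c d) \<le> e' * (measure lborel (cbox c d) + 1)"
    using e'0 by (intro mult_left_mono) auto
  also have "\<dots> = e" using pos by (simp add: e'_def)
  finally have e': "e' > 0" "e' * measure lborel (cbox c d) \<le> e" using e'0 by auto
  have "uniformly_continuous_on (C \<times> cbox c d) H"
    using H C by (intro compact_uniformly_continuous compact_Times) auto
  then obtain \<delta> where \<delta>: "\<delta> > 0" "\<And>x y. x \<in> C \<times> cbox c d \<Longrightarrow> y \<in> C \<times> cbox c d \<Longrightarrow> dist y x < \<delta> \<Longrightarrow> dist (H y) (H x) < e'"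
    unfolding uniformly_continuous_on_def using e'(1) by metis
  obtain p where p: "p tagged_division_of cbox c d" "(\<lambda>x. ball x \<delta>) fine p"
    using fine_division_exists[OF gauge_ball[OF \<delta>(1)]] by blast
  have fin: "finite p" using p(1) by (rule tagged_division_of_finite)
  have tag: "fst i \<in> cbox c d" if "i \<in> p" for i
    using tagged_division_ofD(2,3)[OF p(1), of "fst i" "snd i"] that by auto
  have "norm (integral (cbox c d) (\<lambda>a. H (z, a)) - (\<Sum>i\<in>p. measure lborel (snd i) *\<^sub>R H (z, fst i))) \<le> e"
    if z: "z \<in> C" for z
  proof -
    have cz: "continuous_on (cbox c d) (\<lambda>a. H (z, a))"
      using z by (intro continuous_on_compose2[OF H] continuous_intros) auto
    have "integral (cbox c d) (\<lambda>a. H (z, a)) = (\<Sum>(x, k)\<in>p. integral k (\<lambda>a. H (z, a)))"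
      by (rule integral_combine_tagged_division_topdown[OF integrable_continuous[OF cz] p(1)])
    then have "integral (cbox c d) (\<lambda>a. H (z, a)) - (\<Sum>i\<in>p. measure lborel (snd i) *\<^sub>R H (z, fst i))
      = (\<Sum>i\<in>p. integral (snd i) (\<lambda>a. H (z, a)) - measure lborel (snd i) *\<^sub>R H (z, fst i))"
      by (simp add: sum_subtractf case_prod_beta)
    also have "norm \<dots> \<le> (\<Sum>i\<in>p. e' * measure lborel (snd i))"
    proof (rule sum_norm_le)
      fix i assume i: "i \<in> p"
      obtain u v where uv: "snd i = cbox u v" using tagged_division_ofD(4)[OF p(1), of "fst i" "snd i"] i by auto
      have sub: "snd i \<subseteq> cbox c d" using tagged_division_ofD(3)[OF p(1), of "fst i" "snd i"] i by auto
      have ball: "snd i \<subseteq> ball (fst i) \<delta>" using p(2) i unfolding fine_def by (cases i) auto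
      have "((\<lambda>a. H (z, a)) has_integral integral (snd i) (\<lambda>a. H (z, a))) (cbox u v)"
        unfolding uv by (intro integrable_integral integrable_continuous continuous_on_subset[OF cz]) (use sub uv in auto)
      then have hi: "((\<lambda>a. H (z, a) - H (z, fst i)) has_integral
          (integral (snd i) (\<lambda>a. H (z, a)) - measure lborel (snd i) *\<^sub>R H (z, fst i))) (cbox u v)"
        unfolding uv by (intro has_integral_diff has_integral_const)
      have "norm (H (z, a) - H (z, fst i)) \<le> e'" if "a \<in> cbox u v" for a
        using \<delta>(2)[of "(z, fst i)" "(z, a)"] z tag[OF i] sub ball that uv
        by (auto simp: dist_Pair_Pair dist_norm norm_minus_commute subset_iff intro!: less_imp_le)
      then show "norm (integral (snd i) (\<lambda>a. H (z, a)) - measure lborel (snd i) *\<^sub>R H (z, fst i)) \<le> e' * measure lborel (snd i)"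
        using has_integral_bound[OF _ hi, of e'] e'(1) uv by simp
    qed
    also have "\<dots> = e' * measure lborel (cbox c d)"
      using additive_content_tagged_division[OF p(1)] by (simp add: sum_distrib_left[symmetric] case_prod_beta)
    finally show ?thesis using e'(2) by linarith
  qed
  with fin tag show ?thesis using that by blast
qed

section \<open>The averaged hypersurface\<close>

lemma closed_cball_subset:
  fixes K :: "'a::euclidean_space set"
  assumes "closed K" "\<eta> \<ge> 0"
  shows "closed {z. cball z \<eta> \<subseteq> K}"
proof -
  have "{z. cball z \<eta> \<subseteq> K} = (\<Inter>a\<in>cball 0 \<eta>. (\<lambda>z. z + a) -` K)"
  proof (intro set_eqI iffI)
    fix z assume "z \<in> (\<Inter>a\<in>cball 0 \<eta>. (\<lambda>z. z + a) -` K)"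
    then have h: "\<And>a. norm a \<le> \<eta> \<Longrightarrow> z + a \<in> K" by auto
    have "w \<in> K" if "dist z w \<le> \<eta>" for w
      using h[of "w - z"] that by (simp add: dist_norm norm_minus_commute)
    then show "z \<in> {z. cball z \<eta> \<subseteq> K}" by auto
  qed (auto simp: dist_norm subset_iff)
  moreover have "closed ((\<lambda>z. z + a) -` K)" for a
    using assms(1) by (intro closed_vimage continuous_intros)
  ultimately show ?thesis by auto
qed

text \<open>The parameters are bound before \<phi>, because \<phi> is constructed afterwards to meet
  the bounds \<tau> and \<open>B\<close> at the scale \<epsilon>. The conclusions provide what
  \<open>isotopy_of_close_hypersurface\<close> asks for: depth, closedness of the sublevel set and
  closeness of normals; the nonzero gradient is what makes the level set a smooth boundary.\<close>

lemma averaged_hypersurface: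
  fixes \<rho> :: "'a::euclidean_space \<Rightarrow> real"
  assumes \<rho>: "has_gradient_on \<rho> N UNIV" and nz: "\<forall>x. \<rho> x = 0 \<longrightarrow> N x \<noteq> 0"
    and K: "compact K" "K = {x. \<rho> x \<le> 0}" and \<alpha>: "\<alpha> > 0" and r1: "r1 > 0"
  shows "\<exists>\<eta>>0. \<exists>\<epsilon>>0. \<exists>\<tau>>0. \<exists>B. \<forall>D \<phi> \<Phi>. open D \<longrightarrow> K \<subseteq> D \<longrightarrow> has_gradient_on \<phi> \<Phi> D \<longrightarrow>
      (\<forall>x\<in>K. \<phi> x \<ge> 0) \<longrightarrow> (\<forall>x. cball x \<epsilon> \<subseteq> K \<longrightarrow> \<phi> x \<le> \<tau>) \<longrightarrow>
      (\<forall>x y. x \<in> K \<longrightarrow> y \<notin> K \<longrightarrow> dist x y < \<epsilon> / 2 \<longrightarrow> \<phi> x \<ge> B) \<longrightarrow>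
      (\<exists>I c a. finite (I :: ('a \<times> 'a set) set) \<and> (\<forall>i\<in>I. c i \<ge> 0 \<and> norm (a i) \<le> \<eta>) \<and>
         (\<forall>z. \<rho> z \<le> - r1 \<longrightarrow> z \<in> interior {z. cball z \<eta> \<subseteq> K} \<and> (\<Sum>i\<in>I. c i * \<phi> (z + a i)) < 1) \<and>
         (\<forall>z. cball z \<eta> \<subseteq> K \<longrightarrow> (\<Sum>i\<in>I. c i * \<phi> (z + a i)) \<le> 1 \<longrightarrow> z \<in> interior {z. cball z \<eta> \<subseteq> K}) \<and>
         (\<forall>z. cball z \<eta> \<subseteq> K \<longrightarrow> (\<Sum>i\<in>I. c i * \<phi> (z + a i)) = 1 \<longrightarrow>
            (\<Sum>i\<in>I. c i *\<^sub>R \<Phi> (z + a i)) \<noteq> 0 \<and>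
            (\<exists>k>0. norm ((\<Sum>i\<in>I. c i *\<^sub>R \<Phi> (z + a i)) - k *\<^sub>R N z) \<le> \<alpha> * k)))"
proof -
  have c\<rho>: "continuous_on UNIV \<rho>" and cN: "continuous_on UNIV N"
    using has_gradient_on_continuous[OF \<rho>] by auto
  obtain R where R: "\<And>x. x \<in> K \<Longrightarrow> norm x \<le> R" using compact_imp_bounded[OF K(1)] unfolding bounded_iff by blast
  define M where "M = cball (0::'a) (R + 2)"
  have M: "compact M" by (simp add: M_def)
  have inM: "x \<in> M" if "z \<in> K" "norm (x - z) \<le> 2" for x z
    using R[OF that(1)] that(2) norm_triangle_sub[of x z] by (simp add: M_def)
  obtain n0 where n0: "n0 > 0" "\<And>x. x \<in> K \<Longrightarrow> \<rho> x = 0 \<Longrightarrow> norm (N x) > n0"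
  proof (cases "{x \<in> K. \<rho> x = 0} = {}")
    case True then show ?thesis using that[of 1] by auto
  next
    case False
    have "closed {x. \<rho> x = 0}" by (intro closed_Collect_eq continuous_intros c\<rho>)
    then have "compact (K \<inter> {x. \<rho> x = 0})" using K(1) by (rule compact_Int_closed[rotated])
    moreover have "K \<inter> {x. \<rho> x = 0} = {x \<in> K. \<rho> x = 0}" by auto
    ultimately have "compact {x \<in> K. \<rho> x = 0}" by simp
    moreover have "continuous_on {x \<in> K. \<rho> x = 0} (\<lambda>x. norm (N x))"
      by (intro continuous_intros continuous_on_subset[OF cN]) auto
    ultimately obtain x0 where x0: "x0 \<in> {x \<in> K. \<rho> x = 0}" "\<And>x. x \<in> {x \<in> K. \<rho> x = 0} \<Longrightarrow> norm (N x0) \<le> norm (N x)"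
      using continuous_attains_inf[OF _ False, of "\<lambda>x. norm (N x)"] by blast
    show ?thesis
    proof (rule that[of "norm (N x0) / 2"])
      have p: "norm (N x0) > 0" using nz x0(1) by simp
      then show "norm (N x0) / 2 > 0" by simp
      show "norm (N x) > norm (N x0) / 2" if "x \<in> K" "\<rho> x = 0" for x
        using x0(2)[of x] that p by (simp, linarith)
    qed
  qed
  obtain \<sigma> where \<sigma>: "\<sigma> > 0" "\<And>x. x \<in> K \<Longrightarrow> \<rho> x \<ge> - \<sigma> \<Longrightarrow> norm (N x) > n0"
  proof (rule compact_sublevel[OF K(1), of "\<lambda>x. - \<rho> x" "{x. norm (N x) > n0}"])
    show "continuous_on K (\<lambda>x. - \<rho> x)" by (intro continuous_intros continuous_on_subset[OF c\<rho>]) auto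
    show "open {x. n0 < norm (N x)}" by (intro open_Collect_less continuous_intros cN)
    show "x \<in> {x. n0 < norm (N x)}" if "x \<in> K" "- \<rho> x \<le> 0" for x
      using n0(2)[of x] that K(2) by auto
  next
    fix r assume "r > 0" "\<And>x. x \<in> K \<Longrightarrow> - \<rho> x \<le> r \<Longrightarrow> x \<in> {x. n0 < norm (N x)}"
    then show thesis using that[of r] by (simp add: minus_le_iff)
  qed
  have "bounded (N ` M)" using M continuous_on_subset[OF cN] by (intro compact_imp_bounded compact_continuous_image) auto
  then obtain C1 where C1: "\<And>x. x \<in> M \<Longrightarrow> norm (N x) \<le> C1" unfolding bounded_iff by blast
  define C where "C = \<bar>C1\<bar> + 1"
  have C: "C \<ge> 1" "\<And>x. x \<in> M \<Longrightarrow> norm (N x) \<le> C" using C1 by (force simp: C_def)+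
  \<comment> \<open>The allowed deviation of a relevant shift from the normal, relative to \<eta>.
    The gradient error will be \<open>3 * \<beta> * C * k\<close>, hence the second entry; 1/6 keeps
    the gradient away from 0.\<close>
  define \<beta> where "\<beta> = min (1/6) (\<alpha> / (3 * C))"
  have \<beta>: "\<beta> > 0" "\<beta> \<le> 1" "3 * \<beta> * C \<le> \<alpha>" "\<beta> \<le> 1/6"
  proof -
    show "\<beta> > 0" "\<beta> \<le> 1" "\<beta> \<le> 1/6" using \<alpha> C(1) by (auto simp: \<beta>_def)
    have "\<beta> \<le> \<alpha> / (3 * C)" by (simp add: \<beta>_def)
    then show "3 * \<beta> * C \<le> \<alpha>" using C(1) by (simp add: pos_le_divide_eq mult_ac)
  qed
  \<comment> \<open>Tolerance for the oscillation of \<open>N\<close>. In \<open>relevant\<close>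
    three such errors use up half of the budget \<open>n * \<eta> * \<beta>\<^sup>2 / 2\<close>; the
    other half goes to \<epsilon>.\<close>
  define a' where "a' = n0 * \<beta>\<^sup>2 / 12"
  have a': "a' > 0" using n0(1) \<beta>(1) by (simp add: a'_def)
  have "uniformly_continuous_on M \<rho>" "uniformly_continuous_on M N"
    using M c\<rho> cN continuous_on_subset by (blast intro: compact_uniformly_continuous)+
  note uc = this[unfolded uniformly_continuous_on_def, rule_format]
  have "min \<sigma> r1 > 0" using \<sigma>(1) r1 by simp
  from uc(1)[OF this] obtain d1
    where d1: "d1 > 0" "\<And>x y. x \<in> M \<Longrightarrow> y \<in> M \<Longrightarrow> dist y x < d1 \<Longrightarrow> dist (\<rho> y) (\<rho> x) < min \<sigma> r1"
    by blast
  from uc(2)[OF a'] obtain d2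
    where d2: "d2 > 0" "\<And>x y. x \<in> M \<Longrightarrow> y \<in> M \<Longrightarrow> dist y x < d2 \<Longrightarrow> dist (N y) (N x) < a'"
    by blast
  define \<eta> where "\<eta> = min 1 (min d1 d2 / 3)"
  have \<eta>: "\<eta> > 0" "\<eta> \<le> 1" "2 * \<eta> < d1" "2 * \<eta> < d2" using d1(1) d2(1) by (auto simp: \<eta>_def min_def)
  define \<epsilon> where "\<epsilon> = \<eta> * \<beta>\<^sup>2 / 4"
  have "\<beta>\<^sup>2 \<le> 1" using \<beta> by (simp add: power_le_one)
  then have "\<eta> * \<beta>\<^sup>2 \<le> \<eta> * 1" using \<eta>(1) by (intro mult_left_mono) auto
  then have \<epsilon>: "\<epsilon> > 0" "\<epsilon> \<le> \<eta> / 4" using \<eta>(1) \<beta>(1) by (auto simp: \<epsilon>_def)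
  define BX where "BX = cbox (- \<eta> *\<^sub>R One) (\<eta> *\<^sub>R (One::'a))"
  have BX: "cball 0 \<eta> \<subseteq> BX"
  proof
    fix x :: 'a assume "x \<in> cball 0 \<eta>"
    then have "\<bar>x \<bullet> b\<bar> \<le> \<eta>" if "b \<in> Basis" for b using Basis_le_norm[OF that, of x] by simp
    then show "x \<in> BX" by (auto simp: BX_def mem_box abs_le_iff minus_le_iff)
  qed
  define cB where "cB = measure lborel BX"
  have cB: "cB > 0" unfolding cB_def BX_def by (rule iffD2[OF content_pos_lt_eq]) (use \<eta>(1) in auto)
  \<comment> \<open>Deep shifts contribute at most
    \<open>\<tau> * \<eta> ^ 4 * cB = \<beta> / 4\<close> to the average, which is small both
    against the level 1 and against the gradient tolerance.\<close>
  define \<tau> where "\<tau> = \<beta> / (4 * \<eta> ^ 4 * cB)"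
  have \<tau>: "\<tau> > 0" "\<tau> * \<eta> ^ 4 * cB = \<beta> / 4" using \<beta> \<eta> cB by (auto simp: \<tau>_def)
  \<comment> \<open>Room for a lower bound on the average: a cube inside a ball of radius
    \<open>e1\<close> about a shift of length \<open>\<eta> - 2 * e1\<close> stays in the support of
    the kernel and, for points near the edge of the core, within \<open>\<epsilon> / 2\<close> of
    the outside.\<close>
  define e1 where "e1 = \<epsilon> / 16"
  have e1: "e1 > 0" "16 * e1 = \<epsilon>" "2 * e1 < \<eta>" using \<epsilon> \<eta>(1) by (auto simp: e1_def)
  define s where "s = e1 / DIM('a)"
  have s: "s > 0" "s * DIM('a) = e1" using e1(1) by (auto simp: s_def)
  define cube where "cube a0 = cbox (a0 - s *\<^sub>R One) (a0 + s *\<^sub>R (One::'a))" for a0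
  define cc where "cc = (2 * s) ^ DIM('a)"
  have cc: "cc > 0" using s(1) by (simp add: cc_def)
  have cube_sub: "cube a0 \<subseteq> cball a0 e1" for a0
  proof
    fix x assume x: "x \<in> cube a0"
    have "\<bar>(x - a0) \<bullet> b\<bar> \<le> s" if "b \<in> Basis" for b
    proof -
      have "(a0 - s *\<^sub>R One) \<bullet> b \<le> x \<bullet> b \<and> x \<bullet> b \<le> (a0 + s *\<^sub>R One) \<bullet> b"
        using x that unfolding cube_def mem_box by blast
      then show ?thesis using that by (simp add: inner_diff_left inner_add_left abs_le_iff)
    qed
    then have "(\<Sum>b\<in>Basis. \<bar>(x - a0) \<bullet> b\<bar>) \<le> (\<Sum>b\<in>(Basis::'a set). s)" by (intro sum_mono) auto
    then have "norm (x - a0) \<le> e1" using norm_le_l1[of "x - a0"] s(2) by (simp add: mult.commute)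
    then show "x \<in> cball a0 e1" by (simp add: dist_norm norm_minus_commute)
  qed
  have cube_content: "measure lborel (cube a0) = cc" for a0
    using s(1) by (simp add: cube_def cc_def content_cbox_cases inner_diff_left inner_add_left)
  \<comment> \<open>On that cube the kernel is at least \<open>(\<eta> * e1)\<^sup>2\<close>, so
    this height of \<phi> forces the average up to 2, safely above the level 1.\<close>
  define B where "B = 2 / ((\<eta> * e1)\<^sup>2 * cc)"
  have B: "B > 0" "B * (\<eta> * e1)\<^sup>2 * cc = 2" using \<eta>(1) e1(1) cc by (auto simp: B_def)
  define Cs where "Cs = {z. cball z \<eta> \<subseteq> K}"
  have lin: "\<bar>\<rho> y - \<rho> z - N z \<bullet> (y - z)\<bar> \<le> a' * norm (y - z)"
    if "z \<in> K" "norm (y - z) \<le> 2 * \<eta>" for y z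
  proof -
    have "norm ((\<lambda>x. \<rho> x - N z \<bullet> x) y - (\<lambda>x. \<rho> x - N z \<bullet> x) z) \<le> a' * norm (y - z)"
    proof (rule differentiable_bound[of "cball z (2 * \<eta>)" _ "\<lambda>x v. N x \<bullet> v - N z \<bullet> v"])
      fix x assume x: "x \<in> cball z (2 * \<eta>)"
      show "((\<lambda>x. \<rho> x - N z \<bullet> x) has_derivative (\<lambda>v. N x \<bullet> v - N z \<bullet> v)) (at x within cball z (2 * \<eta>))"
        by (intro has_derivative_diff has_derivative_at_withinI[OF has_gradient_onD[OF \<rho>]])
           (auto intro!: derivative_eq_intros)
      have "dist (N x) (N z) < a'"
        using x \<eta> by (intro d2(2) inM[OF that(1)]) (auto simp: dist_norm norm_minus_commute)
      then show "onorm (\<lambda>v. N x \<bullet> v - N z \<bullet> v) \<le> a'"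
        using a' by (intro onorm_bound) (auto simp: inner_diff_left[symmetric] dist_norm
            intro!: order_trans[OF Cauchy_Schwarz_ineq2] mult_right_mono)
    qed (use that \<eta> in \<open>auto simp: dist_norm norm_minus_commute\<close>)
    then show ?thesis by (simp add: inner_diff_right algebra_simps)
  qed
  have near: "\<rho> z \<ge> - \<sigma>" if "z \<in> K" "y \<notin> K" "norm (y - z) \<le> 2 * \<eta>" for z y
  proof -
    have "dist (\<rho> y) (\<rho> z) < min \<sigma> r1"
      using that \<eta> by (intro d1(2) inM[OF that(1)]) (auto simp: dist_norm)
    then show ?thesis using that(2) K(2) by (auto simp: dist_real_def)
  qed
  \<comment> \<open>The shift by \<eta> along the unit normal stays in \<open>K\<close>, so
    \<open>\<rho> z\<close> is at most about \<open>- \<eta> * norm (N z)\<close>. A point outside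
    \<open>K\<close> near \<open>z + a\<close> then forces \<open>N z \<bullet> a\<close> to be
    almost maximal among vectors of length at most \<eta>, and expanding the square shows that
    \<open>a\<close> is close to the maximiser.\<close>
  have relevant: "norm (a - (\<eta> / norm (N z)) *\<^sub>R N z) \<le> \<beta> * \<eta>"
    if z: "cball z \<eta> \<subseteq> K" and a: "norm a \<le> \<eta>" and y: "y \<notin> K" "norm (y - (z + a)) \<le> \<epsilon>" for z a y
  proof -
    have zK: "z \<in> K" using z \<eta>(1) by force
    have "norm (y - z) \<le> norm (y - (z + a)) + norm a"
      using norm_triangle_ineq[of "y - (z + a)" a] by simp
    then have yz: "norm (y - z) \<le> \<eta> + \<epsilon>" using a y(2) by linarith
    then have yz2: "norm (y - z) \<le> 2 * \<eta>" using \<epsilon> \<eta>(1) by linarith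
    define n where "n = norm (N z)"
    have n: "n > n0" using \<sigma>(2)[OF zK near[OF zK y(1) yz2]] by (simp add: n_def)
    then have npos: "n > 0" using n0(1) by linarith
    define u where "u = (\<eta> / n) *\<^sub>R N z"
    have nu: "norm u = \<eta>" using npos \<eta>(1) by (simp add: u_def n_def)
    have "z + u \<in> K" using z nu by (auto simp: dist_norm subset_iff)
    then have "\<rho> (z + u) \<le> 0" using K(2) by auto
    moreover have "\<bar>\<rho> (z + u) - \<rho> z - N z \<bullet> u\<bar> \<le> a' * \<eta>" using lin[OF zK, of "z + u"] nu \<eta>(1) by simp
    moreover have "N z \<bullet> u = \<eta> * n"
      using npos by (simp add: u_def n_def power2_norm_eq_inner[symmetric] power2_eq_square)
    ultimately have 1: "\<rho> z + \<eta> * n \<le> a' * \<eta>" by linarith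
    have "\<rho> y > 0" using y(1) K(2) by auto
    moreover have "\<bar>\<rho> y - \<rho> z - N z \<bullet> (y - z)\<bar> \<le> a' * (2 * \<eta>)"
      using lin[OF zK yz2] mult_left_mono[OF yz2, of a'] a' by linarith
    ultimately have 2: "\<rho> z + N z \<bullet> (y - z) \<ge> - (a' * (2 * \<eta>))" by linarith
    have "\<bar>N z \<bullet> (y - (z + a))\<bar> \<le> n * \<epsilon>"
    proof -
      have "norm (N z) * norm (y - (z + a)) \<le> n * \<epsilon>"
        unfolding n_def using y(2) by (intro mult_left_mono) auto
      then show ?thesis using Cauchy_Schwarz_ineq2[of "N z" "y - (z + a)"] by linarith
    qed
    then have "N z \<bullet> (y - z) - N z \<bullet> a \<le> n * \<epsilon>" by (simp add: inner_diff_right inner_add_right abs_le_iff)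
    with 1 2 have Na: "N z \<bullet> a \<ge> \<eta> * n - 3 * a' * \<eta> - n * \<epsilon>" by (simp add: algebra_simps)
    have "3 * a' \<le> n * \<beta>\<^sup>2 / 4" unfolding a'_def using n mult_right_mono[of n0 n "\<beta>\<^sup>2"] by simp
    then have "3 * a' * \<eta> \<le> n * \<beta>\<^sup>2 / 4 * \<eta>" using \<eta>(1) by (intro mult_right_mono) auto
    with Na have "N z \<bullet> a \<ge> n * (\<eta> - \<eta> * \<beta>\<^sup>2 / 2)" by (simp add: \<epsilon>_def algebra_simps)
    then have "(\<eta> / n) * (N z \<bullet> a) \<ge> (\<eta> / n) * (n * (\<eta> - \<eta> * \<beta>\<^sup>2 / 2))"
      using npos \<eta>(1) by (intro mult_left_mono) auto
    then have ua: "u \<bullet> a \<ge> \<eta> * \<eta> - \<eta> * \<eta> * \<beta>\<^sup>2 / 2" using npos by (simp add: u_def algebra_simps)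
    have "(norm (a - u))\<^sup>2 = (norm a)\<^sup>2 + (norm u)\<^sup>2 - 2 * (u \<bullet> a)"
      unfolding power2_norm_eq_inner by (simp add: inner_diff_left inner_diff_right inner_commute[of a u])
    also have "\<dots> \<le> \<eta>\<^sup>2 + \<eta>\<^sup>2 - 2 * (\<eta> * \<eta> - \<eta> * \<eta> * \<beta>\<^sup>2 / 2)"
      using a ua nu power_mono[OF a, of 2] by simp
    also have "\<dots> = (\<beta> * \<eta>)\<^sup>2" by (simp add: power2_eq_square algebra_simps)
    finally have "norm (a - u) \<le> \<beta> * \<eta>" 
      by (rule power2_le_imp_le) (use \<beta>(1) \<eta>(1) in simp)
    then show ?thesis by (simp add: u_def n_def)
  qed
  \<comment> \<open>The square root of the kernel. The gradient of the kernel is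
    \<open>- 4 * gg a\<close> times \<open>a\<close>, so after integration by parts the weight is
    \<open>gg\<close> and not its square.\<close>
  define gg where "gg a = max 0 (\<eta>\<^sup>2 - (norm a)\<^sup>2)" for a :: 'a
  have gg: "gg a \<ge> 0" "gg a \<le> \<eta>\<^sup>2" "bump 0 \<eta> a = gg a * gg a" for a
    by (auto simp: gg_def bump_def power2_eq_square)
  have gg0: "gg a = 0" if "norm a \<ge> \<eta>" for a
    using power_mono[OF that, of 2] \<eta>(1) by (simp add: gg_def)
  have cgg: "continuous_on A gg" for A unfolding gg_def by (intro continuous_intros)
  have bg: "bump_grad 0 \<eta> a = (- 4 * gg a) *\<^sub>R a" for a by (simp add: bump_grad_def gg_def)
  show ?thesis
  proof (rule exI[of _ \<eta>], rule conjI, rule \<eta>(1), rule exI[of _ \<epsilon>], rule conjI, rule \<epsilon>(1),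
      rule exI[of _ \<tau>], rule conjI, rule \<tau>(1), rule exI[of _ B], intro allI impI)
    fix D \<phi> \<Phi>
    assume D: "open D" "K \<subseteq> D" and \<phi>: "has_gradient_on \<phi> \<Phi> D" and pos': "\<forall>x\<in>K. \<phi> x \<ge> 0"
      and small': "\<forall>x. cball x \<epsilon> \<subseteq> K \<longrightarrow> \<phi> x \<le> \<tau>"
      and large': "\<forall>x y. x \<in> K \<longrightarrow> y \<notin> K \<longrightarrow> dist x y < \<epsilon> / 2 \<longrightarrow> \<phi> x \<ge> B"
    note pos = pos'[rule_format] and small = small'[rule_format] and large = large'[rule_format]
    have c\<phi>: "continuous_on K \<phi>" "continuous_on K \<Phi>"
      using has_gradient_on_continuous[OF \<phi>] D(2) continuous_on_subset by blast+
    have inK: "z + a \<in> K" if "z \<in> Cs" "norm a \<le> \<eta>" for z a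
      using that by (auto simp: Cs_def dist_norm subset_iff)
    have CsK: "Cs \<subseteq> K" using inK[of _ 0] \<eta>(1) by auto
    have clCs: "closed Cs"
      unfolding Cs_def using K(1) \<eta>(1) by (intro closed_cball_subset compact_imp_closed) auto
    have cCs: "compact Cs" using clCs CsK K(1) by (metis compact_Int_closed inf.absorb_iff2)
    have cut: "continuous_on (Cs \<times> BX) (\<lambda>p. b (snd p) *\<^sub>R f (fst p + snd p))"
      if b: "continuous_on UNIV b" "\<And>a. norm a \<ge> \<eta> \<Longrightarrow> b a = 0" and f: "continuous_on K f"
      for b and f :: "'a \<Rightarrow> 'b::real_normed_vector"
    proof (rule continuous_on_cutoff[where S="{p. norm (snd p) \<le> \<eta>}" and T="{p. norm (snd p) \<ge> \<eta>}"])
      show "closed (Cs \<times> BX)" using clCs by (auto simp: BX_def intro: closed_Times)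
      show "closed {p::'a \<times> 'a. norm (snd p) \<le> \<eta>}" "closed {p::'a \<times> 'a. norm (snd p) \<ge> \<eta>}"
        by (intro closed_Collect_le continuous_intros)+
      show "continuous_on (Cs \<times> BX \<inter> {p. norm (snd p) \<le> \<eta>}) (\<lambda>p. f (fst p + snd p))"
        by (rule continuous_on_compose2[OF f]) (use inK in \<open>auto intro!: continuous_intros\<close>)
      show "continuous_on (Cs \<times> BX) (\<lambda>p. b (snd p))"
        by (rule continuous_on_compose2[OF b(1)]) (auto intro!: continuous_intros)
    qed (use b(2) in auto)
    have cutz: "continuous_on BX (\<lambda>a. b a *\<^sub>R f (z + a))"
      if "z \<in> Cs" "continuous_on UNIV b" "\<And>a. norm a \<ge> \<eta> \<Longrightarrow> b a = 0" "continuous_on K f"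
      for z b and f :: "'a \<Rightarrow> 'b::real_normed_vector"
    proof -
      have "continuous_on BX (\<lambda>a. (\<lambda>p. b (snd p) *\<^sub>R f (fst p + snd p)) (z, a))"
        by (rule continuous_on_compose2[OF cut[OF that(2-4)]]) (use that(1) in \<open>auto intro!: continuous_on_Pair continuous_on_const continuous_on_id\<close>)
      then show ?thesis by simp
    qed
    have cb1: "continuous_on UNIV (bump 0 \<eta> :: 'a \<Rightarrow> real)"
      by (rule has_gradient_on_continuous(1)[OF has_gradient_on_bump])
    have cb2: "bump 0 \<eta> a = 0" if "norm a \<ge> \<eta>" for a :: 'a using gg(3) gg0[OF that] by auto
    \<comment> \<open>Values and gradients are paired so that one Riemann sum approximates both
      integrals with the same nodes and weights.\<close>
    define H where "H p = (bump 0 \<eta> (snd p) *\<^sub>R \<phi> (fst p + snd p), bump 0 \<eta> (snd p) *\<^sub>R \<Phi> (fst p + snd p))" for p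
    have cH: "continuous_on (Cs \<times> BX) H"
      unfolding H_def by (intro continuous_on_Pair cut[OF cb1 cb2] c\<phi>)
    \<comment> \<open>1/4 keeps the level 1 apart from the integrals 1/4 and 2 of the two extreme
      cases; the other entry is the share of the gradient error.\<close>
    define e where "e = min (1/4) (2 * \<beta> / \<eta>)"
    have e: "e > 0" "e \<le> 1/4" "e \<le> 2 * \<beta> / \<eta>" using \<beta>(1) \<eta>(1) by (auto simp: e_def)
    obtain p :: "('a \<times> 'a set) set" where p: "finite p" "\<And>i. i \<in> p \<Longrightarrow> fst i \<in> BX"
      "\<And>z. z \<in> Cs \<Longrightarrow> norm (integral BX (\<lambda>a. H (z, a)) - (\<Sum>i\<in>p. measure lborel (snd i) *\<^sub>R H (z, fst i))) \<le> e"
      by (rule uniform_Riemann_sum[OF cH[unfolded BX_def] cCs e(1), folded BX_def]) blast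
    \<comment> \<open>Nodes outside the support of the kernel are dropped, since there
      \<open>z + fst i\<close> may leave \<open>K\<close>. Their weight is 0.\<close>
    define I where "I = {i \<in> p. norm (fst i) \<le> \<eta>}"
    define c where "c i = measure lborel (snd i) * bump 0 \<eta> (fst i)" for i :: "'a \<times> 'a set"
    define F where "F z = (\<Sum>i\<in>I. c i * \<phi> (z + fst i))" for z
    define G where "G z = (\<Sum>i\<in>I. c i *\<^sub>R \<Phi> (z + fst i))" for z
    have sums: "(\<Sum>i\<in>p. measure lborel (snd i) *\<^sub>R H (z, fst i)) = (F z, G z)" for z
    proof -
      have "(\<Sum>i\<in>p. measure lborel (snd i) *\<^sub>R H (z, fst i)) = (\<Sum>i\<in>p. (c i * \<phi> (z + fst i), c i *\<^sub>R \<Phi> (z + fst i)))"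
        by (simp add: H_def c_def mult.assoc)
      also have "\<dots> = (\<Sum>i\<in>I. (c i * \<phi> (z + fst i), c i *\<^sub>R \<Phi> (z + fst i)))"
      proof (rule sum.mono_neutral_right[OF p(1)])
        show "\<forall>i\<in>p - I. (c i * \<phi> (z + fst i), c i *\<^sub>R \<Phi> (z + fst i)) = 0"
        proof
          fix i assume "i \<in> p - I"
          then have "norm (fst i) \<ge> \<eta>" by (auto simp: I_def)
          then have "c i = 0" using cb2 by (simp add: c_def)
          then show "(c i * \<phi> (z + fst i), c i *\<^sub>R \<Phi> (z + fst i)) = 0" by (simp add: zero_prod_def)
        qed
      qed (auto simp: I_def)
      also have "\<dots> = (F z, G z)" by (simp add: sum_prod F_def G_def)
      finally show ?thesis .
    qed
    define Fi where "Fi z = integral BX (\<lambda>a. bump 0 \<eta> a *\<^sub>R \<phi> (z + a))" for z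
    define Gi where "Gi z = integral BX (\<lambda>a. bump 0 \<eta> a *\<^sub>R \<Phi> (z + a))" for z
    \<comment> \<open>The scale of the gradient: \<open>Gi z\<close> will be close to
      \<open>4 * J z\<close> times the vector of length \<eta> along \<open>N z\<close>.\<close>
    define J where "J z = integral BX (\<lambda>a. gg a *\<^sub>R \<phi> (z + a))" for z
    have ints: "((\<lambda>a. bump 0 \<eta> a *\<^sub>R \<phi> (z + a)) has_integral Fi z) BX"
      "((\<lambda>a. bump 0 \<eta> a *\<^sub>R \<Phi> (z + a)) has_integral Gi z) BX"
      "((\<lambda>a. gg a *\<^sub>R \<phi> (z + a)) has_integral J z) BX" if z: "z \<in> Cs" for z
      unfolding Fi_def Gi_def J_def
      using cutz[OF z cb1 cb2 c\<phi>(1)] cutz[OF z cb1 cb2 c\<phi>(2)] cutz[OF z cgg gg0 c\<phi>(1)]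
      unfolding BX_def by (auto intro!: integrable_integral integrable_continuous)
    have FG: "\<bar>Fi z - F z\<bar> \<le> e" "norm (Gi z - G z) \<le> e" if z: "z \<in> Cs" for z
    proof -
      have "continuous_on BX (\<lambda>a. H (z, a))"
        by (rule continuous_on_compose2[OF cH]) (use z in \<open>auto intro!: continuous_on_Pair continuous_on_const continuous_on_id\<close>)
      then have h: "((\<lambda>a. H (z, a)) has_integral integral BX (\<lambda>a. H (z, a))) BX"
        unfolding BX_def by (intro integrable_integral integrable_continuous)
      have "fst (integral BX (\<lambda>a. H (z, a))) = Fi z" "snd (integral BX (\<lambda>a. H (z, a))) = Gi z"
        using has_integral_unique[OF has_integral_linear[OF h bounded_linear_fst]] ints(1)[OF z]
          has_integral_unique[OF has_integral_linear[OF h bounded_linear_snd]] ints(2)[OF z]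
        by (simp_all add: o_def H_def)
      then have "integral BX (\<lambda>a. H (z, a)) = (Fi z, Gi z)" by (simp add: prod_eq_iff)
      with p(3)[OF z] sums[of z] have n: "norm (Fi z - F z, Gi z - G z) \<le> e" by simp
      show "\<bar>Fi z - F z\<bar> \<le> e" "norm (Gi z - G z) \<le> e"
        using norm_fst_le[of "Fi z - F z" "Gi z - G z"] norm_snd_le[of "Gi z - G z" "Fi z - F z"] n by auto
    qed
    \<comment> \<open>One factor of the kernel is at most \<open>\<eta>\<^sup>2\<close>; on the
      level 1 this bounds \<open>J z\<close> from below.\<close>
    have FJ: "Fi z \<le> \<eta>\<^sup>2 * J z" if z: "z \<in> Cs" for z
    proof (rule has_integral_le[OF ints(1)[OF z] has_integral_mult_right[OF ints(3)[OF z], of "\<eta>\<^sup>2"]])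
      fix a assume "a \<in> BX"
      show "bump 0 \<eta> a *\<^sub>R \<phi> (z + a) \<le> \<eta>\<^sup>2 * gg a *\<^sub>R \<phi> (z + a)"
      proof (cases "norm a \<le> \<eta>")
        case True
        have "gg a * (gg a * \<phi> (z + a)) \<le> \<eta>\<^sup>2 * (gg a * \<phi> (z + a))"
          using gg pos[OF inK[OF z True]] by (intro mult_right_mono) auto
        then show ?thesis by (simp add: gg(3) mult.assoc)
      next
        case False then show ?thesis using gg0[of a] by (simp add: gg(3))
      qed
    qed
    have parts: "Gi z \<bullet> v = integral BX (\<lambda>a. 4 * (gg a *\<^sub>R \<phi> (z + a)) * (a \<bullet> v))"
      and iparts: "(\<lambda>a. 4 * (gg a *\<^sub>R \<phi> (z + a)) * (a \<bullet> v)) integrable_on BX" if z: "z \<in> Cs" for z v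
    proof -
      have f: "has_gradient_on (\<lambda>a. \<phi> (a + z)) (\<lambda>a. \<Phi> (a + z)) {a. a + z \<in> D}"
        by (rule has_gradient_on_shift[OF \<phi>])
      have o: "open {a. a + z \<in> D}"
        using open_vimage[OF D(1), of "\<lambda>a. a + z"] by (simp add: vimage_def continuous_on_add)
      have sub: "cball 0 \<eta> \<subseteq> {a. a + z \<in> D}" using inK[OF z] D(2) by (auto simp: add.commute)
      have out: "bump 0 \<eta> x = 0 \<and> bump_grad 0 \<eta> x = 0" if "x \<notin> cball 0 \<eta>" for x :: 'a
        using bump_outside[OF \<eta>(1), of x 0] that by auto
      note g = has_gradient_on_cutoff[OF f has_gradient_on_bump o closed_cball sub out]
      have "integral BX (\<lambda>a. (bump 0 \<eta> a *\<^sub>R \<Phi> (a + z) + \<phi> (a + z) *\<^sub>R bump_grad 0 \<eta> a) \<bullet> v) = 0"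
        unfolding BX_def
        by (rule integral_gradient_compact_support[OF g BX[unfolded BX_def]]) (use out in auto)
      moreover have i1: "(\<lambda>a. 4 * (gg a *\<^sub>R \<phi> (z + a)) * (a \<bullet> v)) integrable_on BX"
        unfolding BX_def
        by (intro integrable_continuous continuous_on_mult[OF continuous_on_mult[OF continuous_on_const
              cutz[OF z cgg gg0 c\<phi>(1), unfolded BX_def]]] continuous_intros)
      moreover have i2: "((\<lambda>a. (bump 0 \<eta> a *\<^sub>R \<Phi> (z + a)) \<bullet> v) has_integral Gi z \<bullet> v) BX"
        using has_integral_linear[OF ints(2)[OF z] bounded_linear_inner_left[of v]] by (simp add: o_def)
      moreover have "(\<lambda>a. (bump 0 \<eta> a *\<^sub>R \<Phi> (a + z) + \<phi> (a + z) *\<^sub>R bump_grad 0 \<eta> a) \<bullet> v)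
          = (\<lambda>a. (bump 0 \<eta> a *\<^sub>R \<Phi> (z + a)) \<bullet> v - 4 * (gg a *\<^sub>R \<phi> (z + a)) * (a \<bullet> v))"
        by (rule ext) (simp add: bg inner_diff_left add.commute[of _ z] mult_ac)
      ultimately show "Gi z \<bullet> v = integral BX (\<lambda>a. 4 * (gg a *\<^sub>R \<phi> (z + a)) * (a \<bullet> v))"
        using integral_diff[OF has_integral_integrable[OF i2] i1] integral_unique[OF i2] by simp
      show "(\<lambda>a. 4 * (gg a *\<^sub>R \<phi> (z + a)) * (a \<bullet> v)) integrable_on BX" by (rule i1)
    qed
    \<comment> \<open>Used by contraposition on the level 1: some point outside \<open>K\<close>
      lies within \<open>\<eta> + \<epsilon>\<close> of \<open>z\<close>, which puts
      \<open>z\<close> in the collar where \<open>N\<close> is bounded below.\<close>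
    have deepF: "Fi z \<le> 1/4" if z: "z \<in> Cs" and far: "\<And>y. y \<notin> K \<Longrightarrow> norm (y - z) > \<eta> + \<epsilon>" for z
    proof -
      have "norm (Fi z) \<le> (\<tau> * \<eta> ^ 4) * cB"
        unfolding cB_def BX_def
      proof (rule has_integral_bound[OF _ ints(1)[OF z, unfolded BX_def]])
        show "0 \<le> \<tau> * \<eta> ^ 4" using \<tau> \<eta> by simp
        fix a assume "a \<in> cbox (- \<eta> *\<^sub>R One) (\<eta> *\<^sub>R (One::'a))"
        show "norm (bump 0 \<eta> a *\<^sub>R \<phi> (z + a)) \<le> \<tau> * \<eta> ^ 4"
        proof (cases "norm a \<le> \<eta>")
          case True
          have "cball (z + a) \<epsilon> \<subseteq> K"
          proof
            fix y assume "y \<in> cball (z + a) \<epsilon>"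
            then have "norm (y - (z + a)) \<le> \<epsilon>" by (simp add: dist_norm norm_minus_commute)
            moreover have "norm (y - z) \<le> norm (y - (z + a)) + norm a"
              using norm_triangle_ineq[of "y - (z + a)" a] by simp
            ultimately show "y \<in> K" using far[of y] True by force
          qed
          then have "\<phi> (z + a) \<le> \<tau>" by (rule small)
          moreover have "gg a * gg a \<le> \<eta>\<^sup>2 * \<eta>\<^sup>2" using gg by (intro mult_mono) auto
          ultimately have "(gg a * gg a) * \<phi> (z + a) \<le> (\<eta>\<^sup>2 * \<eta>\<^sup>2) * \<tau>"
            using gg pos[OF inK[OF z True]] \<tau> by (intro mult_mono) auto
          then show ?thesis using gg pos[OF inK[OF z True]] by (simp add: gg(3) abs_mult power_def mult_ac numeral_eq_Suc)
        next
          case False then show ?thesis using gg0[of a] \<tau> \<eta> by (simp add: gg(3))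
        qed
      qed
      then show ?thesis using \<tau>(2) \<beta>(2) by simp
    qed
    have shallowF: "Fi z \<ge> 2" if z: "z \<in> Cs" and y: "y \<notin> K" "norm (y - z) < \<eta> + e1" for z y
    proof -
      define t where "t = norm (y - z)"
      have t: "t > \<eta>" using y(1) z unfolding t_def Cs_def by (force simp: dist_norm norm_minus_commute)
      \<comment> \<open>The shift towards the outside point \<open>y\<close>, shortened so that the
        cube around it keeps distance \<open>e1\<close> from the edge of the kernel.\<close>
      define a0 where "a0 = ((\<eta> - 2 * e1) / t) *\<^sub>R (y - z)"
      have tpos: "t > 0" using t \<eta>(1) by linarith
      have na0: "norm a0 = \<eta> - 2 * e1" unfolding a0_def norm_scaleR t_def[symmetric] using tpos e1 by simp
      have "y - z - a0 = ((t - (\<eta> - 2 * e1)) / t) *\<^sub>R (y - z)"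
        unfolding a0_def using tpos by (simp add: diff_divide_distrib scaleR_diff_left)
      moreover have p: "(t - (\<eta> - 2 * e1)) / t \<ge> 0" using tpos t e1(1) by (intro divide_nonneg_pos) auto
      ultimately have "norm (y - z - a0) = (t - (\<eta> - 2 * e1)) / t * t"
        by (simp only: norm_scaleR t_def[symmetric] abs_of_nonneg)
      then have "norm (y - z - a0) = t - (\<eta> - 2 * e1)" using tpos by simp
      then have ya0: "norm (y - z - a0) < 3 * e1" using y(2) by (simp add: t_def)
      have in_cube: "norm a \<le> \<eta> - e1 \<and> \<phi> (z + a) \<ge> B" if "a \<in> cube a0" for a
      proof -
        have a: "norm (a - a0) \<le> e1" using cube_sub that by (force simp: dist_norm norm_minus_commute)
        have na: "norm a \<le> \<eta> - e1" using a na0 norm_triangle_sub[of a a0] by linarith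
        have "z + a \<in> K" using inK[OF z, of a] na e1(1) by linarith
        moreover have "dist (z + a) y < \<epsilon> / 2"
        proof -
          have "norm ((a - a0) - (y - z - a0)) < e1 + 3 * e1"
            using norm_triangle_ineq4[of "a - a0" "y - z - a0"] a ya0 by linarith
          then show ?thesis using e1 by (simp add: dist_norm algebra_simps)
        qed
        ultimately show ?thesis using large y(1) na by blast
      qed
      have sub: "cube a0 \<subseteq> BX"
        using in_cube e1(1) BX by (force simp: subset_iff)
      have "((\<lambda>a. B * (\<eta> * e1)\<^sup>2) has_integral measure lborel (cube a0) *\<^sub>R (B * (\<eta> * e1)\<^sup>2)) (cube a0)"
        unfolding cube_def by (rule has_integral_const)
      moreover have "((\<lambda>a. bump 0 \<eta> a *\<^sub>R \<phi> (z + a)) has_integral integral (cube a0) (\<lambda>a. bump 0 \<eta> a *\<^sub>R \<phi> (z + a))) (cube a0)"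
        unfolding cube_def using sub cutz[OF z cb1 cb2 c\<phi>(1)]
        by (intro integrable_integral integrable_continuous) (auto simp: cube_def intro: continuous_on_subset)
      moreover have "B * (\<eta> * e1)\<^sup>2 \<le> bump 0 \<eta> a *\<^sub>R \<phi> (z + a)" if a: "a \<in> cube a0" for a
      proof -
        have "(norm a)\<^sup>2 \<le> (\<eta> - e1)\<^sup>2" using in_cube[OF a] by (intro power_mono) auto
        moreover have "(\<eta> - e1)\<^sup>2 = \<eta>\<^sup>2 - 2 * (\<eta> * e1) + e1 * e1" by (simp add: power2_eq_square algebra_simps)
        moreover have "e1 * e1 \<le> \<eta> * e1" using e1 by (intro mult_right_mono) auto
        ultimately have "\<eta> * e1 \<le> gg a" unfolding gg_def by linarith
        then have "(\<eta> * e1) * (\<eta> * e1) \<le> gg a * gg a" using \<eta>(1) e1(1) gg(1)[of a] by (intro mult_mono) auto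
        then have "((\<eta> * e1) * (\<eta> * e1)) * B \<le> (gg a * gg a) * \<phi> (z + a)"
          using in_cube[OF a] B(1) gg(1)[of a] by (intro mult_mono[of "(\<eta> * e1) * (\<eta> * e1)" "gg a * gg a"]) auto
        then show ?thesis by (simp add: gg(3) power2_eq_square mult_ac)
      qed
      ultimately have "measure lborel (cube a0) *\<^sub>R (B * (\<eta> * e1)\<^sup>2) \<le> integral (cube a0) (\<lambda>a. bump 0 \<eta> a *\<^sub>R \<phi> (z + a))"
        by (rule has_integral_le)
      also have "\<dots> \<le> Fi z"
        unfolding Fi_def
      proof (rule integral_subset_le[OF sub])
        show "(\<lambda>a. bump 0 \<eta> a *\<^sub>R \<phi> (z + a)) integrable_on cube a0"
          unfolding cube_def using sub cutz[OF z cb1 cb2 c\<phi>(1)]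
          by (intro integrable_continuous) (auto simp: cube_def intro: continuous_on_subset)
        show "(\<lambda>a. bump 0 \<eta> a *\<^sub>R \<phi> (z + a)) integrable_on BX" using ints(1)[OF z] by blast
        show "\<forall>a\<in>BX. 0 \<le> bump 0 \<eta> a *\<^sub>R \<phi> (z + a)"
        proof
          fix a
          show "0 \<le> bump 0 \<eta> a *\<^sub>R \<phi> (z + a)"
            using pos[OF inK[OF z, of a]] gg0[of a] gg(1)[of a] by (cases "norm a \<le> \<eta>") (auto simp: gg(3))
        qed
      qed
      finally show ?thesis using B(2) cube_content by (simp add: mult_ac)
    qed
    have "c i \<ge> 0 \<and> norm (fst i) \<le> \<eta>" if "i \<in> I" for i using that by (auto simp: I_def c_def bump_nonneg)
    moreover have "z \<in> interior Cs \<and> F z < 1" if z: "\<rho> z \<le> - r1" for z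
    proof -
      have zK: "z \<in> K" using z r1 K(2) by auto
      have far: "norm (y - z) > 2 * \<eta>" if "y \<notin> K" for y
      proof (rule ccontr)
        assume "\<not> norm (y - z) > 2 * \<eta>"
        then have "dist (\<rho> y) (\<rho> z) < min \<sigma> r1"
          using \<eta> zK by (intro d1(2) inM[OF zK]) (auto simp: dist_norm)
        then have "\<rho> y < 0" using z by (auto simp: dist_real_def)
        with that K(2) show False by auto
      qed
      have "ball z \<eta> \<subseteq> Cs"
      proof
        fix w assume w: "w \<in> ball z \<eta>"
        have "y \<in> K" if "dist w y \<le> \<eta>" for y
        proof (rule ccontr)
          assume "y \<notin> K"
          then have "dist y z > 2 * \<eta>" using far by (simp add: dist_norm)
          with w that show False using dist_triangle[of y z w] by (simp add: dist_commute)
        qed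
        then show "w \<in> Cs" by (auto simp: Cs_def)
      qed
      then have zi: "z \<in> interior Cs" using \<eta>(1) by (meson centre_in_ball interiorI open_ball)
      then have zC: "z \<in> Cs" using interior_subset by blast
      have "Fi z \<le> 1/4" by (rule deepF[OF zC]) (use far \<epsilon> \<eta>(1) in force)
      with FG(1)[OF zC] e(2) zi show ?thesis by auto
    qed
    \<comment> \<open>Otherwise a point within \<open>e1\<close> of \<open>z\<close> has an outside
      point within \<eta>, and \<open>shallowF\<close> makes the integral at \<open>z\<close> at
      least 2.\<close>
    moreover have "z \<in> interior Cs" if z: "z \<in> Cs" "F z \<le> 1" for z
    proof (rule ccontr)
      assume "z \<notin> interior Cs"
      then have "\<not> ball z e1 \<subseteq> Cs" using e1(1) by (meson centre_in_ball interiorI open_ball)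
      then obtain z' y where zy: "dist z z' < e1" "dist z' y \<le> \<eta>" "y \<notin> K" by (auto simp: Cs_def subset_iff)
      have "norm (y - z) < \<eta> + e1" using zy dist_triangle[of y z z'] by (simp add: dist_norm[symmetric] dist_commute)
      then have "Fi z \<ge> 2" using shallowF[OF z(1) zy(3)] by simp
      with FG(1)[OF z(1)] e(2) z(2) show False by auto
    qed
    moreover have "G z \<noteq> 0 \<and> (\<exists>k>0. norm (G z - k *\<^sub>R N z) \<le> \<alpha> * k)" if z: "z \<in> Cs" "F z = 1" for z
    proof -
      have Fz: "Fi z \<ge> 1/2" using FG(1)[OF z(1)] e(2) z(2) by auto
      have zK: "z \<in> K" using z(1) CsK by auto
      obtain y where y: "y \<notin> K" "norm (y - z) \<le> \<eta> + \<epsilon>"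
        using deepF[OF z(1)] Fz by force
      have n: "norm (N z) > n0" using \<sigma>(2)[OF zK near[OF zK y(1)]] y(2) \<epsilon> \<eta>(1) by simp
      define n where "n = norm (N z)"
      have npos: "n > 0" using n n0(1) unfolding n_def by linarith
      define u where "u = (\<eta> / n) *\<^sub>R N z"
      have nu: "norm u = \<eta>" using npos \<eta>(1) by (simp add: u_def n_def)
      have J: "J z \<ge> 1 / (2 * \<eta>\<^sup>2)"
        using FJ[OF z(1)] Fz \<eta>(1) by (simp add: field_simps)
      then have Jpos: "J z > 0" using \<eta>(1) by (smt (verit) divide_pos_pos zero_less_power)
      \<comment> \<open>Pointwise dichotomy under the integral: either \<open>z + a\<close> is deep
        and the term is negligible by the choice of \<tau>, or the shift is relevant and within
        \<open>\<beta> * \<eta>\<close> of \<open>u\<close>.\<close>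
      have est: "\<bar>(Gi z - (4 * J z) *\<^sub>R u) \<bullet> v\<bar> \<le> (8 * \<beta> * \<eta> * J z) * norm v" for v
      proof -
        let ?f = "\<lambda>a. 4 * (gg a *\<^sub>R \<phi> (z + a)) * (a \<bullet> v) - 4 * (u \<bullet> v) * (gg a *\<^sub>R \<phi> (z + a))"
        let ?g = "\<lambda>a. (4 * \<beta> * \<eta> * norm v) * (gg a *\<^sub>R \<phi> (z + a)) + (8 * \<tau> * \<eta> ^ 3 * norm v)"
        have f: "(?f has_integral (Gi z \<bullet> v - 4 * (u \<bullet> v) * J z)) BX"
          using parts[OF z(1), of v] iparts[OF z(1), of v]
          by (intro has_integral_diff has_integral_mult_right ints(3)[OF z(1)]) (simp add: integrable_integral)
        have g: "(?g has_integral ((4 * \<beta> * \<eta> * norm v) * J z + cB *\<^sub>R (8 * \<tau> * \<eta> ^ 3 * norm v))) BX"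
          unfolding cB_def BX_def
          by (intro has_integral_add has_integral_mult_right has_integral_const ints(3)[OF z(1), unfolded BX_def])
        have pw: "\<bar>?f a\<bar> \<le> ?g a" for a
        proof (cases "norm a < \<eta>")
          case False
          then show ?thesis using gg0[of a] \<tau>(1) \<eta>(1) by simp
        next
          case True
          then have aK: "\<phi> (z + a) \<ge> 0" using pos inK[OF z(1)] by simp
          have eq: "?f a = 4 * (gg a * \<phi> (z + a)) * ((a - u) \<bullet> v)" by (simp add: inner_diff_left algebra_simps)
          have "\<bar>?f a\<bar> = 4 * (gg a * \<phi> (z + a)) * \<bar>(a - u) \<bullet> v\<bar>"
            unfolding eq abs_mult using gg(1)[of a] aK by simp
          also have "\<dots> \<le> 4 * (gg a * \<phi> (z + a)) * (norm (a - u) * norm v)"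
            using gg(1)[of a] aK Cauchy_Schwarz_ineq2 by (intro mult_left_mono) auto
          finally have 1: "\<bar>?f a\<bar> \<le> 4 * (gg a * \<phi> (z + a)) * (norm (a - u) * norm v)" .
          show ?thesis
          proof (cases "cball (z + a) \<epsilon> \<subseteq> K")
            case True
            have "norm (a - u) \<le> 2 * \<eta>" using norm_triangle_ineq4[of a u] nu \<open>norm a < \<eta>\<close> by linarith
            then have "4 * (gg a * \<phi> (z + a)) * (norm (a - u) * norm v) \<le> 4 * (\<eta>\<^sup>2 * \<tau>) * ((2 * \<eta>) * norm v)"
              using gg[of a] aK small[OF True] \<eta>(1) \<tau>(1) by (intro mult_mono) auto
            also have "\<dots> = 8 * \<tau> * \<eta> ^ 3 * norm v" by (simp add: power2_eq_square power3_eq_cube)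
            finally show ?thesis using 1 gg(1)[of a] aK \<beta>(1) \<eta>(1) by (smt (verit) mult_nonneg_nonneg norm_ge_zero real_scaleR_def)
          next
            case False
            then obtain w where "w \<notin> K" "dist (z + a) w \<le> \<epsilon>" by (auto simp: subset_iff)
            then have "norm (a - u) \<le> \<beta> * \<eta>"
              using relevant[of z a w] z(1) \<open>norm a < \<eta>\<close> by (simp add: Cs_def u_def n_def dist_norm norm_minus_commute)
            then have "4 * (gg a * \<phi> (z + a)) * (norm (a - u) * norm v) \<le> 4 * (gg a * \<phi> (z + a)) * ((\<beta> * \<eta>) * norm v)"
              using gg(1)[of a] aK by (intro mult_left_mono mult_right_mono) auto
            also have "\<dots> = (4 * \<beta> * \<eta> * norm v) * (gg a *\<^sub>R \<phi> (z + a))" by simp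
            finally have "\<bar>?f a\<bar> \<le> (4 * \<beta> * \<eta> * norm v) * (gg a *\<^sub>R \<phi> (z + a))" using 1 by linarith
            moreover have "0 \<le> 8 * \<tau> * \<eta> ^ 3 * norm v" using \<tau>(1) \<eta>(1) by simp
            ultimately show ?thesis by linarith
          qed
        qed
        have "\<bar>Gi z \<bullet> v - 4 * (u \<bullet> v) * J z\<bar> \<le> (4 * \<beta> * \<eta> * norm v) * J z + cB *\<^sub>R (8 * \<tau> * \<eta> ^ 3 * norm v)"
          using has_integral_le[OF f g] has_integral_le[OF has_integral_neg[OF f] g] pw
          by (force simp: abs_le_iff)
        \<comment> \<open>The lower bound on \<open>J z\<close> turns the absolute error of the deep
          shifts into a relative one.\<close>
        also have "cB *\<^sub>R (8 * \<tau> * \<eta> ^ 3 * norm v) \<le> (4 * \<beta> * \<eta> * norm v) * J z"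
        proof -
          have "8 * (\<tau> * \<eta> ^ 4 * cB) / \<eta> = 2 * \<beta> / \<eta>" unfolding \<tau>(2) by simp
          also have "\<dots> = 4 * \<beta> * \<eta> * (1 / (2 * \<eta>\<^sup>2))" using \<eta>(1) by (simp add: power2_eq_square)
          also have "\<dots> \<le> 4 * \<beta> * \<eta> * J z" using J \<beta>(1) \<eta>(1) by (intro mult_left_mono) auto
          finally have "8 * (\<tau> * \<eta> ^ 4 * cB) / \<eta> \<le> 4 * \<beta> * \<eta> * J z" .
          moreover have "8 * (\<tau> * \<eta> ^ 4 * cB) / \<eta> = cB * (8 * \<tau> * \<eta> ^ 3)"
          proof -
            have "\<eta> ^ 4 = \<eta> * \<eta> ^ 3" by (simp add: power_numeral_reduce)
            then show ?thesis using \<eta>(1) by simp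
          qed
          ultimately have "cB * (8 * \<tau> * \<eta> ^ 3) * norm v \<le> 4 * \<beta> * \<eta> * J z * norm v"
            by (intro mult_right_mono) auto
          then show ?thesis by (simp add: mult_ac)
        qed
        finally show ?thesis by (simp add: inner_diff_left algebra_simps)
      qed
      have "norm (Gi z - (4 * J z) *\<^sub>R u) \<le> 8 * \<beta> * \<eta> * J z"
      proof (cases "Gi z - (4 * J z) *\<^sub>R u = 0")
        case True then show ?thesis using \<beta>(1) \<eta>(1) Jpos by simp
      next
        case False
        have "norm (Gi z - (4 * J z) *\<^sub>R u) * norm (Gi z - (4 * J z) *\<^sub>R u) \<le> (8 * \<beta> * \<eta> * J z) * norm (Gi z - (4 * J z) *\<^sub>R u)"
          using est[of "Gi z - (4 * J z) *\<^sub>R u"] by (simp add: power2_norm_eq_inner[symmetric] power2_eq_square)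
        then show ?thesis using False by simp
      qed
      moreover have "norm (G z - Gi z) \<le> 4 * \<beta> * \<eta> * J z"
      proof -
        have "2 * \<beta> / \<eta> = 4 * \<beta> * \<eta> * (1 / (2 * \<eta>\<^sup>2))" using \<eta>(1) by (simp add: power2_eq_square)
        also have "\<dots> \<le> 4 * \<beta> * \<eta> * J z" using J \<beta>(1) \<eta>(1) by (intro mult_left_mono) auto
        finally show ?thesis using FG(2)[OF z(1)] e(3) by (simp add: norm_minus_commute)
      qed
      ultimately have 1: "norm (G z - (4 * J z) *\<^sub>R u) \<le> 12 * \<beta> * \<eta> * J z"
        using norm_triangle_ineq[of "G z - Gi z" "Gi z - (4 * J z) *\<^sub>R u"] by simp
      \<comment> \<open>Converts the multiple of \<open>u\<close> into one of \<open>N z\<close>.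
        The errors from relevant shifts, deep shifts and the Riemann sum, each
        \<open>4 * \<beta> * \<eta> * J z\<close>, together become
        \<open>3 * \<beta> * n * k\<close>.\<close>
      define k where "k = 4 * J z * \<eta> / n"
      have k: "k > 0" using Jpos \<eta>(1) npos by (simp add: k_def)
      have eq: "12 * \<beta> * \<eta> * J z = 3 * \<beta> * n * k" using npos by (simp add: k_def)
      have ku: "(4 * J z) *\<^sub>R u = k *\<^sub>R N z" by (simp add: u_def k_def)
      have "G z \<noteq> 0"
      proof
        assume "G z = 0"
        then have "n * k \<le> 12 * \<beta> * \<eta> * J z" using 1 k unfolding ku by (simp add: n_def mult.commute)
        also have "\<dots> \<le> 1/2 * (n * k)" unfolding eq using \<beta>(4) npos k by simp
        finally show False using npos k by (simp add: mult_le_0_iff)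
      qed
      have "3 * \<beta> * n * k \<le> 3 * \<beta> * C * k"
        using C(2)[OF inM[OF zK, of z]] \<beta>(1) k by (intro mult_right_mono mult_left_mono) (auto simp: n_def)
      also have "\<dots> \<le> \<alpha> * k" using \<beta>(3) k by (intro mult_right_mono) auto
      finally have "norm (G z - k *\<^sub>R N z) \<le> \<alpha> * k" using 1 eq unfolding ku by linarith
      with k \<open>G z \<noteq> 0\<close> show ?thesis by blast
    qed
    ultimately show "\<exists>I c a. finite (I :: ('a \<times> 'a set) set) \<and> (\<forall>i\<in>I. c i \<ge> 0 \<and> norm (a i) \<le> \<eta>) \<and>
         (\<forall>z. \<rho> z \<le> - r1 \<longrightarrow> z \<in> interior {z. cball z \<eta> \<subseteq> K} \<and> (\<Sum>i\<in>I. c i * \<phi> (z + a i)) < 1) \<and>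
         (\<forall>z. cball z \<eta> \<subseteq> K \<longrightarrow> (\<Sum>i\<in>I. c i * \<phi> (z + a i)) \<le> 1 \<longrightarrow> z \<in> interior {z. cball z \<eta> \<subseteq> K}) \<and>
         (\<forall>z. cball z \<eta> \<subseteq> K \<longrightarrow> (\<Sum>i\<in>I. c i * \<phi> (z + a i)) = 1 \<longrightarrow>
            (\<Sum>i\<in>I. c i *\<^sub>R \<Phi> (z + a i)) \<noteq> 0 \<and>
            (\<exists>k>0. norm ((\<Sum>i\<in>I. c i *\<^sub>R \<Phi> (z + a i)) - k *\<^sub>R N z) \<le> \<alpha> * k))"
      using p(1) by (intro exI[of _ I] exI[of _ c] exI[of _ fst]) (auto simp: F_def G_def Cs_def I_def)
  qed
qed

section \<open>Separating polynomials and rational functions\<close>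

text \<open>Generated by the ring operations instead of coefficients, so that translation and
  differentiation are plain inductions. \<open>polynomial_fun_cpoly_eval\<close> and
  \<open>polynomial_fun_imp_cpoly_eval\<close> identify the class with the polynomials of the
  hulls.\<close>

inductive polynomial_fun :: "(complex ^ 'n::finite \<Rightarrow> complex) \<Rightarrow> bool" where
  const: "polynomial_fun (\<lambda>z. c)"
| coord: "polynomial_fun (\<lambda>z. z $ i)"
| add: "polynomial_fun f \<Longrightarrow> polynomial_fun g \<Longrightarrow> polynomial_fun (\<lambda>z. f z + g z)"
| mult: "polynomial_fun f \<Longrightarrow> polynomial_fun g \<Longrightarrow> polynomial_fun (\<lambda>z. f z * g z)"

lemma polynomial_fun_sum:
  "(\<And>i. i \<in> I \<Longrightarrow> polynomial_fun (f i)) \<Longrightarrow> polynomial_fun (\<lambda>z. \<Sum>i\<in>I. f i z)"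
  by (induction I rule: infinite_finite_induct) (auto intro: polynomial_fun.intros)

lemma polynomial_fun_prod:
  "(\<And>i. i \<in> I \<Longrightarrow> polynomial_fun (f i)) \<Longrightarrow> polynomial_fun (\<lambda>z. \<Prod>i\<in>I. f i z)"
  by (induction I rule: infinite_finite_induct) (auto intro: polynomial_fun.intros)

lemma polynomial_fun_power: "polynomial_fun f \<Longrightarrow> polynomial_fun (\<lambda>z. f z ^ k)"
  by (induction k) (auto intro: polynomial_fun.intros)

lemma polynomial_fun_cmult: "polynomial_fun f \<Longrightarrow> polynomial_fun (\<lambda>z. c * f z)"
  by (intro polynomial_fun.intros)

lemma polynomial_fun_uminus: "polynomial_fun f \<Longrightarrow> polynomial_fun (\<lambda>z. - f z)"
  using polynomial_fun_cmult[of f "- 1"] by simp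

lemma polynomial_fun_diff: "polynomial_fun f \<Longrightarrow> polynomial_fun g \<Longrightarrow> polynomial_fun (\<lambda>z. f z - g z)"
  using polynomial_fun.add[of f "\<lambda>z. - g z"] polynomial_fun_uminus[of g] by simp

lemma polynomial_fun_shift: "polynomial_fun f \<Longrightarrow> polynomial_fun (\<lambda>z. f (z + b))"
  by (induction rule: polynomial_fun.induct) (auto intro: polynomial_fun.intros)

lemma polynomial_fun_continuous: "polynomial_fun f \<Longrightarrow> continuous_on A f"
  by (induction rule: polynomial_fun.induct) (auto intro!: continuous_intros)

section \<open>Comparison with coefficient families\<close>

lemma cpoly_eval_superset:
  assumes "finite A" "Poly_Mapping.keys P \<subseteq> A"
  shows "cpoly_eval P z = (\<Sum>m\<in>A. Poly_Mapping.lookup P m * (\<Prod>i\<in>UNIV. (z $ i) ^ Poly_Mapping.lookup m i))"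
  unfolding cpoly_eval_def using assms
  by (intro sum.mono_neutral_left) (auto simp: in_keys_iff)

lemma cpoly_eval_add: "cpoly_eval (P + Q) z = cpoly_eval P z + cpoly_eval Q z"
proof -
  let ?A = "Poly_Mapping.keys P \<union> Poly_Mapping.keys Q"
  have "Poly_Mapping.keys (P + Q) \<subseteq> ?A" by (rule keys_add)
  then show ?thesis
    by (subst (1 2 3) cpoly_eval_superset[of ?A])
       (auto simp: lookup_add sum.distrib algebra_simps)
qed

lemma cpoly_eval_single:
  "cpoly_eval (Poly_Mapping.single m c) z = c * (\<Prod>i\<in>UNIV. (z $ i) ^ Poly_Mapping.lookup m i)"
  by (subst cpoly_eval_superset[of "{m}"]) auto

lemma polynomial_fun_cpoly_eval: "polynomial_fun (cpoly_eval P)"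
  unfolding cpoly_eval_def
  by (intro polynomial_fun_sum polynomial_fun_cmult polynomial_fun_prod polynomial_fun_power polynomial_fun.coord)

lemma cpoly_eval_sum: "cpoly_eval (\<Sum>i\<in>I. P i) z = (\<Sum>i\<in>I. cpoly_eval (P i) z)"
  by (induction I rule: infinite_finite_induct)
     (auto simp: cpoly_eval_add cpoly_eval_def[of 0])

lemma polynomial_fun_imp_cpoly_eval:
  fixes f :: "complex ^ 'n::finite \<Rightarrow> complex"
  assumes "polynomial_fun f"
  shows "\<exists>P. f = cpoly_eval P"
  using assms
proof (induction rule: polynomial_fun.induct)
  case (const c)
  show ?case by (rule exI[of _ "Poly_Mapping.single 0 c"]) (simp add: fun_eq_iff cpoly_eval_single)
next
  case (coord i)
  have "(\<Prod>j\<in>UNIV. (z $ j) ^ Poly_Mapping.lookup (Poly_Mapping.single i 1) j) = z $ i" for z :: "complex ^ 'n"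
  proof -
    have "(\<Prod>j\<in>UNIV. (z $ j) ^ Poly_Mapping.lookup (Poly_Mapping.single i 1) j)
      = (\<Prod>j\<in>UNIV. if j = i then z $ i else 1)"
      by (intro prod.cong) (auto simp: lookup_single when_def)
    then show ?thesis by simp
  qed
  then show ?case
    by (intro exI[of _ "Poly_Mapping.single (Poly_Mapping.single i 1) 1"] ext) (simp only: cpoly_eval_single mult_1_left)
next
  case (add f g)
  then obtain P Q where "f = cpoly_eval P" "g = cpoly_eval Q" by blast
  then show ?case by (intro exI[of _ "P + Q"]) (simp add: fun_eq_iff cpoly_eval_add)
next
  case (mult f g)
  then obtain P Q where PQ: "f = cpoly_eval P" "g = cpoly_eval Q" by blast
  let ?R = "\<Sum>m\<in>Poly_Mapping.keys P. \<Sum>k\<in>Poly_Mapping.keys Q.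
      Poly_Mapping.single (m + k) (Poly_Mapping.lookup P m * Poly_Mapping.lookup Q k)"
  have "f z * g z = cpoly_eval ?R z" for z
    unfolding PQ cpoly_eval_sum cpoly_eval_single
    unfolding cpoly_eval_def sum_product
    by (intro sum.cong refl) (simp add: lookup_add power_add prod.distrib)
  then show ?case by (intro exI[of _ ?R]) (simp add: fun_eq_iff)
qed

text \<open>Equality of total functions, with the value 0 at the zeros of \<open>q\<close>, since
  division by 0 gives 0. As one \<open>q\<close> governs the whole space, \<open>f\<close> is
  regular on the open set where \<open>q\<close> does not vanish.\<close>

definition rational_fun_on :: "(complex ^ 'n::finite) set \<Rightarrow> (complex ^ 'n \<Rightarrow> complex) \<Rightarrow> bool" where
  "rational_fun_on K f \<longleftrightarrow>
     (\<exists>p q. polynomial_fun p \<and> polynomial_fun q \<and> (\<forall>z\<in>K. q z \<noteq> 0) \<and> f = (\<lambda>z. p z / q z))"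

lemma polynomial_imp_rational: "polynomial_fun f \<Longrightarrow> rational_fun_on K f"
  unfolding rational_fun_on_def
  by (rule exI[of _ f], rule exI[of _ "\<lambda>z. 1"]) (auto intro: polynomial_fun.intros)

lemma rational_fun_on_continuous:
  assumes "rational_fun_on K f"
  shows "continuous_on K f"
proof -
  obtain p q where pq: "polynomial_fun p" "polynomial_fun q" "\<forall>z\<in>K. q z \<noteq> 0" "f = (\<lambda>z. p z / q z)"
    using assms unfolding rational_fun_on_def by blast
  show ?thesis
    unfolding pq(4) by (intro continuous_on_divide polynomial_fun_continuous pq(1-3))
qed

section \<open>Families small deep inside and large near the boundary\<close>

lemma polynomial_fun_cmult_power:
  "polynomial_fun f \<Longrightarrow> polynomial_fun (\<lambda>z. (c * f z) ^ k)"
  by (intro polynomial_fun_power polynomial_fun_cmult)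

lemma rational_fun_on_cmult_power:
  assumes "rational_fun_on K f"
  shows "rational_fun_on K (\<lambda>z. (c * f z) ^ k)"
proof -
  obtain p q where pq: "polynomial_fun p" "polynomial_fun q" "\<forall>z\<in>K. q z \<noteq> 0" "f = (\<lambda>z. p z / q z)"
    using assms unfolding rational_fun_on_def by blast
  show ?thesis
    unfolding rational_fun_on_def
    by (rule exI[of _ "\<lambda>z. (c * p z) ^ k"], rule exI[of _ "\<lambda>z. q z ^ k"])
       (use pq in \<open>auto intro!: polynomial_fun_power polynomial_fun_cmult simp: power_divide\<close>)
qed

text \<open>After scaling, a separating function is at most some \<open>q < 1\<close> on
  \<open>X\<close> and exceeds some \<open>l > 1\<close> near \<open>y\<close>. Compactness reduces
  \<open>Y\<close> to finitely many of these, and one common high power makes them as small on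
  \<open>X\<close> and as large on \<open>Y\<close> as desired.\<close>

lemma separating_family:
  fixes X Y :: "'a::topological_space set" and \<A> :: "('a \<Rightarrow> complex) set"
  assumes Y: "compact Y" "Y \<subseteq> K" and cont: "\<And>f. f \<in> \<A> \<Longrightarrow> continuous_on K f"
    and pow: "\<And>f c k. f \<in> \<A> \<Longrightarrow> (\<lambda>z. (c * f z) ^ k) \<in> \<A>"
    and sep: "\<And>y. y \<in> Y \<Longrightarrow> \<exists>f\<in>\<A>. \<exists>m. (\<forall>x\<in>X. norm (f x) \<le> m) \<and> m < norm (f y)"
    and \<tau>: "\<tau> > 0"
  obtains \<F> where "finite \<F>" "\<F> \<subseteq> \<A>" "\<And>x. x \<in> X \<Longrightarrow> (\<Sum>f\<in>\<F>. (norm (f x))\<^sup>2) \<le> \<tau>"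
    "\<And>y. y \<in> Y \<Longrightarrow> (\<Sum>f\<in>\<F>. (norm (f y))\<^sup>2) \<ge> B"
proof -
  define ok where "ok y g q l \<longleftrightarrow> g \<in> \<A> \<and> 0 \<le> q \<and> q < 1 \<and> l > 1 \<and> (\<forall>x\<in>X. norm (g x) \<le> q) \<and> l < norm (g y)"
    for y and g :: "'a \<Rightarrow> complex" and q l :: real
  have "\<exists>g q l. ok y g q l" if y: "y \<in> Y" for y
  proof -
    obtain f m where f: "f \<in> \<A>" "\<forall>x\<in>X. norm (f x) \<le> m" "m < norm (f y)" using sep[OF y] by blast
    \<comment> \<open>For empty \<open>X\<close> the bound \<open>m\<close> may be negative.\<close>
    define m' where "m' = (if X = {} then 0 else m)"
    have m': "0 \<le> m'" "\<forall>x\<in>X. norm (f x) \<le> m'"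
    proof -
      show "\<forall>x\<in>X. norm (f x) \<le> m'" using f(2) by (auto simp: m'_def)
      then show "0 \<le> m'" by (cases "X = {}") (auto simp: m'_def intro: order_trans[OF norm_ge_zero])
    qed
    show ?thesis
    proof (cases "m' < norm (f y)")
      case True
      define t where "t = (m' + norm (f y)) / 2"
      have t: "m' < t" "t < norm (f y)" "t > 0" using True m'(1) by (auto simp: t_def)
      obtain l where l: "1 < l" "l < norm (f y) / t" using t dense[of 1 "norm (f y) / t"] by auto
      have "ok y (\<lambda>z. (complex_of_real (1 / t) * f z) ^ 1) (m' / t) l"
        unfolding ok_def
      proof (intro conjI)
        show "(\<lambda>z. (complex_of_real (1 / t) * f z) ^ 1) \<in> \<A>" by (rule pow[OF f(1)])
      qed (use m' t l in \<open>auto simp: norm_mult norm_divide divide_right_mono\<close>)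
      then show ?thesis by blast
    next
      case False
      then have X: "X = {}" using f(3) by (auto simp: m'_def split: if_splits)
      then have "m' = 0" by (simp add: m'_def)
      with False have f0: "f y = 0" by simp
      \<comment> \<open>Here \<open>X\<close> is empty and \<open>f y\<close> is 0, so scaling
        cannot help; the zeroth power yields the constant 2 instead.\<close>
      have "(\<lambda>z. (2 * (0 * f z) ^ 0) ^ 1) \<in> \<A>" using pow[OF pow[OF f(1), of 0 0], of 2 1] by simp
      then have "ok y (\<lambda>z. (2 * (0 * f z) ^ 0) ^ 1) 0 (3/2)" unfolding ok_def using X by simp
      then show ?thesis by blast
    qed
  qed
  then obtain g q l where ok: "\<And>y. y \<in> Y \<Longrightarrow> ok y (g y) (q y) (l y)" by metis
  have op: "\<exists>T. open T \<and> T \<inter> K = {x\<in>K. l y < norm (g y x)}" if y: "y \<in> Y" for y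
  proof -
    have "g y \<in> \<A>" using ok[OF y] by (simp add: ok_def)
    then have "continuous_on K (\<lambda>x. norm (g y x))" by (intro continuous_intros cont)
    then obtain T where "open T" "T \<inter> K = (\<lambda>x. norm (g y x)) -` {l y<..} \<inter> K"
      using continuous_on_open_invariant[of K "\<lambda>x. norm (g y x)"] open_greaterThan by blast
    then show ?thesis by (intro exI[of _ T]) auto
  qed
  then obtain T where T: "\<And>y. y \<in> Y \<Longrightarrow> open (T y)" "\<And>y. y \<in> Y \<Longrightarrow> T y \<inter> K = {x\<in>K. l y < norm (g y x)}" by metis
  have "Y \<subseteq> (\<Union>y\<in>Y. T y)"
  proof
    fix y assume y: "y \<in> Y"
    then have "y \<in> {x\<in>K. l y < norm (g y x)}" using ok[OF y] Y(2) by (auto simp: ok_def)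
    then show "y \<in> (\<Union>y\<in>Y. T y)" using T(2)[OF y] y by blast
  qed
  then obtain S where S: "S \<subseteq> Y" "finite S" "Y \<subseteq> (\<Union>y\<in>S. T y)"
    using compactE_image[OF Y(1), of Y T] T(1) by blast
  \<comment> \<open>One exponent for all members. \<open>card S + 1\<close> shares \<tau> among them
    and is nonzero for empty \<open>S\<close> too.\<close>
  have "eventually (\<lambda>k. \<forall>s\<in>S. (q s ^ k)\<^sup>2 \<le> \<tau> / (card S + 1) \<and> (l s ^ k)\<^sup>2 \<ge> B) sequentially"
  proof (rule eventually_ball_finite[OF S(2)], intro ballI)
    fix s assume s: "s \<in> S"
    then have o: "ok s (g s) (q s) (l s)" using ok S(1) by blast
    have "(\<lambda>k. (q s ^ k)\<^sup>2) \<longlonglongrightarrow> 0\<^sup>2"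
      using o by (intro tendsto_power LIMSEQ_realpow_zero) (auto simp: ok_def)
    then have "eventually (\<lambda>k. (q s ^ k)\<^sup>2 < \<tau> / (card S + 1)) sequentially"
      by (rule order_tendstoD) (use \<tau> in simp)
    \<comment> \<open>The 1 ensures that squaring does not decrease the power.\<close>
    moreover have "eventually (\<lambda>k. l s ^ k \<ge> max 1 B) sequentially"
    proof -
      have l1: "1 < l s" using o by (simp add: ok_def)
      then obtain n where n: "max 1 B < l s ^ n" using real_arch_pow by blast
      show ?thesis
      proof (rule eventually_sequentiallyI[of n])
        fix k assume "n \<le> k"
        then have "l s ^ n \<le> l s ^ k" using l1 by (intro power_increasing) auto
        with n show "l s ^ k \<ge> max 1 B" by linarith
      qed
    qed
    ultimately show "eventually (\<lambda>k. (q s ^ k)\<^sup>2 \<le> \<tau> / (card S + 1) \<and> (l s ^ k)\<^sup>2 \<ge> B) sequentially"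
    proof eventually_elim
      case (elim k)
      have "l s ^ k * 1 \<le> l s ^ k * l s ^ k" using elim(2) by (intro mult_left_mono) auto
      then have "B \<le> (l s ^ k)\<^sup>2" using elim(2) unfolding power2_eq_square by linarith
      then show ?case using elim(1) by simp
    qed
  qed
  then obtain k where k: "\<And>s. s \<in> S \<Longrightarrow> (q s ^ k)\<^sup>2 \<le> \<tau> / (card S + 1)" "\<And>s. s \<in> S \<Longrightarrow> (l s ^ k)\<^sup>2 \<ge> B"
    using eventually_happens'[OF sequentially_bot] by blast
  define h where "h s = (\<lambda>z. (1 * g s z) ^ k)" for s
  show ?thesis
  proof (rule that[of "h ` S"])
    show "finite (h ` S)" using S(2) by simp
    have "h s \<in> \<A>" if "s \<in> S" for s
      unfolding h_def by (rule pow) (use ok[of s] S(1) that in \<open>auto simp: ok_def\<close>)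
    then show "h ` S \<subseteq> \<A>" by blast
  next
    fix x assume x: "x \<in> X"
    have "(\<Sum>f\<in>h ` S. (norm (f x))\<^sup>2) \<le> (\<Sum>f\<in>h ` S. \<tau> / (card S + 1))"
    proof (rule sum_mono)
      fix f assume "f \<in> h ` S"
      then obtain s where s: "s \<in> S" "f = h s" by blast
      have o: "ok s (g s) (q s) (l s)" using ok S(1) s(1) by blast
      have "norm (f x) \<le> q s ^ k" using o x by (auto simp: s h_def norm_power ok_def intro!: power_mono)
      then have "(norm (f x))\<^sup>2 \<le> (q s ^ k)\<^sup>2" by (intro power_mono) auto
      with k(1)[OF s(1)] show "(norm (f x))\<^sup>2 \<le> \<tau> / (card S + 1)" by linarith
    qed
    also have "\<dots> = card (h ` S) * (\<tau> / (card S + 1))" by simp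
    also have "\<dots> \<le> card S * (\<tau> / (card S + 1))"
      using card_image_le[OF S(2), of h] \<tau> by (intro mult_right_mono) auto
    also have "\<dots> \<le> \<tau>" using \<tau> by (simp add: field_simps)
    finally show "(\<Sum>f\<in>h ` S. (norm (f x))\<^sup>2) \<le> \<tau>" .
  next
    fix y assume y: "y \<in> Y"
    then obtain s where s: "s \<in> S" "y \<in> T s" using S(3) by blast
    then have "l s < norm (g s y)" using T(2)[of s] S(1) y Y(2) by blast
    moreover have "l s > 1" using ok[of s] s(1) S(1) by (auto simp: ok_def)
    ultimately have "l s ^ k \<le> norm (h s y)" by (simp add: h_def norm_power power_mono)
    then have "(l s ^ k)\<^sup>2 \<le> (norm (h s y))\<^sup>2" using \<open>l s > 1\<close> by (intro power_mono) auto
    also have "\<dots> \<le> (\<Sum>f\<in>h ` S. (norm (f y))\<^sup>2)"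
      using S(2) s(1) by (intro member_le_sum) auto
    finally show "(\<Sum>f\<in>h ` S. (norm (f y))\<^sup>2) \<ge> B" using k(2)[OF s(1)] by linarith
  qed
qed

text \<open>Taylor expansion along a complex line. The coefficients are again polynomials in the
  base point, and putting them to 0 beyond \<open>d\<close> lets them form a formal power
  series.\<close>

lemma polynomial_fun_line:
  assumes "polynomial_fun f"
  shows "\<exists>d g. (\<forall>i. polynomial_fun (g i)) \<and> (\<forall>i>d. \<forall>z. g i z = 0) \<and>
    (\<forall>z \<zeta>. f (z + \<zeta> *s b) = (\<Sum>i\<le>d. g i z * \<zeta> ^ i))"
  using assms
proof (induction rule: polynomial_fun.induct)
  case (const c)
  show ?case
    by (rule exI[of _ 0], rule exI[of _ "\<lambda>i z. if i = 0 then c else 0"]) (auto intro: polynomial_fun.intros)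
next
  case (coord j)
  have "polynomial_fun ((\<lambda>i z. if i = 0 then z $ j else if i = 1 then b $ j else 0) i)" for i :: nat
    by (cases "i = 0"; cases "i = 1") (auto intro: polynomial_fun.intros)
  then show ?case
    by (intro exI[of _ 1] exI[of _ "\<lambda>i z. if i = 0 then z $ j else if i = 1 then b $ j else 0"]) (auto simp: mult.commute)
next
  case (add f f')
  obtain d g where g: "\<And>i. polynomial_fun (g i)" "\<And>i z. i > d \<Longrightarrow> g i z = 0"
      "\<And>z \<zeta>. f (z + \<zeta> *s b) = (\<Sum>i\<le>d. g i z * \<zeta> ^ i)"
    using add.IH(1) by blast
  obtain d' g' where g': "\<And>i. polynomial_fun (g' i)" "\<And>i z. i > d' \<Longrightarrow> g' i z = 0"
      "\<And>z \<zeta>. f' (z + \<zeta> *s b) = (\<Sum>i\<le>d'. g' i z * \<zeta> ^ i)"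
    using add.IH(2) by blast
  have "(\<Sum>i\<le>d. g i z * \<zeta> ^ i) = (\<Sum>i\<le>max d d'. g i z * \<zeta> ^ i)" for z \<zeta>
    by (rule sum.mono_neutral_left) (auto simp: g(2))
  moreover have "(\<Sum>i\<le>d'. g' i z * \<zeta> ^ i) = (\<Sum>i\<le>max d d'. g' i z * \<zeta> ^ i)" for z \<zeta>
    by (rule sum.mono_neutral_left) (auto simp: g'(2))
  ultimately show ?case
    by (intro exI[of _ "max d d'"] exI[of _ "\<lambda>i z. g i z + g' i z"])
       (auto simp: g g' sum.distrib algebra_simps intro: polynomial_fun.intros)
next
  case (mult f f')
  obtain d g where g: "\<And>i. polynomial_fun (g i)" "\<And>i z. i > d \<Longrightarrow> g i z = 0"
      "\<And>z \<zeta>. f (z + \<zeta> *s b) = (\<Sum>i\<le>d. g i z * \<zeta> ^ i)"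
    using mult.IH(1) by blast
  obtain d' g' where g': "\<And>i. polynomial_fun (g' i)" "\<And>i z. i > d' \<Longrightarrow> g' i z = 0"
      "\<And>z \<zeta>. f' (z + \<zeta> *s b) = (\<Sum>i\<le>d'. g' i z * \<zeta> ^ i)"
    using mult.IH(2) by blast
  have "(\<Sum>k\<le>i. g k z * g' (i - k) z) = 0" if "i > d + d'" for i z
  proof (rule sum.neutral, intro ballI)
    fix k assume "k \<in> {..i}"
    then have "k > d \<or> i - k > d'" using that by auto
    then show "g k z * g' (i - k) z = 0" using g(2) g'(2) by auto
  qed
  moreover have "f (z + \<zeta> *s b) * f' (z + \<zeta> *s b) = (\<Sum>i\<le>d + d'. (\<Sum>k\<le>i. g k z * g' (i - k) z) * \<zeta> ^ i)" for z \<zeta>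
    unfolding g(3) g'(3) by (rule polynomial_product) (simp_all add: g(2) g'(2))
  ultimately show ?case
    using g(1) g'(1)
    by (intro exI[of _ "d + d'"] exI[of _ "\<lambda>i z. \<Sum>k\<le>i. g k z * g' (i - k) z"])
       (auto intro!: polynomial_fun_sum polynomial_fun.mult)
qed

text \<open>
  As in the theorem of Cartan and Thullen, the separating function is a Taylor coefficient of
  \<open>1 / f\<close> in the direction of a nearby zero of \<open>f\<close>: on \<open>X\<close> the Cauchy estimates
  bound it, while the expansion at \<open>y\<close> must diverge.
\<close>

lemma rational_separation:
  fixes f :: "complex ^ 'n::finite \<Rightarrow> complex"
  assumes f: "polynomial_fun f" and low: "\<And>w. w \<in> K \<Longrightarrow> norm (f w) \<ge> \<mu>" and \<mu>: "\<mu> > 0"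
    and y: "y \<in> K" "f (y + b) = 0" and R: "R > 1"
    and X: "\<And>x \<zeta>. x \<in> X \<Longrightarrow> norm \<zeta> \<le> R \<Longrightarrow> x + \<zeta> *s b \<in> K"
  shows "\<exists>h m. rational_fun_on K h \<and> (\<forall>x\<in>X. norm (h x) \<le> m) \<and> m < norm (h y)"
proof -
  obtain d g where g: "\<And>i. polynomial_fun (g i)" "\<And>i z. i > d \<Longrightarrow> g i z = 0"
    "\<And>z \<zeta>. f (z + \<zeta> *s b) = (\<Sum>i\<le>d. g i z * \<zeta> ^ i)"
    using polynomial_fun_line[OF f, of b] by blast
  \<comment> \<open>The series of \<open>f (z + \<zeta> *s b)\<close> in \<zeta>, to be inverted
    formally; \<open>c k z\<close> is then the Taylor coefficient of order \<open>k\<close> of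
    \<open>1 / f\<close> along the line.\<close>
  define A where "A z = Abs_fps (\<lambda>i. g i z)" for z
  define c where "c k z = fps_nth (inverse (A z)) k" for k z
  have g0: "g 0 z = f z" for z
  proof -
    have "f (z + 0 *s b) = g 0 z" unfolding g(3) by (simp add: power_0_left if_distrib cong: if_cong)
    then show ?thesis by simp
  qed
  have fK: "f z \<noteq> 0" if "z \<in> K" for z using low[OF that] \<mu> by auto
  have conv: "(\<Sum>i\<le>k. g i z * c (k - i) z) = (if k = 0 then 1 else 0)" if "f z \<noteq> 0" for k z
  proof -
    have "A z * inverse (A z) = 1" by (rule inverse_mult_eq_1') (simp add: A_def g0 that)
    then have "fps_nth (A z * inverse (A z)) k = (if k = 0 then 1 else 0)" by simp
    then show ?thesis by (simp add: fps_mult_nth A_def c_def atLeast0AtMost)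
  qed
  \<comment> \<open>The convolution identity solved for its newest coefficient gives, by recursion,
    the denominator \<open>f z ^ Suc k\<close>; so the coefficient is regular wherever
    \<open>f\<close> has no zero.\<close>
  have rat: "\<exists>P. polynomial_fun P \<and> (\<forall>z. f z \<noteq> 0 \<longrightarrow> c k z = P z / f z ^ Suc k)" for k
  proof (induction k rule: less_induct)
    case (less k)
    show ?case
    proof (cases "k = 0")
      case True
      have "c 0 z = 1 / f z" if "f z \<noteq> 0" for z
        using conv[OF that, of 0] that by (simp add: g0 field_simps)
      then show ?thesis using True by (intro exI[of _ "\<lambda>z. 1"]) (auto intro: polynomial_fun.intros)
    next
      case False
      obtain P where P: "\<And>j. j < k \<Longrightarrow> polynomial_fun (P j)"
        "\<And>j z. j < k \<Longrightarrow> f z \<noteq> 0 \<Longrightarrow> c j z = P j z / f z ^ Suc j"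
        using less.IH by metis
      have "c k z = - (\<Sum>i\<in>{1..k}. g i z * P (k - i) z * f z ^ (i - 1)) / f z ^ Suc k" if nz: "f z \<noteq> 0" for z
      proof -
        have "{..k} = insert 0 {1..k}" by auto
        then have "f z * c k z + (\<Sum>i\<in>{1..k}. g i z * c (k - i) z) = 0"
          using conv[OF nz, of k] False by (simp add: g0)
        then have "c k z = - (\<Sum>i\<in>{1..k}. g i z * c (k - i) z) / f z"
          using nz by (simp add: field_simps add_eq_0_iff)
        also have "(\<Sum>i\<in>{1..k}. g i z * c (k - i) z) = (\<Sum>i\<in>{1..k}. g i z * P (k - i) z * f z ^ (i - 1) / f z ^ k)"
        proof (rule sum.cong[OF refl])
          fix i assume i: "i \<in> {1..k}"
          have "f z ^ k = f z ^ Suc (k - i) * f z ^ (i - 1)" unfolding power_add[symmetric] using i by simp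
          then show "g i z * c (k - i) z = g i z * P (k - i) z * f z ^ (i - 1) / f z ^ k"
            using P(2)[of "k - i" z] i nz False by simp
        qed
        also have "\<dots> = (\<Sum>i\<in>{1..k}. g i z * P (k - i) z * f z ^ (i - 1)) / f z ^ k" by (rule sum_divide_distrib[symmetric])
        finally show ?thesis using nz by simp
      qed
      moreover have "polynomial_fun (\<lambda>z. - (\<Sum>i\<in>{1..k}. g i z * P (k - i) z * f z ^ (i - 1)))"
        using False by (intro polynomial_fun_uminus polynomial_fun_sum polynomial_fun.mult polynomial_fun_power g(1) f P(1)) auto
      ultimately show ?thesis by blast
    qed
  qed
  \<comment> \<open>Cauchy estimate on the disc of radius \<open>R\<close>: along it the line stays
    in \<open>K\<close>, where \<open>1 / f\<close> is at most \<open>1 / \<mu>\<close>.\<close>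
  have bound: "norm (c k x) \<le> 1 / \<mu> / R ^ k" if x: "x \<in> X" for k x
  proof -
    define u where "u \<zeta> = (\<Sum>i\<le>d. g i x * \<zeta> ^ i)" for \<zeta>
    have uf: "u \<zeta> = f (x + \<zeta> *s b)" for \<zeta> by (simp add: u_def g(3))
    have uK: "norm (u \<zeta>) \<ge> \<mu>" if "norm \<zeta> \<le> R" for \<zeta> unfolding uf using low X[OF x that] by blast
    have nz: "u \<zeta> \<noteq> 0" if "norm \<zeta> \<le> R" for \<zeta> using uK[OF that] \<mu> by auto
    have "u has_fps_expansion A x"
    proof (rule has_fps_expansionI, rule always_eventually, rule allI)
      fix \<zeta>
      have "(\<lambda>n. fps_nth (A x) n * \<zeta> ^ n) sums (\<Sum>n\<in>{..d}. fps_nth (A x) n * \<zeta> ^ n)"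
        by (rule sums_finite) (auto simp: A_def g(2))
      then show "(\<lambda>n. fps_nth (A x) n * \<zeta> ^ n) sums u \<zeta>" by (simp add: A_def u_def)
    qed
    moreover have "fps_nth (A x) 0 \<noteq> 0" using nz[of 0] R uf[of 0] by (simp add: A_def g0)
    ultimately have "(\<lambda>\<zeta>. inverse (u \<zeta>)) has_fps_expansion inverse (A x)" by (rule has_fps_expansion_inverse)
    then have c: "c k x = (deriv ^^ k) (\<lambda>\<zeta>. inverse (u \<zeta>)) 0 / fact k"
      unfolding c_def by (rule fps_nth_fps_expansion)
    have "norm ((deriv ^^ k) (\<lambda>\<zeta>. inverse (u \<zeta>)) 0) \<le> fact k * (1 / \<mu>) / R ^ k"
    proof (rule Cauchy_inequality)
      have "u holomorphic_on S" for S unfolding u_def by (intro holomorphic_intros)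
      then show "(\<lambda>\<zeta>. inverse (u \<zeta>)) holomorphic_on ball 0 R"
        using nz by (intro holomorphic_on_inverse) auto
      have "continuous_on (cball 0 R) u" unfolding u_def by (intro continuous_intros)
      then show "continuous_on (cball 0 R) (\<lambda>\<zeta>. inverse (u \<zeta>))"
        using nz by (intro continuous_on_inverse) auto
      show "norm (inverse (u \<zeta>)) \<le> 1 / \<mu>" if "norm (0 - \<zeta>) = R" for \<zeta>
        using uK[of \<zeta>] that \<mu> le_imp_inverse_le[of \<mu> "norm (u \<zeta>)"]
        by (simp add: norm_inverse divide_inverse)
    qed (use R in simp)
    then show ?thesis unfolding c by (simp add: norm_divide field_simps)
  qed
  \<comment> \<open>Otherwise, as \<open>R > 1\<close>, the series of the \<open>c k y\<close>
    converges absolutely, and its product with the finite sum of the \<open>g k y\<close> is 1,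
    although that sum is \<open>f (y + b) = 0\<close>.\<close>
  have "\<exists>k. norm (c k y) > 1 / \<mu> / R ^ k"
  proof (rule ccontr)
    assume "\<nexists>k. norm (c k y) > 1 / \<mu> / R ^ k"
    then have le: "norm (c k y) \<le> 1 / \<mu> * (1 / R) ^ k" for k by (simp add: not_less power_one_over)
    have "summable (\<lambda>k. 1 / \<mu> * (1 / R) ^ k)" using R by (intro summable_mult summable_geometric) simp
    then have "summable (\<lambda>k. norm (c k y))" by (rule summable_comparison_test[rotated]) (use le in auto)
    moreover have "summable (\<lambda>k. norm (g k y))" by (rule summable_finite[of "{..d}"]) (auto simp: g(2))
    ultimately have "(\<lambda>k. \<Sum>i\<le>k. g i y * c (k - i) y) sums (suminf (\<lambda>k. g k y) * suminf (\<lambda>k. c k y))"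
      by (intro Cauchy_product_sums)
    moreover have "suminf (\<lambda>k. g k y) = 0"
    proof -
      have "suminf (\<lambda>k. g k y) = (\<Sum>k\<le>d. g k y)" by (rule suminf_finite) (auto simp: g(2))
      also have "\<dots> = f (y + 1 *s b)" unfolding g(3) by simp
      finally show ?thesis using y(2) by simp
    qed
    ultimately have "(\<lambda>k. if k = 0 then 1 else 0) sums (0::complex)"
      by (simp add: conv[OF fK[OF y(1)]])
    moreover have "(\<lambda>k. if k = 0 then 1 else 0) sums (1::complex)" using sums_single[of 0 "\<lambda>_. 1::complex"] by simp
    ultimately show False using sums_unique2 by fastforce
  qed
  then obtain k where k: "norm (c k y) > 1 / \<mu> / R ^ k" by blast
  obtain P where P: "polynomial_fun P" "\<And>z. f z \<noteq> 0 \<Longrightarrow> c k z = P z / f z ^ Suc k" using rat by blast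
  have XK: "x \<in> K" if "x \<in> X" for x using X[OF that, of 0] R by simp
  have "rational_fun_on K (\<lambda>z. P z / f z ^ Suc k)"
    unfolding rational_fun_on_def
    by (rule exI[of _ P], rule exI[of _ "\<lambda>z. f z ^ Suc k"]) (use P fK polynomial_fun_power[OF f, of "Suc k"] in auto)
  moreover have "norm (P x / f x ^ Suc k) \<le> 1 / \<mu> / R ^ k" if "x \<in> X" for x
    using bound[OF that, of k] P(2)[OF fK[OF XK[OF that]]] by simp
  moreover have "norm (P y / f y ^ Suc k) > 1 / \<mu> / R ^ k" using k P(2)[OF fK[OF y(1)]] by simp
  ultimately show ?thesis by blast
qed

section \<open>Separation of points near the boundary\<close>

lemma polynomially_convex_separation:
  assumes K: "polynomially_convex K" and z: "z \<notin> K" and ne: "K \<noteq> {}"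
  obtains f m where "polynomial_fun f" "\<And>w. w \<in> K \<Longrightarrow> norm (f w) \<le> m" "m < norm (f z)"
proof -
  have "z \<notin> polynomial_hull K" using K z by (simp add: polynomially_convex_def)
  then obtain P where P: "(SUP w\<in>K. norm (cpoly_eval P w)) < norm (cpoly_eval P z)"
    by (auto simp: polynomial_hull_def not_le)
  have "compact ((\<lambda>w. norm (cpoly_eval P w)) ` K)"
    using K by (intro compact_continuous_image continuous_intros polynomial_fun_continuous polynomial_fun_cpoly_eval)
      (simp add: polynomially_convex_def)
  then have "bdd_above ((\<lambda>w. norm (cpoly_eval P w)) ` K)" by (intro bounded_imp_bdd_above compact_imp_bounded)
  then have "norm (cpoly_eval P w) \<le> (SUP w\<in>K. norm (cpoly_eval P w))" if "w \<in> K" for w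
    using that by (rule cSUP_upper[rotated])
  with P show ?thesis using that[of "cpoly_eval P"] polynomial_fun_cpoly_eval by blast
qed

text \<open>The classical form of rational convexity: the zero set of a polynomial through the point
  misses \<open>K\<close>. If the witness \<open>P / Q\<close> has no pole at \<open>z\<close>,
  subtract its value there and clear denominators; a zero on \<open>K\<close> would mean that
  \<open>P / Q\<close> attains on \<open>K\<close> a value beyond its supremum.\<close>

lemma rationally_convex_separation:
  assumes K: "rationally_convex K" and z: "z \<notin> K"
  obtains f where "polynomial_fun f" "\<And>w. w \<in> K \<Longrightarrow> f w \<noteq> 0" "f z = 0"
proof -
  have "z \<notin> rational_hull K" using K z by (simp add: rationally_convex_def)
  then obtain P Q where Q: "\<And>w. w \<in> K \<Longrightarrow> cpoly_eval Q w \<noteq> 0"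
    and PQ: "cpoly_eval Q z = 0 \<or> norm (cpoly_eval P z / cpoly_eval Q z) > (SUP w\<in>K. norm (cpoly_eval P w / cpoly_eval Q w))"
    by (auto simp: rational_hull_def not_le)
  show ?thesis
  proof (cases "cpoly_eval Q z = 0")
    case True
    then show ?thesis using that[of "cpoly_eval Q"] Q polynomial_fun_cpoly_eval by blast
  next
    case False
    let ?f = "\<lambda>w. cpoly_eval P w * cpoly_eval Q z - cpoly_eval Q w * cpoly_eval P z"
    have "compact ((\<lambda>w. norm (cpoly_eval P w / cpoly_eval Q w)) ` K)"
      using K Q by (intro compact_continuous_image continuous_intros polynomial_fun_continuous polynomial_fun_cpoly_eval)
        (auto simp: rationally_convex_def)
    then have bdd: "bdd_above ((\<lambda>w. norm (cpoly_eval P w / cpoly_eval Q w)) ` K)"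
      by (intro bounded_imp_bdd_above compact_imp_bounded)
    have "?f w \<noteq> 0" if w: "w \<in> K" for w
    proof
      assume "?f w = 0"
      then have "cpoly_eval P w / cpoly_eval Q w = cpoly_eval P z / cpoly_eval Q z"
        using False Q[OF w] by (simp add: frac_eq_eq mult.commute)
      then have "norm (cpoly_eval P z / cpoly_eval Q z) \<le> (SUP w\<in>K. norm (cpoly_eval P w / cpoly_eval Q w))"
        using cSUP_upper[OF w bdd] by simp
      with PQ False show False by linarith
    qed
    moreover have "polynomial_fun ?f"
      by (intro polynomial_fun_diff polynomial_fun.mult polynomial_fun_cpoly_eval polynomial_fun.const)
    ultimately show ?thesis using that[of ?f] by simp
  qed
qed

text \<open>The coordinate functions in the family will make the Levi form positive definite.\<close>

lemma exhausting_family: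
  fixes K :: "(complex ^ 'n::finite) set"
  assumes K: "compact K" and cont: "\<And>f. f \<in> \<A> \<Longrightarrow> continuous_on K f"
    and pow: "\<And>f c k. f \<in> \<A> \<Longrightarrow> (\<lambda>z. (c * f z) ^ k) \<in> \<A>" and coord: "\<And>i. (\<lambda>z. z $ i) \<in> \<A>"
    and sep: "\<And>y y'. y \<in> K \<Longrightarrow> y' \<notin> K \<Longrightarrow> dist y y' < \<epsilon> \<Longrightarrow>
      \<exists>f\<in>\<A>. \<exists>m. (\<forall>x. cball x \<epsilon> \<subseteq> K \<longrightarrow> norm (f x) \<le> m) \<and> m < norm (f y)"
    and \<epsilon>: "\<epsilon> > 0" and \<tau>: "\<tau> > 0"
  obtains \<F> \<kappa> where "finite \<F>" "\<F> \<subseteq> \<A>" "\<And>x. cball x \<epsilon> \<subseteq> K \<Longrightarrow> (\<Sum>f\<in>\<F>. (norm (f x))\<^sup>2) \<le> \<tau>"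
    "\<And>y y'. y \<in> K \<Longrightarrow> y' \<notin> K \<Longrightarrow> dist y y' < \<epsilon> / 2 \<Longrightarrow> (\<Sum>f\<in>\<F>. (norm (f y))\<^sup>2) \<ge> B"
    "\<kappa> \<noteq> 0" "\<And>i. (\<lambda>z. \<kappa> * z $ i) \<in> \<F>"
proof -
  \<comment> \<open>A compact version of the shell: it contains all points of \<open>K\<close>
    within \<open>\<epsilon> / 2\<close> of the complement, and each of its points is still less
    than \<epsilon> away from some point outside, as \<open>sep\<close> demands.\<close>
  define Y where "Y = K \<inter> {y. infdist y (- K) \<le> \<epsilon> / 2}"
  have cne: "- K \<noteq> {}"
  proof
    assume "- K = {}"
    then have "K = UNIV" by auto
    with K show False using not_bounded_UNIV compact_imp_bounded by metis
  qed
  have cY: "compact Y" unfolding Y_def by (intro compact_Int_closed K closed_Collect_le continuous_intros)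
  have "\<exists>f\<in>\<A>. \<exists>m. (\<forall>x\<in>{x. cball x \<epsilon> \<subseteq> K}. norm (f x) \<le> m) \<and> m < norm (f y)" if y: "y \<in> Y" for y
  proof -
    have "infdist y (- K) < \<epsilon>" using y \<epsilon> by (auto simp: Y_def)
    then obtain y' where "y' \<in> - K" "dist y y' < \<epsilon>"
      using cne infdist_notempty[OF cne, of y] by (metis cINF_less_iff bdd_below_image_dist)
    then show ?thesis using sep[of y y'] y by (auto simp: Y_def)
  qed
  note sepY = this
  obtain \<F> where \<F>: "finite \<F>" "\<F> \<subseteq> \<A>" "\<And>x. x \<in> {x. cball x \<epsilon> \<subseteq> K} \<Longrightarrow> (\<Sum>f\<in>\<F>. (norm (f x))\<^sup>2) \<le> \<tau> / 2"
    "\<And>y. y \<in> Y \<Longrightarrow> (\<Sum>f\<in>\<F>. (norm (f y))\<^sup>2) \<ge> B"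
    proof (rule separating_family[OF cY _ cont pow, where X = "{x. cball x \<epsilon> \<subseteq> K}" and \<tau> = "\<tau> / 2" and B = B])
    show "Y \<subseteq> K" by (auto simp: Y_def)
    show "\<exists>f\<in>\<A>. \<exists>m. (\<forall>x\<in>{x. cball x \<epsilon> \<subseteq> K}. norm (f x) \<le> m) \<and> m < norm (f y)" if "y \<in> Y" for y
      by (rule sepY[OF that])
    show "\<tau> / 2 > 0" using \<tau> by simp
  qed (assumption | use that in blast)+
  obtain R where R: "R > 0" "\<And>x. x \<in> K \<Longrightarrow> norm x \<le> R" using compact_imp_bounded[OF K] unfolding bounded_pos by blast
  \<comment> \<open>Makes the scaled coordinates add at most \<open>\<tau> / 2\<close> on
    \<open>K\<close>; the separating family was built for the other half.\<close>
  define \<kappa> where "\<kappa> = sqrt (\<tau> / (2 * CARD('n) * R\<^sup>2))"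
  have \<kappa>: "\<kappa> > 0" "\<kappa>\<^sup>2 * R\<^sup>2 = \<tau> / (2 * CARD('n))" using \<tau> R by (auto simp: \<kappa>_def real_sqrt_pow2)
  define q where "q i = (\<lambda>z :: complex ^ 'n. complex_of_real \<kappa> * z $ i)" for i
  show ?thesis
  proof (rule that[of "\<F> \<union> range q" "complex_of_real \<kappa>"])
    have "q i \<in> \<A>" for i using pow[OF coord[of i], of "complex_of_real \<kappa>" 1] by (simp add: q_def)
    then show "\<F> \<union> range q \<subseteq> \<A>" using \<F>(2) by blast
    fix x assume x: "cball x \<epsilon> \<subseteq> K"
    have "(\<Sum>f\<in>range q. (norm (f x))\<^sup>2) \<le> (\<Sum>f\<in>range q. \<tau> / (2 * CARD('n)))"
    proof (rule sum_mono)
      fix f assume "f \<in> range q"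
      then obtain i where f: "f = q i" by blast
      have "x \<in> K" using x \<epsilon> by auto
      then have "norm (x $ i) \<le> R" using R(2)[of x] Finite_Cartesian_Product.norm_nth_le[of x i] by linarith
      then have "(norm (f x))\<^sup>2 \<le> (\<kappa> * R)\<^sup>2"
        unfolding f q_def using \<kappa>(1) by (intro power_mono) (auto simp: norm_mult intro!: mult_left_mono)
      then show "(norm (f x))\<^sup>2 \<le> \<tau> / (2 * CARD('n))" using \<kappa>(2) by (simp add: power_mult_distrib)
    qed
    also have "\<dots> = card (range q) * (\<tau> / (2 * CARD('n)))" by simp
    also have "\<dots> \<le> CARD('n) * (\<tau> / (2 * CARD('n)))"
      using card_image_le[of UNIV q] \<tau> by (intro mult_right_mono) auto
    also have "\<dots> = \<tau> / 2" by simp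
    finally have "(\<Sum>f\<in>range q. (norm (f x))\<^sup>2) \<le> \<tau> / 2" .
    moreover have "(\<Sum>f\<in>\<F> \<union> range q. (norm (f x))\<^sup>2) \<le> (\<Sum>f\<in>\<F>. (norm (f x))\<^sup>2) + (\<Sum>f\<in>range q. (norm (f x))\<^sup>2)"
      using \<F>(1) by (subst sum_Un) (auto intro: sum_nonneg)
    ultimately show "(\<Sum>f\<in>\<F> \<union> range q. (norm (f x))\<^sup>2) \<le> \<tau>" using \<F>(3)[of x] x by simp
  next
    fix y y' assume y: "y \<in> K" "y' \<notin> K" "dist y y' < \<epsilon> / 2"
    have "infdist y (- K) \<le> dist y y'" using y(2) by (intro infdist_le) auto
    then have "y \<in> Y" using y by (simp add: Y_def)
    then have "B \<le> (\<Sum>f\<in>\<F>. (norm (f y))\<^sup>2)" by (rule \<F>(4))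
    also have "\<dots> \<le> (\<Sum>f\<in>\<F> \<union> range q. (norm (f y))\<^sup>2)" using \<F>(1) by (intro sum_mono2) auto
    finally show "B \<le> (\<Sum>f\<in>\<F> \<union> range q. (norm (f y))\<^sup>2)" .
  qed (use \<F>(1) \<kappa>(1) in \<open>auto simp: q_def\<close>)
qed

text \<open>Translate a polynomial that separates \<open>y'\<close> from \<open>K\<close>: the shift
  \<open>y' - y\<close> is shorter than \<epsilon>, so deep points stay in \<open>K\<close> while
  \<open>y\<close> lands on \<open>y'\<close>.\<close>

lemma polynomial_separation_near_boundary:
  assumes K: "polynomially_convex K" and y: "y \<in> K" "y' \<notin> K" "dist y y' < \<epsilon>"
  shows "\<exists>f\<in>Collect polynomial_fun. \<exists>m. (\<forall>x. cball x \<epsilon> \<subseteq> K \<longrightarrow> norm (f x) \<le> m) \<and> m < norm (f y)"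
proof -
  obtain f m where f: "polynomial_fun f" "\<And>w. w \<in> K \<Longrightarrow> norm (f w) \<le> m" "m < norm (f y')"
    using polynomially_convex_separation[OF K y(2)] y(1) by blast
  have "norm (f (x + (y' - y))) \<le> m" if "cball x \<epsilon> \<subseteq> K" for x
    using that y(3) by (intro f(2)) (auto simp: dist_norm norm_minus_commute subset_iff)
  then show ?thesis
    using f(3) polynomial_fun_shift[OF f(1), of "y' - y"] by (intro bexI[of _ "\<lambda>z. f (z + (y' - y))"]) auto
qed

text \<open>Translation does not help here: the reciprocal of the translated polynomial would have a
  pole at \<open>y\<close>, inside \<open>K\<close>. Instead \<open>rational_separation\<close> is
  used in the direction \<open>b = y' - y\<close>, with \<open>R = \<epsilon> / norm b\<close> as
  the factor by which \<open>b\<close> can be stretched from deep points without leaving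
  \<open>K\<close>.\<close>

lemma rational_separation_near_boundary:
  fixes K :: "(complex ^ 'n::finite) set"
  assumes K: "rationally_convex K" and y: "y \<in> K" "y' \<notin> K" "dist y y' < \<epsilon>"
  shows "\<exists>f\<in>Collect (rational_fun_on K). \<exists>m. (\<forall>x. cball x \<epsilon> \<subseteq> K \<longrightarrow> norm (f x) \<le> m) \<and> m < norm (f y)"
proof -
  obtain f where f: "polynomial_fun f" "\<And>w. w \<in> K \<Longrightarrow> f w \<noteq> 0" "f y' = 0"
    using rationally_convex_separation[OF K y(2)] by blast
  have cK: "compact K" using K by (simp add: rationally_convex_def)
  have "\<exists>x\<in>K. \<forall>w\<in>K. norm (f x) \<le> norm (f w)"
    using cK y(1) by (intro continuous_attains_inf continuous_intros polynomial_fun_continuous f(1)) auto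
  then obtain x0 where x0: "x0 \<in> K" "\<And>w. w \<in> K \<Longrightarrow> norm (f x0) \<le> norm (f w)" by blast
  define b where "b = y' - y"
  have b: "norm b > 0" "norm b < \<epsilon>" using y by (auto simp: b_def dist_norm norm_minus_commute)
  have "x + \<zeta> *s b \<in> K" if "x \<in> {x. cball x \<epsilon> \<subseteq> K}" "norm \<zeta> \<le> \<epsilon> / norm b" for x \<zeta>
  proof -
    have "norm (\<zeta> *s b) = norm \<zeta> * norm b"
      unfolding norm_vec_def by (simp add: norm_mult L2_set_right_distrib)
    also have "\<dots> \<le> \<epsilon>" using that(2) b(1) by (simp add: pos_le_divide_eq)
    finally show ?thesis using that(1) by (auto simp: dist_norm subset_iff)
  qed
  then have "\<exists>h m. rational_fun_on K h \<and> (\<forall>x\<in>{x. cball x \<epsilon> \<subseteq> K}. norm (h x) \<le> m) \<and> m < norm (h y)"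
    using x0 f(2)[OF x0(1)] b y(1) f(3)
    by (intro rational_separation[OF f(1), where \<mu> = "norm (f x0)" and b = b and R = "\<epsilon> / norm b"]) (auto simp: b_def)
  then show ?thesis by blast
qed

section \<open>Sums of squares of holomorphic functions\<close>

text \<open>In contrast to \<open>rational_fun_on\<close>, agreement with a quotient is asked only
  on \<open>U\<close>. This gives closure under sums, since the usual rule for adding fractions
  fails at poles, where division by 0 yields 0.\<close>

definition regular_on :: "(complex ^ 'n::finite) set \<Rightarrow> (complex ^ 'n \<Rightarrow> complex) \<Rightarrow> bool" where
  "regular_on U f \<longleftrightarrow>
     (\<exists>p q. polynomial_fun p \<and> polynomial_fun q \<and> (\<forall>z\<in>U. q z \<noteq> 0 \<and> f z = p z / q z))"

lemma regular_on_polynomial: "polynomial_fun f \<Longrightarrow> regular_on U f"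
  unfolding regular_on_def
  by (rule exI[of _ f], rule exI[of _ "\<lambda>z. 1"]) (auto intro: polynomial_fun.intros)

lemma regular_on_subset: "regular_on U f \<Longrightarrow> V \<subseteq> U \<Longrightarrow> regular_on V f"
  unfolding regular_on_def by blast

lemma regular_on_add:
  assumes "regular_on U f" "regular_on U g"
  shows "regular_on U (\<lambda>z. f z + g z)"
proof -
  obtain p q where pq: "polynomial_fun p" "polynomial_fun q" "\<And>z. z \<in> U \<Longrightarrow> q z \<noteq> 0 \<and> f z = p z / q z"
    using assms(1) unfolding regular_on_def by blast
  obtain p' q' where pq': "polynomial_fun p'" "polynomial_fun q'" "\<And>z. z \<in> U \<Longrightarrow> q' z \<noteq> 0 \<and> g z = p' z / q' z"
    using assms(2) unfolding regular_on_def by blast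
  show ?thesis
    unfolding regular_on_def
    by (rule exI[of _ "\<lambda>z. p z * q' z + p' z * q z"], rule exI[of _ "\<lambda>z. q z * q' z"])
       (use pq pq' in \<open>auto simp: add_frac_eq intro!: polynomial_fun.add polynomial_fun.mult\<close>)
qed

lemma regular_on_mult:
  assumes "regular_on U f" "regular_on U g"
  shows "regular_on U (\<lambda>z. f z * g z)"
proof -
  obtain p q where pq: "polynomial_fun p" "polynomial_fun q" "\<And>z. z \<in> U \<Longrightarrow> q z \<noteq> 0 \<and> f z = p z / q z"
    using assms(1) unfolding regular_on_def by blast
  obtain p' q' where pq': "polynomial_fun p'" "polynomial_fun q'" "\<And>z. z \<in> U \<Longrightarrow> q' z \<noteq> 0 \<and> g z = p' z / q' z"
    using assms(2) unfolding regular_on_def by blast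
  show ?thesis
    unfolding regular_on_def
    by (rule exI[of _ "\<lambda>z. p z * p' z"], rule exI[of _ "\<lambda>z. q z * q' z"])
       (use pq pq' in \<open>auto intro!: polynomial_fun.mult\<close>)
qed

lemma regular_on_cmult: "regular_on U f \<Longrightarrow> regular_on U (\<lambda>z. c * f z)"
  by (rule regular_on_mult[OF regular_on_polynomial[OF polynomial_fun.const]])

lemma regular_on_sum:
  "(\<And>i. i \<in> I \<Longrightarrow> regular_on U (f i)) \<Longrightarrow> regular_on U (\<lambda>z. \<Sum>i\<in>I. f i z)"
  by (induction I rule: infinite_finite_induct)
     (auto intro: regular_on_add regular_on_polynomial polynomial_fun.const)

lemma regular_on_shift:
  assumes "regular_on U f" "\<And>z. z \<in> V \<Longrightarrow> z + b \<in> U"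
  shows "regular_on V (\<lambda>z. f (z + b))"
proof -
  obtain p q where pq: "polynomial_fun p" "polynomial_fun q" "\<And>z. z \<in> U \<Longrightarrow> q z \<noteq> 0 \<and> f z = p z / q z"
    using assms(1) unfolding regular_on_def by blast
  show ?thesis
    unfolding regular_on_def
    by (rule exI[of _ "\<lambda>z. p (z + b)"], rule exI[of _ "\<lambda>z. q (z + b)"])
       (use pq assms(2) in \<open>auto intro!: polynomial_fun_shift\<close>)
qed

lemma rational_fun_imp_regular_open:
  assumes "rational_fun_on K f"
  obtains D where "open D" "K \<subseteq> D" "regular_on D f"
proof -
  obtain p q where pq: "polynomial_fun p" "polynomial_fun q" "\<forall>z\<in>K. q z \<noteq> 0" "f = (\<lambda>z. p z / q z)"
    using assms unfolding rational_fun_on_def by blast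
  have "open {z. q z \<noteq> 0}" by (intro open_Collect_neq polynomial_fun_continuous pq continuous_intros)
  then show ?thesis
    by (rule that) (use pq in \<open>auto simp: regular_on_def\<close>)
qed

section \<open>Derivatives and smoothness\<close>

lemma polynomial_fun_derivative:
  assumes "polynomial_fun f"
  shows "\<exists>d. (\<forall>j. polynomial_fun (d j)) \<and> (\<forall>z. (f has_derivative (\<lambda>v. \<Sum>j\<in>UNIV. d j z * v $ j)) (at z))"
  using assms
proof (induction rule: polynomial_fun.induct)
  case (const c)
  show ?case by (rule exI[of _ "\<lambda>j z. 0"]) (auto intro: polynomial_fun.intros)
next
  case (coord i)
  have "((\<lambda>z. z $ i) has_derivative (\<lambda>v. v $ i)) (at z)" for z :: "complex ^ 'a"
    by (intro bounded_linear.has_derivative[OF bounded_linear_vec_nth] has_derivative_ident)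
  moreover have "(\<Sum>j\<in>UNIV. (if j = i then 1 else 0) * v $ j) = v $ i" for v :: "complex ^ 'a"
    by (simp add: if_distrib[of "\<lambda>x. x * _"] cong: if_cong)
  moreover have "polynomial_fun (\<lambda>z :: complex ^ 'a. if j = i then 1 else 0)" for j
    by (rule polynomial_fun.const)
  ultimately show ?case by (intro exI[of _ "\<lambda>j z. if j = i then 1 else 0"]) simp
next
  case (add f g)
  obtain d where d: "\<And>j. polynomial_fun (d j)" "\<And>z. (f has_derivative (\<lambda>v. \<Sum>j\<in>UNIV. d j z * v $ j)) (at z)"
    using add.IH(1) by blast
  obtain e where e: "\<And>j. polynomial_fun (e j)" "\<And>z. (g has_derivative (\<lambda>v. \<Sum>j\<in>UNIV. e j z * v $ j)) (at z)"
    using add.IH(2) by blast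
  show ?case
  proof (intro exI[of _ "\<lambda>j z. d j z + e j z"] conjI allI)
    show "((\<lambda>z. f z + g z) has_derivative (\<lambda>v. \<Sum>j\<in>UNIV. (d j z + e j z) * v $ j)) (at z)" for z
      using has_derivative_add[OF d(2) e(2)] by (simp add: sum.distrib algebra_simps)
  qed (intro polynomial_fun.add d(1) e(1))
next
  case (mult f g)
  obtain d where d: "\<And>j. polynomial_fun (d j)" "\<And>z. (f has_derivative (\<lambda>v. \<Sum>j\<in>UNIV. d j z * v $ j)) (at z)"
    using mult.IH(1) by blast
  obtain e where e: "\<And>j. polynomial_fun (e j)" "\<And>z. (g has_derivative (\<lambda>v. \<Sum>j\<in>UNIV. e j z * v $ j)) (at z)"
    using mult.IH(2) by blast
  show ?case
  proof (intro exI[of _ "\<lambda>j z. f z * e j z + d j z * g z"] conjI allI)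
    show "((\<lambda>z. f z * g z) has_derivative (\<lambda>v. \<Sum>j\<in>UNIV. (f z * e j z + d j z * g z) * v $ j)) (at z)" for z
      using has_derivative_mult[OF d(2) e(2)]
      by (simp add: sum.distrib sum_distrib_left sum_distrib_right algebra_simps)
  qed (intro polynomial_fun.add polynomial_fun.mult d(1) e(1) mult.hyps)
qed

lemma regular_on_derivative:
  assumes f: "regular_on U f" and U: "open U"
  obtains d where "\<And>j. regular_on U (d j)"
    "\<And>z. z \<in> U \<Longrightarrow> (f has_derivative (\<lambda>v. \<Sum>j\<in>UNIV. d j z * v $ j)) (at z)"
proof -
  obtain p q where pq: "polynomial_fun p" "polynomial_fun q" "\<And>z. z \<in> U \<Longrightarrow> q z \<noteq> 0 \<and> f z = p z / q z"
    using f unfolding regular_on_def by blast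
  obtain d where d: "\<And>j. polynomial_fun (d j)" "\<And>z. (p has_derivative (\<lambda>v. \<Sum>j\<in>UNIV. d j z * v $ j)) (at z)"
    using polynomial_fun_derivative[OF pq(1)] by blast
  obtain e where e: "\<And>j. polynomial_fun (e j)" "\<And>z. (q has_derivative (\<lambda>v. \<Sum>j\<in>UNIV. e j z * v $ j)) (at z)"
    using polynomial_fun_derivative[OF pq(2)] by blast
  show ?thesis
  proof (rule that[of "\<lambda>j z. (d j z * q z - p z * e j z) / (q z * q z)"])
    show "regular_on U (\<lambda>z. (d j z * q z - p z * e j z) / (q z * q z))" for j
      unfolding regular_on_def
      by (rule exI[of _ "\<lambda>z. d j z * q z - p z * e j z"], rule exI[of _ "\<lambda>z. q z * q z"])
         (use pq d(1) e(1) in \<open>auto intro!: polynomial_fun.mult polynomial_fun_diff\<close>)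
    fix z assume z: "z \<in> U"
    have "((\<lambda>z. p z / q z) has_derivative
        (\<lambda>v. ((\<Sum>j\<in>UNIV. d j z * v $ j) * q z - p z * (\<Sum>j\<in>UNIV. e j z * v $ j)) / (q z * q z))) (at z)"
      by (rule has_derivative_divide'[OF d(2) e(2)]) (use pq(3)[OF z] in auto)
    also have "(\<lambda>v. ((\<Sum>j\<in>UNIV. d j z * v $ j) * q z - p z * (\<Sum>j\<in>UNIV. e j z * v $ j)) / (q z * q z))
      = (\<lambda>v. \<Sum>j\<in>UNIV. (d j z * q z - p z * e j z) / (q z * q z) * v $ j)"
      by (rule ext) (simp add: sum_distrib_left sum_distrib_right sum_subtractf[symmetric] sum_divide_distrib algebra_simps)
    finally show "(f has_derivative (\<lambda>v. \<Sum>j\<in>UNIV. (d j z * q z - p z * e j z) / (q z * q z) * v $ j)) (at z)"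
      by (rule has_derivative_transform_within_open[OF _ U z]) (use pq(3) in auto)
  qed
qed

text \<open>The algebra generated by regular functions and conjugation. It is closed under
  directional derivatives, so smoothness of every order follows by one induction.\<close>

inductive smooth_fun_on :: "(complex ^ 'n::finite) set \<Rightarrow> (complex ^ 'n \<Rightarrow> complex) \<Rightarrow> bool" for U where
  regular: "regular_on U f \<Longrightarrow> smooth_fun_on U f"
| cnj: "smooth_fun_on U f \<Longrightarrow> smooth_fun_on U (\<lambda>z. cnj (f z))"
| add: "smooth_fun_on U f \<Longrightarrow> smooth_fun_on U g \<Longrightarrow> smooth_fun_on U (\<lambda>z. f z + g z)"
| mult: "smooth_fun_on U f \<Longrightarrow> smooth_fun_on U g \<Longrightarrow> smooth_fun_on U (\<lambda>z. f z * g z)"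

lemma smooth_fun_on_sum:
  "(\<And>i. i \<in> I \<Longrightarrow> smooth_fun_on U (f i)) \<Longrightarrow> smooth_fun_on U (\<lambda>z. \<Sum>i\<in>I. f i z)"
  by (induction I rule: infinite_finite_induct)
     (auto intro: smooth_fun_on.intros regular_on_polynomial polynomial_fun.const)

lemma smooth_fun_on_derivative:
  assumes "smooth_fun_on U f" and U: "open U"
  shows "\<exists>f'. (\<forall>z\<in>U. (f has_derivative f' z) (at z)) \<and> (\<forall>v. smooth_fun_on U (\<lambda>z. f' z v))"
  using assms(1)
proof (induction rule: smooth_fun_on.induct)
  case (regular f)
  obtain d where d: "\<And>j. regular_on U (d j)"
    "\<And>z. z \<in> U \<Longrightarrow> (f has_derivative (\<lambda>v. \<Sum>j\<in>UNIV. d j z * v $ j)) (at z)"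
    using regular_on_derivative[OF regular U] by blast
  have "smooth_fun_on U (\<lambda>z. \<Sum>j\<in>UNIV. d j z * v $ j)" for v
    by (intro smooth_fun_on.regular regular_on_sum regular_on_mult d(1) regular_on_polynomial polynomial_fun.const)
  with d(2) show ?case by (intro exI[of _ "\<lambda>z v. \<Sum>j\<in>UNIV. d j z * v $ j"]) blast
next
  case (cnj f)
  then obtain f' where f': "\<And>z. z \<in> U \<Longrightarrow> (f has_derivative f' z) (at z)" "\<And>v. smooth_fun_on U (\<lambda>z. f' z v)" by blast
  show ?case
    by (rule exI[of _ "\<lambda>z v. cnj (f' z v)"])
       (auto intro!: has_derivative_cnj f' smooth_fun_on.cnj)
next
  case (add f g)
  obtain f' where f': "\<And>z. z \<in> U \<Longrightarrow> (f has_derivative f' z) (at z)" "\<And>v. smooth_fun_on U (\<lambda>z. f' z v)"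
    using add.IH(1) by blast
  obtain g' where g': "\<And>z. z \<in> U \<Longrightarrow> (g has_derivative g' z) (at z)" "\<And>v. smooth_fun_on U (\<lambda>z. g' z v)"
    using add.IH(2) by blast
  show ?case
    by (rule exI[of _ "\<lambda>z v. f' z v + g' z v"]) (auto intro!: has_derivative_add f' g' smooth_fun_on.add)
next
  case (mult f g)
  obtain f' where f': "\<And>z. z \<in> U \<Longrightarrow> (f has_derivative f' z) (at z)" "\<And>v. smooth_fun_on U (\<lambda>z. f' z v)"
    using mult.IH(1) by blast
  obtain g' where g': "\<And>z. z \<in> U \<Longrightarrow> (g has_derivative g' z) (at z)" "\<And>v. smooth_fun_on U (\<lambda>z. g' z v)"
    using mult.IH(2) by blast
  show ?case
    by (rule exI[of _ "\<lambda>z v. f z * g' z v + f' z v * g z"])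
       (auto intro!: has_derivative_mult f' g' smooth_fun_on.add smooth_fun_on.mult mult.hyps)
qed

lemma Ck_on_Re_smooth:
  assumes U: "open U"
  shows "smooth_fun_on U f \<Longrightarrow> Ck_on k (\<lambda>z. Re (f z)) U"
proof (induction k arbitrary: f)
  case 0
  obtain f' where f': "\<And>z. z \<in> U \<Longrightarrow> (f has_derivative f' z) (at z)"
    using smooth_fun_on_derivative[OF 0 U] by blast
  have "continuous_on U f"
    using f' has_derivative_continuous by (intro continuous_at_imp_continuous_on ballI) blast
  then show ?case by (simp add: continuous_on_Re)
next
  case (Suc k)
  obtain f' where f': "\<And>z. z \<in> U \<Longrightarrow> (f has_derivative f' z) (at z)" "\<And>v. smooth_fun_on U (\<lambda>z. f' z v)"
    using smooth_fun_on_derivative[OF Suc.prems U] by blast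
  have "\<forall>z\<in>U. ((\<lambda>z. Re (f z)) has_derivative (\<lambda>v. Re (f' z v))) (at z)"
    using f'(1) by (auto intro!: has_derivative_Re)
  moreover have "\<forall>v. Ck_on k (\<lambda>z. Re (f' z v)) U" using Suc.IH f'(2) by blast
  ultimately show ?case unfolding Ck_on.simps by (intro exI[of _ "\<lambda>z v. Re (f' z v)"]) simp
qed

definition sum_of_squares :: "('l \<Rightarrow> complex ^ 'n::finite \<Rightarrow> complex) \<Rightarrow> 'l set \<Rightarrow> complex ^ 'n \<Rightarrow> real" where
  "sum_of_squares f \<Lambda> z = (\<Sum>l\<in>\<Lambda>. (norm (f l z))\<^sup>2)"

lemma sum_of_squares_complex:
  "complex_of_real (sum_of_squares f \<Lambda> z) = (\<Sum>l\<in>\<Lambda>. f l z * cnj (f l z))"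
  unfolding sum_of_squares_def of_real_sum complex_norm_square ..

lemma Ck_on_sum_of_squares:
  assumes "open U" "\<And>l. l \<in> \<Lambda> \<Longrightarrow> regular_on U (f l)"
  shows "Ck_on k (\<lambda>z. sum_of_squares f \<Lambda> z + c) U"
proof -
  have "smooth_fun_on U (\<lambda>z. (\<Sum>l\<in>\<Lambda>. f l z * cnj (f l z)) + complex_of_real c)"
    by (intro smooth_fun_on.add smooth_fun_on_sum smooth_fun_on.mult smooth_fun_on.cnj
        smooth_fun_on.regular assms regular_on_polynomial polynomial_fun.const)
  from Ck_on_Re_smooth[OF assms(1) this, of k] show ?thesis
    unfolding sum_of_squares_complex[symmetric] by simp
qed

section \<open>The Levi form of a sum of squares\<close>

lemma sum_mult_axis: "(\<Sum>j\<in>UNIV. d j * (axis k c) $ j) = d k * (c::complex)"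
proof -
  have "(\<Sum>j\<in>UNIV. d j * (axis k c) $ j) = (\<Sum>j\<in>UNIV. if j = k then d k * c else 0)"
    by (intro sum.cong) (auto simp: axis_def)
  then show ?thesis by simp
qed

text \<open>For complex differentiable \<open>f l\<close> and \<open>g l\<close> the derivative in z
  sees only the first factor of \<open>f l * cnj (g l)\<close>, the conjugate one only the second.
  Derivatives are needed at one point only, and \<open>f\<close> and \<open>g\<close> may differ, so
  that the lemma applies again to its own output; \<open>c\<close> takes care of the constant in a
  defining function.\<close>

lemma wirtinger_mixed:
  assumes d: "\<And>l. l \<in> \<Lambda> \<Longrightarrow> (f l has_derivative (\<lambda>v. \<Sum>j\<in>UNIV. d l j * v $ j)) (at z)"
    and e: "\<And>l. l \<in> \<Lambda> \<Longrightarrow> (g l has_derivative (\<lambda>v. \<Sum>j\<in>UNIV. e l j * v $ j)) (at z)"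
    and U: "open U" "z \<in> U" "\<And>w. w \<in> U \<Longrightarrow> h w = (\<Sum>l\<in>\<Lambda>. f l w * cnj (g l w)) + c"
  shows "wirtinger k h z = (\<Sum>l\<in>\<Lambda>. d l k * cnj (g l z))"
    "wirtinger_bar k h z = (\<Sum>l\<in>\<Lambda>. f l z * cnj (e l k))"
proof -
  let ?D = "\<lambda>v. \<Sum>l\<in>\<Lambda>. f l z * cnj (\<Sum>j\<in>UNIV. e l j * v $ j) + (\<Sum>j\<in>UNIV. d l j * v $ j) * cnj (g l z)"
  have "((\<lambda>w. (\<Sum>l\<in>\<Lambda>. f l w * cnj (g l w)) + c) has_derivative (\<lambda>v. ?D v + 0)) (at z)"
    by (intro has_derivative_add has_derivative_sum has_derivative_mult has_derivative_cnj d e has_derivative_const)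
  then have "(h has_derivative (\<lambda>v. ?D v + 0)) (at z)"
    by (rule has_derivative_transform_within_open[OF _ U(1,2)]) (use U(3) in auto)
  then have D: "frechet_derivative h (at z) = ?D" using frechet_derivative_at by fastforce
  have 1: "?D (axis k 1) = (\<Sum>l\<in>\<Lambda>. f l z * cnj (e l k)) + (\<Sum>l\<in>\<Lambda>. d l k * cnj (g l z))"
    unfolding sum_mult_axis by (simp add: sum.distrib)
  have 2: "?D (axis k \<i>) = - \<i> * (\<Sum>l\<in>\<Lambda>. f l z * cnj (e l k)) + \<i> * (\<Sum>l\<in>\<Lambda>. d l k * cnj (g l z))"
    unfolding sum_mult_axis by (simp add: sum.distrib sum_distrib_left sum_negf sum_subtractf mult_ac)
  show "wirtinger k h z = (\<Sum>l\<in>\<Lambda>. d l k * cnj (g l z))"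
    unfolding wirtinger_def D 1 2 by (simp add: algebra_simps)
  show "wirtinger_bar k h z = (\<Sum>l\<in>\<Lambda>. f l z * cnj (e l k))"
    unfolding wirtinger_bar_def D 1 2 by (simp add: algebra_simps)
qed

text \<open>\<open>wirtinger_mixed\<close> twice: first for the conjugate derivative on all of
  \<open>U\<close>, then with \<open>g l\<close> replaced by the derivative \<open>d l k\<close>.
  The double sum over coordinates then factors into squares.\<close>

lemma levi_form_sum_of_squares:
  assumes U: "open U" "p \<in> U" and reg: "\<And>l. l \<in> \<Lambda> \<Longrightarrow> regular_on U (f l)"
    and d: "\<And>l z. l \<in> \<Lambda> \<Longrightarrow> z \<in> U \<Longrightarrow> (f l has_derivative (\<lambda>v. \<Sum>j\<in>UNIV. d l j z * v $ j)) (at z)"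
    and dreg: "\<And>l j. l \<in> \<Lambda> \<Longrightarrow> regular_on U (d l j)"
  shows "levi_form (\<lambda>z. sum_of_squares f \<Lambda> z + c) p v =
    complex_of_real (\<Sum>l\<in>\<Lambda>. (norm (\<Sum>j\<in>UNIV. d l j p * v $ j))\<^sup>2)"
proof -
  have bar: "wirtinger_bar k (\<lambda>z. complex_of_real (sum_of_squares f \<Lambda> z + c)) z = (\<Sum>l\<in>\<Lambda>. f l z * cnj (d l k z))"
    if "z \<in> U" for k z
    by (rule wirtinger_mixed(2)[where U = U and c = "complex_of_real c" and d = "\<lambda>l j. d l j z" and e = "\<lambda>l j. d l j z"])
       (use d that U in \<open>auto simp: sum_of_squares_complex\<close>)
  have w: "wirtinger j (wirtinger_bar k (\<lambda>z. complex_of_real (sum_of_squares f \<Lambda> z + c))) p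
      = (\<Sum>l\<in>\<Lambda>. d l j p * cnj (d l k p))" for j k
  proof -
    have "\<exists>e. \<forall>l\<in>\<Lambda>. (d l k has_derivative (\<lambda>v. \<Sum>j\<in>UNIV. e l j * v $ j)) (at p)"
    proof -
      have "\<exists>e. (d l k has_derivative (\<lambda>v. \<Sum>j\<in>UNIV. e j * v $ j)) (at p)" if "l \<in> \<Lambda>" for l
        using regular_on_derivative[OF dreg[OF that, of k] U(1)] U(2) by metis
      then show ?thesis by metis
    qed
    then obtain e where e: "\<And>l. l \<in> \<Lambda> \<Longrightarrow> (d l k has_derivative (\<lambda>v. \<Sum>j\<in>UNIV. e l j * v $ j)) (at p)" by blast
    show ?thesis
      by (rule wirtinger_mixed(1)[where U = U and c = 0 and d = "\<lambda>l j. d l j p" and e = e]) (use d e U bar in auto)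
  qed
  have "levi_form (\<lambda>z. sum_of_squares f \<Lambda> z + c) p v =
      (\<Sum>j\<in>UNIV. \<Sum>k\<in>UNIV. \<Sum>l\<in>\<Lambda>. (d l j p * v $ j) * cnj (d l k p * v $ k))"
    unfolding levi_form_def w by (simp add: sum_distrib_right sum_distrib_left mult_ac)
  also have "\<dots> = (\<Sum>j\<in>UNIV. \<Sum>l\<in>\<Lambda>. \<Sum>k\<in>UNIV. (d l j p * v $ j) * cnj (d l k p * v $ k))"
    by (intro sum.cong refl sum.swap)
  also have "\<dots> = (\<Sum>l\<in>\<Lambda>. \<Sum>j\<in>UNIV. \<Sum>k\<in>UNIV. (d l j p * v $ j) * cnj (d l k p * v $ k))"
    by (rule sum.swap)
  also have "\<dots> = (\<Sum>l\<in>\<Lambda>. (\<Sum>j\<in>UNIV. d l j p * v $ j) * cnj (\<Sum>j\<in>UNIV. d l j p * v $ j))"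
    unfolding cnj_sum sum_product ..
  finally show ?thesis unfolding of_real_sum complex_norm_square .
qed

text \<open>Some coordinate \<open>v $ i\<close> is nonzero, and the member that is affine in
  \<open>z $ i\<close> contributes the square of \<open>norm (\<kappa> * v $ i)\<close>. Positivity
  thus holds in all directions and not merely in tangential ones.\<close>

lemma levi_form_pos:
  fixes f :: "'l \<Rightarrow> complex ^ 'n::finite \<Rightarrow> complex"
  assumes U: "open U" "p \<in> U" and fin: "finite \<Lambda>" and reg: "\<And>l. l \<in> \<Lambda> \<Longrightarrow> regular_on U (f l)"
    and coord: "\<And>i. \<exists>l\<in>\<Lambda>. \<exists>\<kappa> b. \<kappa> \<noteq> 0 \<and> f l = (\<lambda>z. \<kappa> * (z $ i + b))" and v: "v \<noteq> 0"
  shows "Re (levi_form (\<lambda>z. sum_of_squares f \<Lambda> z + c) p v) > 0"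
proof -
  define Q where "Q l d \<longleftrightarrow> (\<forall>j. regular_on U (d j)) \<and>
    (\<forall>z\<in>U. (f l has_derivative (\<lambda>v. \<Sum>j\<in>UNIV. d j z * v $ j)) (at z))" for l d
  have "\<exists>d. Q l d" if l: "l \<in> \<Lambda>" for l
  proof -
    obtain d where "\<And>j. regular_on U (d j)"
      "\<And>z. z \<in> U \<Longrightarrow> (f l has_derivative (\<lambda>v. \<Sum>j\<in>UNIV. d j z * v $ j)) (at z)"
      by (rule regular_on_derivative[OF reg[OF l] U(1)]) blast
    then show ?thesis unfolding Q_def by blast
  qed
  then obtain d where "\<And>l. l \<in> \<Lambda> \<Longrightarrow> Q l (d l)" by metis
  then have d: "\<And>l j. l \<in> \<Lambda> \<Longrightarrow> regular_on U (d l j)"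
    "\<And>l z. l \<in> \<Lambda> \<Longrightarrow> z \<in> U \<Longrightarrow> (f l has_derivative (\<lambda>v. \<Sum>j\<in>UNIV. d l j z * v $ j)) (at z)"
    unfolding Q_def by blast+
  obtain i where i: "v $ i \<noteq> 0" using v by (metis vec_eq_iff zero_index)
  obtain l \<kappa> b where l: "l \<in> \<Lambda>" "\<kappa> \<noteq> 0" "f l = (\<lambda>z. \<kappa> * (z $ i + b))" using coord by blast
  have "(f l has_derivative (\<lambda>v. \<kappa> * (v $ i + 0))) (at p)"
    unfolding l(3)
    by (intro has_derivative_mult_right has_derivative_add has_derivative_const
        bounded_linear.has_derivative[OF bounded_linear_vec_nth] has_derivative_ident)
  from has_derivative_unique[OF this d(2)[OF l(1) U(2)]]
  have "(\<Sum>j\<in>UNIV. d l j p * v $ j) = \<kappa> * v $ i" by (metis add.right_neutral)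
  then have "(norm (\<Sum>j\<in>UNIV. d l j p * v $ j))\<^sup>2 > 0" using l(2) i by simp
  then have "(\<Sum>l\<in>\<Lambda>. (norm (\<Sum>j\<in>UNIV. d l j p * v $ j))\<^sup>2) > 0"
    using fin l(1) by (intro sum_pos2) auto
  moreover have "levi_form (\<lambda>z. sum_of_squares f \<Lambda> z + c) p v =
      complex_of_real (\<Sum>l\<in>\<Lambda>. (norm (\<Sum>j\<in>UNIV. d l j p * v $ j))\<^sup>2)"
    by (rule levi_form_sum_of_squares[OF U reg d(2) d(1)])
  ultimately show ?thesis by simp
qed

text \<open>
  The polarised function \<open>w \<mapsto> \<Sum> conj (f\<^sub>l z) f\<^sub>l w\<close> separates \<open>z\<close> from the sublevel set, by
  the inequality between arithmetic and geometric means.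
\<close>

lemma sum_of_squares_polarised:
  assumes "sum_of_squares f \<Lambda> w \<le> 1"
  shows "norm (\<Sum>l\<in>\<Lambda>. cnj (f l z) * f l w) \<le> (1 + sum_of_squares f \<Lambda> z) / 2"
    "norm (\<Sum>l\<in>\<Lambda>. cnj (f l z) * f l z) = sum_of_squares f \<Lambda> z"
proof -
  have "norm (\<Sum>l\<in>\<Lambda>. cnj (f l z) * f l w) \<le> (\<Sum>l\<in>\<Lambda>. ((norm (f l w))\<^sup>2 + (norm (f l z))\<^sup>2) / 2)"
  proof (rule sum_norm_le)
    fix l
    show "norm (cnj (f l z) * f l w) \<le> ((norm (f l w))\<^sup>2 + (norm (f l z))\<^sup>2) / 2"
      using sum_squares_bound[of "norm (f l z)" "norm (f l w)"] by (simp add: norm_mult)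
  qed
  also have "\<dots> = (sum_of_squares f \<Lambda> w + sum_of_squares f \<Lambda> z) / 2"
    by (simp add: sum_of_squares_def sum.distrib sum_divide_distrib[symmetric])
  finally show "norm (\<Sum>l\<in>\<Lambda>. cnj (f l z) * f l w) \<le> (1 + sum_of_squares f \<Lambda> z) / 2" using assms by simp
  have "(\<Sum>l\<in>\<Lambda>. cnj (f l z) * f l z) = complex_of_real (sum_of_squares f \<Lambda> z)"
    unfolding sum_of_squares_complex by (simp add: mult.commute)
  moreover have "sum_of_squares f \<Lambda> z \<ge> 0" unfolding sum_of_squares_def by (intro sum_nonneg) simp
  ultimately show "norm (\<Sum>l\<in>\<Lambda>. cnj (f l z) * f l z) = sum_of_squares f \<Lambda> z" by simp
qed

section \<open>Convexity of the sublevel sets\<close>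

lemma polynomially_convexI:
  assumes K: "compact K" "K \<noteq> {}"
    and sep: "\<And>z. z \<notin> K \<Longrightarrow> \<exists>f m. polynomial_fun f \<and> (\<forall>w\<in>K. norm (f w) \<le> m) \<and> m < norm (f z)"
  shows "polynomially_convex K"
proof -
  have bdd: "bdd_above ((\<lambda>w. norm (cpoly_eval P w)) ` K)" for P
    using K(1) by (intro bounded_imp_bdd_above compact_imp_bounded compact_continuous_image continuous_intros
        polynomial_fun_continuous polynomial_fun_cpoly_eval)
  have "z \<in> polynomial_hull K \<longleftrightarrow> z \<in> K" for z
  proof
    assume z: "z \<in> polynomial_hull K"
    show "z \<in> K"
    proof (rule ccontr)
      assume "z \<notin> K"
      then obtain f m where f: "polynomial_fun f" "\<forall>w\<in>K. norm (f w) \<le> m" "m < norm (f z)" using sep by blast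
      obtain P where P: "f = cpoly_eval P" using polynomial_fun_imp_cpoly_eval[OF f(1)] by blast
      have "norm (cpoly_eval P z) \<le> (SUP w\<in>K. norm (cpoly_eval P w))" using z by (simp add: polynomial_hull_def)
      also have "\<dots> \<le> m" using f(2) K(2) by (intro cSUP_least) (auto simp: P)
      finally show False using f(3) by (simp add: P)
    qed
  next
    assume "z \<in> K"
    then show "z \<in> polynomial_hull K" by (auto simp: polynomial_hull_def intro: cSUP_upper bdd)
  qed
  then show ?thesis using K(1) by (auto simp: polynomially_convex_def)
qed

lemma rationally_convexI:
  assumes K: "compact K" "K \<noteq> {}"
    and sep: "\<And>z. z \<notin> K \<Longrightarrow> \<exists>p q m. polynomial_fun p \<and> polynomial_fun q \<and> (\<forall>w\<in>K. q w \<noteq> 0 \<and> norm (p w / q w) \<le> m) \<and>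
      (q z = 0 \<or> m < norm (p z / q z))"
  shows "rationally_convex K"
proof -
  have bdd: "bdd_above ((\<lambda>w. norm (cpoly_eval P w / cpoly_eval Q w)) ` K)" if "\<forall>w\<in>K. cpoly_eval Q w \<noteq> 0" for P Q
    using K(1) that by (intro bounded_imp_bdd_above compact_imp_bounded compact_continuous_image continuous_intros
        polynomial_fun_continuous polynomial_fun_cpoly_eval)
  have "z \<in> rational_hull K \<longleftrightarrow> z \<in> K" for z
  proof
    assume z: "z \<in> rational_hull K"
    show "z \<in> K"
    proof (rule ccontr)
      assume "z \<notin> K"
      then obtain p q m where f: "polynomial_fun p" "polynomial_fun q" "\<forall>w\<in>K. q w \<noteq> 0 \<and> norm (p w / q w) \<le> m"
        "q z = 0 \<or> m < norm (p z / q z)" using sep by blast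
      obtain P where P: "p = cpoly_eval P" using polynomial_fun_imp_cpoly_eval[OF f(1)] by blast
      obtain Q where Q: "q = cpoly_eval Q" using polynomial_fun_imp_cpoly_eval[OF f(2)] by blast
      have nz: "\<forall>w\<in>K. cpoly_eval Q w \<noteq> 0" using f(3) by (simp add: Q)
      then have h: "cpoly_eval Q z \<noteq> 0" "norm (cpoly_eval P z / cpoly_eval Q z) \<le> (SUP w\<in>K. norm (cpoly_eval P w / cpoly_eval Q w))"
        using z unfolding rational_hull_def by blast+
      note h(2)
      also have "(SUP w\<in>K. norm (cpoly_eval P w / cpoly_eval Q w)) \<le> m" using f(3) K(2) by (intro cSUP_least) (auto simp: P Q)
      finally show False using f(4) h(1) by (simp add: P Q)
    qed
  next
    assume "z \<in> K"
    then show "z \<in> rational_hull K" by (auto simp: rational_hull_def intro: cSUP_upper bdd)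
  qed
  then show ?thesis using K(1) by (auto simp: rationally_convex_def)
qed

text \<open>A point can miss \<open>L\<close> for two reasons. If its ball leaves \<open>K\<close>
  at \<open>y\<close>, translation by \<open>y - z\<close> moves \<open>L\<close> into
  \<open>K\<close> and \<open>z\<close> to \<open>y\<close>; otherwise the sum of squares exceeds 1
  and the polarised function separates.\<close>

lemma polynomially_convex_sublevel:
  assumes K: "polynomially_convex K" and f: "\<And>l. l \<in> \<Lambda> \<Longrightarrow> polynomial_fun (f l)"
    and L: "L = {z. cball z \<eta> \<subseteq> K \<and> sum_of_squares f \<Lambda> z \<le> 1}" "compact L" "L \<noteq> {}" and \<eta>: "\<eta> > 0"
  shows "polynomially_convex L"
proof (rule polynomially_convexI[OF L(2,3)])
  fix z assume z: "z \<notin> L"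
  show "\<exists>f m. polynomial_fun f \<and> (\<forall>w\<in>L. norm (f w) \<le> m) \<and> m < norm (f z)"
  proof (cases "cball z \<eta> \<subseteq> K")
    case False
    then obtain y where "y \<in> cball z \<eta>" and y: "y \<notin> K" by blast
    then have y: "dist z y \<le> \<eta>" "y \<notin> K" by simp_all
    have "K \<noteq> {}" using L(1,3) \<eta> by force
    obtain g m where g: "polynomial_fun g" "\<And>w. w \<in> K \<Longrightarrow> norm (g w) \<le> m" "m < norm (g y)"
      by (rule polynomially_convex_separation[OF K y(2) \<open>K \<noteq> {}\<close>]) blast
    have "norm (g (w + (y - z))) \<le> m" if "w \<in> L" for w
      using that y(1) by (intro g(2)) (auto simp: L(1) dist_norm norm_minus_commute subset_iff)
    then show ?thesis using polynomial_fun_shift[OF g(1), of "y - z"] g(3)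
      by (intro exI[of _ "\<lambda>w. g (w + (y - z))"] exI[of _ m]) auto
  next
    case True
    then have F: "sum_of_squares f \<Lambda> z > 1" using z by (auto simp: L(1))
    have "polynomial_fun (\<lambda>w. \<Sum>l\<in>\<Lambda>. cnj (f l z) * f l w)"
      by (intro polynomial_fun_sum polynomial_fun_cmult f)
    moreover have "\<forall>w\<in>L. norm (\<Sum>l\<in>\<Lambda>. cnj (f l z) * f l w) \<le> (1 + sum_of_squares f \<Lambda> z) / 2"
      using sum_of_squares_polarised(1) by (auto simp: L(1))
    moreover obtain w where "w \<in> L" using L(3) by blast
    then have "norm (\<Sum>l\<in>\<Lambda>. cnj (f l z) * f l z) = sum_of_squares f \<Lambda> z"
      by (intro sum_of_squares_polarised(2)[of f \<Lambda> w]) (auto simp: L(1))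
    ultimately show ?thesis using F
      by (intro exI[of _ "\<lambda>w. \<Sum>l\<in>\<Lambda>. cnj (f l z) * f l w"] exI[of _ "(1 + sum_of_squares f \<Lambda> z) / 2"]) auto
  qed
qed

text \<open>The same two cases as for polynomials, with other witnesses: a translated polynomial
  with a zero at \<open>z\<close>, or the polarised function, which is regular just on the core,
  where \<open>z\<close> then lies.\<close>

lemma rationally_convex_sublevel:
  assumes K: "rationally_convex K" and f: "\<And>l. l \<in> \<Lambda> \<Longrightarrow> regular_on {z. cball z \<eta> \<subseteq> K} (f l)"
    and L: "L = {z. cball z \<eta> \<subseteq> K \<and> sum_of_squares f \<Lambda> z \<le> 1}" "compact L" "L \<noteq> {}" and \<eta>: "\<eta> > 0"
  shows "rationally_convex L"
proof (rule rationally_convexI[OF L(2,3)])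
  fix z assume z: "z \<notin> L"
  show "\<exists>p q m. polynomial_fun p \<and> polynomial_fun q \<and> (\<forall>w\<in>L. q w \<noteq> 0 \<and> norm (p w / q w) \<le> m) \<and>
      (q z = 0 \<or> m < norm (p z / q z))"
  proof (cases "cball z \<eta> \<subseteq> K")
    case False
    then obtain y where "y \<in> cball z \<eta>" and y: "y \<notin> K" by blast
    then have y: "dist z y \<le> \<eta>" "y \<notin> K" by simp_all
    obtain g where g: "polynomial_fun g" "\<And>w. w \<in> K \<Longrightarrow> g w \<noteq> 0" "g y = 0"
      by (rule rationally_convex_separation[OF K y(2)]) blast
    have "g (w + (y - z)) \<noteq> 0" if "w \<in> L" for w
      using that y(1) by (intro g(2)) (auto simp: L(1) dist_norm norm_minus_commute subset_iff)
    \<comment> \<open>The zero of the denominator at \<open>z\<close> separates, so numerator and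
      bound are taken to be 0.\<close>
    then show ?thesis using polynomial_fun_shift[OF g(1), of "y - z"] g(3)
      by (intro exI[of _ "\<lambda>w. 0"] exI[of _ "\<lambda>w. g (w + (y - z))"] exI[of _ 0]) (auto intro: polynomial_fun.const)
  next
    case True
    then have F: "sum_of_squares f \<Lambda> z > 1" using z by (auto simp: L(1))
    have "regular_on {z. cball z \<eta> \<subseteq> K} (\<lambda>w. \<Sum>l\<in>\<Lambda>. cnj (f l z) * f l w)"
      by (intro regular_on_sum regular_on_cmult f)
    then obtain p q where pq: "polynomial_fun p" "polynomial_fun q"
      "\<And>w. cball w \<eta> \<subseteq> K \<Longrightarrow> q w \<noteq> 0 \<and> (\<Sum>l\<in>\<Lambda>. cnj (f l z) * f l w) = p w / q w"
      unfolding regular_on_def by blast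
    have "\<forall>w\<in>L. q w \<noteq> 0 \<and> norm (p w / q w) \<le> (1 + sum_of_squares f \<Lambda> z) / 2"
    proof
      fix w assume "w \<in> L"
      then have "cball w \<eta> \<subseteq> K" "sum_of_squares f \<Lambda> w \<le> 1" by (auto simp: L(1))
      with sum_of_squares_polarised(1)[of f \<Lambda> w z] pq(3)[of w]
      show "q w \<noteq> 0 \<and> norm (p w / q w) \<le> (1 + sum_of_squares f \<Lambda> z) / 2" by metis
    qed
    moreover obtain w where "w \<in> L" using L(3) by blast
    then have "norm (\<Sum>l\<in>\<Lambda>. cnj (f l z) * f l z) = sum_of_squares f \<Lambda> z"
      by (intro sum_of_squares_polarised(2)[of f \<Lambda> w]) (auto simp: L(1))
    then have "norm (p z / q z) = sum_of_squares f \<Lambda> z" using pq(3)[OF True] by simp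
    ultimately show ?thesis using F pq(1,2)
      by (intro exI[of _ p] exI[of _ q] exI[of _ "(1 + sum_of_squares f \<Lambda> z) / 2"]) auto
  qed
qed

section \<open>Approximation from inside\<close>

text \<open>If \<open>\<rho> x\<close> were 0, then \<open>x\<close> would be an interior maximum of
  \<open>\<rho>\<close> and the gradient would vanish. So the core lies in the domain itself and not
  merely in its closure.\<close>

lemma cball_subset_imp_neg:
  fixes \<rho> :: "'a::euclidean_space \<Rightarrow> real"
  assumes \<rho>: "has_gradient_on \<rho> N UNIV" and nz: "\<And>x. \<rho> x = 0 \<Longrightarrow> N x \<noteq> 0"
    and sub: "cball x \<eta> \<subseteq> {x. \<rho> x \<le> 0}" and \<eta>: "\<eta> > 0"
  shows "\<rho> x < 0"
proof (rule ccontr)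
  assume n: "\<not> \<rho> x < 0"
  have "x \<in> cball x \<eta>" using \<eta> by simp
  then have "\<rho> x \<le> 0" using sub by blast
  with n have 0: "\<rho> x = 0" by simp
  have "(\<lambda>v. N x \<bullet> v) = (\<lambda>v. 0)"
  proof (rule differential_zero_maxmin[of x "ball x \<eta>" \<rho>])
    have "\<rho> y \<le> \<rho> x" if "y \<in> ball x \<eta>" for y using that sub 0 by (auto simp: subset_iff)
    then show "(\<forall>y\<in>ball x \<eta>. \<rho> y \<le> \<rho> x) \<or> (\<forall>y\<in>ball x \<eta>. \<rho> x \<le> \<rho> y)" by blast
  qed (use \<eta> has_gradient_onD[OF \<rho>] in auto)
  then have "N x \<bullet> N x = 0" by metis
  with nz[OF 0] show False by simp
qed

text \<open>The part common to both cases: \<open>\<A>\<close> will be the class of polynomials or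
  of functions rational on the closure. Convexity of the new closure is left to the caller, for whom
  the closure and the members \<open>f l\<close> are made explicit. An index is a quadrature node
  with its cell, paired with a function of the family.\<close>

lemma pseudoconvex_approximation:
  fixes \<Omega> :: "(complex ^ 'n::finite) set"
  assumes dom: "domain \<Omega>" and C1: "has_C_boundary 1 \<Omega>" and cK: "compact (closure \<Omega>)" and ne: "\<Omega> \<noteq> {}"
    and e: "e > 0" and rat: "\<And>f. f \<in> \<A> \<Longrightarrow> rational_fun_on (closure \<Omega>) f"
    and fam: "\<And>\<epsilon> \<tau> B. \<epsilon> > 0 \<Longrightarrow> \<tau> > 0 \<Longrightarrow> \<exists>\<F> \<kappa>. finite \<F> \<and> \<F> \<subseteq> \<A> \<and>
      (\<forall>x. cball x \<epsilon> \<subseteq> closure \<Omega> \<longrightarrow> (\<Sum>f\<in>\<F>. (norm (f x))\<^sup>2) \<le> \<tau>) \<and>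
      (\<forall>y y'. y \<in> closure \<Omega> \<longrightarrow> y' \<notin> closure \<Omega> \<longrightarrow> dist y y' < \<epsilon> / 2 \<longrightarrow> B \<le> (\<Sum>f\<in>\<F>. (norm (f y))\<^sup>2)) \<and>
      \<kappa> \<noteq> 0 \<and> (\<forall>i. (\<lambda>z. \<kappa> * z $ i) \<in> \<F>)"
  obtains \<Omega>' h \<eta> and \<Lambda> :: "(((complex ^ 'n) \<times> (complex ^ 'n) set) \<times> (complex ^ 'n \<Rightarrow> complex)) set" and f
  where "ambient_C1_isotopy h \<Omega> \<Omega>'" "\<forall>s\<in>{0..1}. \<forall>z. norm (h s z - z) < e" "domain \<Omega>'" "smoothly_bounded \<Omega>'"
    "strictly_pseudoconvex \<Omega>'" "\<Omega>' \<subseteq> \<Omega>" "\<Omega>' \<noteq> {}" "\<eta> > 0"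
    "closure \<Omega>' = {z. cball z \<eta> \<subseteq> closure \<Omega> \<and> sum_of_squares f \<Lambda> z \<le> 1}"
    "\<And>l. l \<in> \<Lambda> \<Longrightarrow> \<exists>g\<in>\<A>. \<exists>c a. norm a \<le> \<eta> \<and> f l = (\<lambda>z. c * g (z + a))"
proof -
  define K where "K = closure \<Omega>"
  have o\<Omega>: "open \<Omega>" "connected \<Omega>" using dom by (auto simp: domain_def)
  have b\<Omega>: "bounded \<Omega>" using cK closure_subset compact_imp_bounded bounded_subset by metis
  obtain \<rho> N r0 where \<rho>: "has_gradient_on \<rho> N UNIV" "\<Omega> = {x. \<rho> x < 0}" "K = {x. \<rho> x \<le> 0}"
    "\<And>x. \<rho> x = 0 \<Longrightarrow> N x \<noteq> 0" "r0 > 0" "compact {x. \<bar>\<rho> x\<bar> \<le> r0}"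
    using global_defining_function[OF o\<Omega>(1) b\<Omega> ne C1] unfolding K_def by metis
  have \<rho>nz: "\<forall>x. \<rho> x = 0 \<longrightarrow> N x \<noteq> 0" using \<rho>(4) by blast
  obtain \<alpha> r1 where \<alpha>: "\<alpha> > 0" "r1 > 0"
    and iso: "\<forall>D F G. open D \<longrightarrow> (\<forall>x\<in>D. \<rho> x < 0) \<longrightarrow> has_gradient_on F G D \<longrightarrow>
      (\<forall>x. \<rho> x \<le> - r1 \<longrightarrow> x \<in> D \<and> F x < 1) \<longrightarrow> closed {x\<in>D. F x \<le> 1} \<longrightarrow>
      (\<forall>x\<in>D. F x = 1 \<longrightarrow> (\<exists>c>0. norm (G x - c *\<^sub>R N x) \<le> \<alpha> * c)) \<longrightarrow>
      (\<exists>h. ambient_C1_isotopy h {x. \<rho> x < 0} {x\<in>D. F x < 1} \<and>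
         (\<forall>s\<in>{0..1}. \<forall>z. norm (h s z - z) < e))"
    using isotopy_of_close_hypersurface[OF \<rho>(1) \<rho>nz \<rho>(5,6) e] by (elim exE conjE) (rule that)
  have cK': "compact K" using cK by (simp add: K_def)
  obtain \<eta> \<epsilon> \<tau> B where par: "\<eta> > 0" "\<epsilon> > 0" "\<tau> > 0"
    and av: "\<forall>D \<phi> \<Phi>. open D \<longrightarrow> K \<subseteq> D \<longrightarrow> has_gradient_on \<phi> \<Phi> D \<longrightarrow>
      (\<forall>x\<in>K. \<phi> x \<ge> 0) \<longrightarrow> (\<forall>x. cball x \<epsilon> \<subseteq> K \<longrightarrow> \<phi> x \<le> \<tau>) \<longrightarrow>
      (\<forall>x y. x \<in> K \<longrightarrow> y \<notin> K \<longrightarrow> dist x y < \<epsilon> / 2 \<longrightarrow> \<phi> x \<ge> B) \<longrightarrow>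
      (\<exists>I c a. finite (I :: ((complex ^ 'n) \<times> (complex ^ 'n) set) set) \<and> (\<forall>i\<in>I. c i \<ge> 0 \<and> norm (a i) \<le> \<eta>) \<and>
         (\<forall>z. \<rho> z \<le> - r1 \<longrightarrow> z \<in> interior {z. cball z \<eta> \<subseteq> K} \<and> (\<Sum>i\<in>I. c i * \<phi> (z + a i)) < 1) \<and>
         (\<forall>z. cball z \<eta> \<subseteq> K \<longrightarrow> (\<Sum>i\<in>I. c i * \<phi> (z + a i)) \<le> 1 \<longrightarrow> z \<in> interior {z. cball z \<eta> \<subseteq> K}) \<and>
         (\<forall>z. cball z \<eta> \<subseteq> K \<longrightarrow> (\<Sum>i\<in>I. c i * \<phi> (z + a i)) = 1 \<longrightarrow>
            (\<Sum>i\<in>I. c i *\<^sub>R \<Phi> (z + a i)) \<noteq> 0 \<and>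
            (\<exists>k>0. norm ((\<Sum>i\<in>I. c i *\<^sub>R \<Phi> (z + a i)) - k *\<^sub>R N z) \<le> \<alpha> * k)))"
    using averaged_hypersurface[OF \<rho>(1) \<rho>nz cK' \<rho>(3) \<alpha>] by (elim exE conjE) (rule that)
  obtain \<F> \<kappa> where \<F>: "finite \<F>" "\<F> \<subseteq> \<A>" "\<And>x. cball x \<epsilon> \<subseteq> K \<Longrightarrow> (\<Sum>f\<in>\<F>. (norm (f x))\<^sup>2) \<le> \<tau>"
    "\<And>y y'. y \<in> K \<Longrightarrow> y' \<notin> K \<Longrightarrow> dist y y' < \<epsilon> / 2 \<Longrightarrow> B \<le> (\<Sum>f\<in>\<F>. (norm (f y))\<^sup>2)"
    "\<kappa> \<noteq> 0" "\<And>i. (\<lambda>z. \<kappa> * z $ i) \<in> \<F>"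
    using fam[OF par(2,3), of B] unfolding K_def by blast
  have "\<exists>D. open D \<and> K \<subseteq> D \<and> regular_on D g" if "g \<in> \<F>" for g
  proof -
    have "rational_fun_on K g" using rat \<F>(2) that unfolding K_def by blast
    then show ?thesis by (rule rational_fun_imp_regular_open) blast
  qed
  then obtain Dg where Dg: "\<And>g. g \<in> \<F> \<Longrightarrow> open (Dg g)" "\<And>g. g \<in> \<F> \<Longrightarrow> K \<subseteq> Dg g" "\<And>g. g \<in> \<F> \<Longrightarrow> regular_on (Dg g) g"
    by metis
  \<comment> \<open>Finitely many functions have finitely many denominators, so one open
    neighbourhood of \<open>K\<close> avoids all poles.\<close>
  define D where "D = (\<Inter>g\<in>\<F>. Dg g)"
  have D: "open D" "K \<subseteq> D" using Dg(1,2) \<F>(1) unfolding D_def by (auto intro!: open_INT)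
  have Dreg: "regular_on D g" if "g \<in> \<F>" for g
    by (rule regular_on_subset[OF Dg(3)[OF that]]) (use that in \<open>auto simp: D_def\<close>)
  define \<phi> where "\<phi> z = (\<Sum>g\<in>\<F>. (norm (g z))\<^sup>2)" for z
  have "Ck_on 1 (\<lambda>z. sum_of_squares (\<lambda>g. g) \<F> z + 0) D" by (rule Ck_on_sum_of_squares[OF D(1) Dreg])
  then have "Ck_on 1 \<phi> D" by (simp add: sum_of_squares_def \<phi>_def[abs_def])
  from C_on_1_imp_gradient[OF this] obtain \<Phi> where \<Phi>: "has_gradient_on \<phi> \<Phi> D" by blast
  have \<phi>0: "\<phi> z \<ge> 0" for z unfolding \<phi>_def by (intro sum_nonneg) simp
  define C where "C = {z. cball z \<eta> \<subseteq> K}"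
  have "\<exists>I c a. finite (I :: ((complex ^ 'n) \<times> (complex ^ 'n) set) set) \<and> (\<forall>i\<in>I. c i \<ge> 0 \<and> norm (a i) \<le> \<eta>) \<and>
         (\<forall>z. \<rho> z \<le> - r1 \<longrightarrow> z \<in> interior C \<and> (\<Sum>i\<in>I. c i * \<phi> (z + a i)) < 1) \<and>
         (\<forall>z. cball z \<eta> \<subseteq> K \<longrightarrow> (\<Sum>i\<in>I. c i * \<phi> (z + a i)) \<le> 1 \<longrightarrow> z \<in> interior C) \<and>
         (\<forall>z. cball z \<eta> \<subseteq> K \<longrightarrow> (\<Sum>i\<in>I. c i * \<phi> (z + a i)) = 1 \<longrightarrow>
            (\<Sum>i\<in>I. c i *\<^sub>R \<Phi> (z + a i)) \<noteq> 0 \<and>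
            (\<exists>k>0. norm ((\<Sum>i\<in>I. c i *\<^sub>R \<Phi> (z + a i)) - k *\<^sub>R N z) \<le> \<alpha> * k))"
    unfolding C_def
  proof (rule av[rule_format, OF D(1,2) \<Phi> \<phi>0])
    show "\<phi> x \<le> \<tau>" if "cball x \<epsilon> \<subseteq> K" for x using \<F>(3)[OF that] by (simp add: \<phi>_def)
    show "B \<le> \<phi> x" if "x \<in> K" "y \<notin> K" "dist x y < \<epsilon> / 2" for x y
      using \<F>(4)[OF that] by (simp add: \<phi>_def)
  qed
  then obtain I c a where I0: "finite (I :: ((complex ^ 'n) \<times> (complex ^ 'n) set) set) \<and> (\<forall>i\<in>I. c i \<ge> 0 \<and> norm (a i) \<le> \<eta>) \<and>
         (\<forall>z. \<rho> z \<le> - r1 \<longrightarrow> z \<in> interior C \<and> (\<Sum>i\<in>I. c i * \<phi> (z + a i)) < 1) \<and>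
         (\<forall>z. cball z \<eta> \<subseteq> K \<longrightarrow> (\<Sum>i\<in>I. c i * \<phi> (z + a i)) \<le> 1 \<longrightarrow> z \<in> interior C) \<and>
         (\<forall>z. cball z \<eta> \<subseteq> K \<longrightarrow> (\<Sum>i\<in>I. c i * \<phi> (z + a i)) = 1 \<longrightarrow>
            (\<Sum>i\<in>I. c i *\<^sub>R \<Phi> (z + a i)) \<noteq> 0 \<and>
            (\<exists>k>0. norm ((\<Sum>i\<in>I. c i *\<^sub>R \<Phi> (z + a i)) - k *\<^sub>R N z) \<le> \<alpha> * k))"
    by (elim exE) (rule that)
  have I: "finite I" "\<And>i. i \<in> I \<Longrightarrow> c i \<ge> 0" "\<And>i. i \<in> I \<Longrightarrow> norm (a i) \<le> \<eta>"
    "\<And>z. \<rho> z \<le> - r1 \<Longrightarrow> z \<in> interior C \<and> (\<Sum>i\<in>I. c i * \<phi> (z + a i)) < 1"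
    using I0 by blast+
  have I5: "z \<in> interior C" if "z \<in> C" "(\<Sum>i\<in>I. c i * \<phi> (z + a i)) \<le> 1" for z
    using I0 that by (simp add: C_def)
  have I6: "(\<Sum>i\<in>I. c i *\<^sub>R \<Phi> (z + a i)) \<noteq> 0 \<and>
      (\<exists>k>0. norm ((\<Sum>i\<in>I. c i *\<^sub>R \<Phi> (z + a i)) - k *\<^sub>R N z) \<le> \<alpha> * k)"
    if "z \<in> C" "(\<Sum>i\<in>I. c i * \<phi> (z + a i)) = 1" for z
    using I0 that by (simp add: C_def)
  define F where "F z = (\<Sum>i\<in>I. c i * \<phi> (z + a i))" for z
  define G where "G z = (\<Sum>i\<in>I. c i *\<^sub>R \<Phi> (z + a i))" for z
  \<comment> \<open>The square root of the quadrature weight is absorbed, which makes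
    \<open>F\<close> a sum of squares.\<close>
  define f where "f l = (\<lambda>z. complex_of_real (sqrt (c (fst l))) * (snd l) (z + a (fst l)))"
    for l :: "((complex ^ 'n) \<times> (complex ^ 'n) set) \<times> (complex ^ 'n \<Rightarrow> complex)"
  define \<Lambda> where "\<Lambda> = I \<times> \<F>"
  have CK: "z + a i \<in> K" if "z \<in> C" "i \<in> I" for z i
    using that I(3)[OF that(2)] by (auto simp: C_def dist_norm subset_iff)
  have FS: "F z = sum_of_squares f \<Lambda> z" for z
  proof -
    have "sum_of_squares f \<Lambda> z = (\<Sum>i\<in>I. \<Sum>g\<in>\<F>. (norm (f (i, g) z))\<^sup>2)"
      unfolding sum_of_squares_def \<Lambda>_def sum.cartesian_product by (simp add: case_prod_beta)
    also have "\<dots> = (\<Sum>i\<in>I. \<Sum>g\<in>\<F>. c i * (norm (g (z + a i)))\<^sup>2)"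
      by (intro sum.cong refl) (use I(2) in \<open>simp add: f_def norm_mult power_mult_distrib\<close>)
    finally show ?thesis by (simp add: F_def \<phi>_def sum_distrib_left)
  qed
  \<comment> \<open>The isotopy lemma wants an open set; by \<open>I5\<close> the sublevel set loses
    nothing in the passage to the interior.\<close>
  define D0 where "D0 = interior C"
  have D0: "open D0" "D0 \<subseteq> C" by (auto simp: D0_def interior_subset)
  have gF: "has_gradient_on F G V" if "V \<subseteq> C" for V
    unfolding F_def G_def
    by (intro has_gradient_on_sum has_gradient_on_cmult has_gradient_on_subset[OF has_gradient_on_shift[OF \<Phi>]])
       (use CK that D(2) in blast)
  have cF: "continuous_on C F" using has_gradient_on_continuous(1)[OF gF[OF order_refl]] .
  have clC: "closed C" unfolding C_def using cK' par(1) by (intro closed_cball_subset compact_imp_closed) auto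
  have neg: "\<rho> x < 0" if "x \<in> C" for x
    by (rule cball_subset_imp_neg[OF \<rho>(1,4) _ par(1)]) (use that in \<open>auto simp: C_def \<rho>(3)\<close>)
  have sub1: "{x\<in>D0. F x \<le> 1} = {x\<in>C. F x \<le> 1}"
    using D0(2) I5 unfolding F_def D0_def by blast
  have cl1: "closed {x\<in>C. F x \<le> 1}"
  proof -
    have "{x\<in>C. F x \<le> 1} = C \<inter> F -` {..1}" by auto
    then show ?thesis using continuous_closed_preimage[OF cF clC closed_atMost[of 1]] by simp
  qed
  define \<Omega>' where "\<Omega>' = {x\<in>D0. F x < 1}"
  have "\<exists>h. ambient_C1_isotopy h {x. \<rho> x < 0} {x\<in>D0. F x < 1} \<and> (\<forall>s\<in>{0..1}. \<forall>z. norm (h s z - z) < e)"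
  proof (rule iso[rule_format, OF D0(1) _ gF[OF D0(2)]])
    show "\<rho> x < 0" if "x \<in> D0" for x using neg that D0(2) by blast
    show "x \<in> D0 \<and> F x < 1" if "\<rho> x \<le> - r1" for x using I(4)[OF that] by (simp add: F_def D0_def)
    show "closed {x\<in>D0. F x \<le> 1}" using cl1 sub1 by simp
    show "\<exists>k>0. norm (G x - k *\<^sub>R N x) \<le> \<alpha> * k" if "x \<in> D0" "F x = 1" for x
      using I6[of x] that D0(2) unfolding F_def G_def by blast
  qed
  then obtain h where h: "ambient_C1_isotopy h \<Omega> \<Omega>'" "\<forall>s\<in>{0..1}. \<forall>z. norm (h s z - z) < e"
    unfolding \<Omega>'_def \<rho>(2) by blast
  have im: "h 1 ` \<Omega> = \<Omega>'" and diff: "C1_diffeomorphism (h 1)" using h(1) by (auto simp: ambient_C1_isotopy_def)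
  have "enat 0 \<le> 1" by (simp add: zero_enat_def[symmetric])
  then have "Ck_on 0 (h 1) UNIV" using diff unfolding C1_diffeomorphism_def C_on_def by blast
  then have ch: "continuous_on \<Omega> (h 1)" using continuous_on_subset by auto
  have o\<Omega>': "open \<Omega>'"
  proof -
    have "\<Omega>' = F -` {..<1} \<inter> D0" by (auto simp: \<Omega>'_def)
    then show ?thesis
      using iffD1[OF continuous_on_open_vimage[OF D0(1)] continuous_on_subset[OF cF D0(2)]] open_lessThan by metis
  qed
  have dom': "domain \<Omega>'" unfolding domain_def using o\<Omega>' connected_continuous_image[OF ch o\<Omega>(2)] im by simp
  have sub: "\<Omega>' \<subseteq> \<Omega>" using neg D0(2) unfolding \<Omega>'_def \<rho>(2) by blast
  \<comment> \<open>Where the gradient is nonzero, \<open>F - 1\<close> is a smooth local defining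
    function; by \<open>I6\<close> this covers the whole level 1.\<close>
  define U where "U = {z\<in>D0. G z \<noteq> 0}"
  have oU: "open U"
  proof -
    have "U = G -` (- {0}) \<inter> D0" by (auto simp: U_def)
    then show ?thesis
      using iffD1[OF continuous_on_open_vimage[OF D0(1)] has_gradient_on_continuous(2)[OF gF[OF D0(2)]]]
      by (simp add: open_Compl)
  qed
  have UC: "U \<subseteq> C" using D0(2) by (auto simp: U_def)
  have inU: "p \<in> U" if "p \<in> D0" "F p = 1" for p
    using I6[of p] that D0(2) unfolding U_def F_def G_def by blast
  have reg: "regular_on U (f l)" if "l \<in> \<Lambda>" for l
    unfolding f_def
  proof (intro regular_on_cmult regular_on_shift)
    show "regular_on D (snd l)" using Dreg that by (auto simp: \<Lambda>_def)
    show "z + a (fst l) \<in> D" if z: "z \<in> U" for z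
    proof -
      have "z \<in> C" "fst l \<in> I" using z UC \<open>l \<in> \<Lambda>\<close> by (auto simp: \<Lambda>_def)
      then show ?thesis using CK D(2) by blast
    qed
  qed
  define \<rho>' where "\<rho>' z = sum_of_squares f \<Lambda> z + (- 1)" for z
  have \<rho>'F: "\<rho>' z = F z - 1" for z by (simp add: \<rho>'_def FS)
  have g\<rho>': "has_gradient_on \<rho>' G U"
    using has_gradient_on_diff[OF gF[OF UC] has_gradient_on_const[of 1 U]] by (simp add: \<rho>'F[abs_def])
  have \<Omega>'U: "\<Omega>' \<inter> U = {z\<in>U. \<rho>' z < 0}" by (auto simp: \<Omega>'_def U_def \<rho>'F)
  have ldf: "local_defining_function \<infinity> \<Omega>' p U \<rho>'" if "p \<in> U" for p
    unfolding local_defining_function_def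
  proof (intro conjI ballI oU that \<Omega>'U)
    show "C_on \<infinity> \<rho>' U" unfolding C_on_def \<rho>'_def[abs_def] by (intro allI impI Ck_on_sum_of_squares[OF oU reg])
    fix z assume z: "z \<in> U"
    have "frechet_derivative \<rho>' (at z) = (\<lambda>v. G z \<bullet> v)"
      by (rule frechet_derivative_at[symmetric, OF has_gradient_onD[OF g\<rho>' z]])
    moreover have "G z \<bullet> G z \<noteq> 0" using z by (simp add: U_def)
    ultimately show "frechet_derivative \<rho>' (at z) \<noteq> (\<lambda>v. 0)" by (auto dest: fun_cong[of _ _ "G z"])
  qed
  have clsub: "closure \<Omega>' \<subseteq> {x\<in>D0. F x \<le> 1}"
  proof (rule closure_minimal)
    show "\<Omega>' \<subseteq> {x\<in>D0. F x \<le> 1}" by (auto simp: \<Omega>'_def)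
    show "closed {x\<in>D0. F x \<le> 1}" unfolding sub1 by (rule cl1)
  qed
  have fr: "p \<in> D0" "F p = 1" if "p \<in> frontier \<Omega>'" for p
  proof -
    have "p \<in> closure \<Omega>'" "p \<notin> \<Omega>'" using that o\<Omega>' by (auto simp: frontier_def interior_open)
    then show "p \<in> D0" "F p = 1" using clsub by (auto simp: \<Omega>'_def)
  qed
  \<comment> \<open>A nonzero gradient on the level 1 makes each of its points a limit of
    \<open>\<Omega>'\<close>, so the level has no isolated or flat pieces outside the
    closure.\<close>
  have cl\<Omega>': "closure \<Omega>' = {x\<in>C. F x \<le> 1}"
  proof -
    have "x \<in> closure \<Omega>'" if x: "x \<in> D0" "F x \<le> 1" for x
    proof (cases "F x = 1")
      case True
      have "x \<in> frontier \<Omega>'"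
        using frontier_pos_neg(2)[OF oU g\<rho>' _ \<Omega>'U inU[OF x(1) True]] True by (auto simp: U_def \<rho>'F)
      then show ?thesis by (simp add: frontier_def)
    next
      case False
      then have "x \<in> \<Omega>'" using x by (simp add: \<Omega>'_def)
      then show ?thesis using closure_subset by blast
    qed
    then show ?thesis using clsub sub1 by blast
  qed
  have sb: "smoothly_bounded \<Omega>'"
    unfolding smoothly_bounded_def has_C_boundary_def
    using bounded_subset[OF b\<Omega> sub] ldf inU fr by blast
  have sp: "strictly_pseudoconvex \<Omega>'"
    unfolding strictly_pseudoconvex_def
  proof (intro ballI exI conjI impI)
    fix p assume p: "p \<in> frontier \<Omega>'"
    have pU: "p \<in> U" using inU fr[OF p] by blast
    show "local_defining_function \<infinity> \<Omega>' p U \<rho>'" by (rule ldf[OF pU])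
    fix v :: "complex ^ 'n" assume v: "v \<noteq> 0"
    \<comment> \<open>If all weights vanished, \<open>F\<close> would be 0 on the frontier instead
      of 1. A positive weight keeps the coordinate functions among the squares.\<close>
    have "\<exists>i0\<in>I. c i0 > 0"
    proof (rule ccontr)
      assume "\<not> (\<exists>i0\<in>I. c i0 > 0)"
      then have "c i = 0" if "i \<in> I" for i using I(2)[OF that] that by force
      then have "F p = 0" by (simp add: F_def)
      with fr[OF p] show False by simp
    qed
    then obtain i0 where i0: "i0 \<in> I" "c i0 > 0" by blast
    have coord: "\<exists>l\<in>\<Lambda>. \<exists>\<kappa> b. \<kappa> \<noteq> 0 \<and> f l = (\<lambda>z. \<kappa> * (z $ i + b))" for i
    proof (rule bexI[of _ "(i0, \<lambda>z. \<kappa> * z $ i)"])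
      show "\<exists>\<kappa>' b. \<kappa>' \<noteq> 0 \<and> f (i0, \<lambda>z. \<kappa> * z $ i) = (\<lambda>z. \<kappa>' * (z $ i + b))"
        by (rule exI[of _ "complex_of_real (sqrt (c i0)) * \<kappa>"], rule exI[of _ "a i0 $ i"])
           (use i0 \<F>(5) in \<open>auto simp: f_def\<close>)
      show "(i0, \<lambda>z. \<kappa> * z $ i) \<in> \<Lambda>" using i0 \<F>(6) by (simp add: \<Lambda>_def)
    qed
    have "finite \<Lambda>" using I(1) \<F>(1) by (simp add: \<Lambda>_def)
    then show "Re (levi_form \<rho>' p v) > 0"
      unfolding \<rho>'_def[abs_def] by (rule levi_form_pos[OF oU pU _ reg coord v])
  qed
  show ?thesis
  proof (rule that[OF h dom' sb sp sub _ par(1)])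
    show "\<Omega>' \<noteq> {}" using im ne by blast
    show "closure \<Omega>' = {z. cball z \<eta> \<subseteq> closure \<Omega> \<and> sum_of_squares f \<Lambda> z \<le> 1}"
      unfolding cl\<Omega>' FS C_def K_def by blast
    show "\<exists>g\<in>\<A>. \<exists>c a. norm a \<le> \<eta> \<and> f l = (\<lambda>z. c * g (z + a))" if "l \<in> \<Lambda>" for l
    proof -
      have "snd l \<in> \<A>" "norm (a (fst l)) \<le> \<eta>" using that \<F>(2) I(3) by (auto simp: \<Lambda>_def)
      then show ?thesis unfolding f_def by blast
    qed
  qed
qed

text \<open>\<open>domain\<close> admits the empty set. It is treated apart by the constant isotopy,
  because the global defining function starts from a nonempty boundary.\<close>

lemma empty_domain:
  fixes \<Omega> :: "(complex ^ 'n::finite) set"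
  assumes "\<Omega> = {}" "e > 0"
  shows "ambient_C1_isotopy (\<lambda>s z. z) \<Omega> \<Omega>" "\<forall>s\<in>{0..1::real}. \<forall>z::complex ^ 'n. norm (z - z) < e"
    "domain \<Omega>" "smoothly_bounded \<Omega>" "strictly_pseudoconvex \<Omega>"
proof -
  have "ambient_C1_isotopy (\<lambda>s x. x + s *\<^sub>R (0 :: complex ^ 'n)) \<Omega> \<Omega>"
    by (rule small_isotopy[where g' = "\<lambda>x v. 0"]) auto
  then show "ambient_C1_isotopy (\<lambda>s z. z) \<Omega> \<Omega>" by simp
qed (use assms in \<open>auto simp: domain_def smoothly_bounded_def has_C_boundary_def strictly_pseudoconvex_def\<close>)

theorem theorem2p11:
  fixes \<Omega> :: "(complex ^ 'n::finite) set"
  assumes "domain \<Omega>" and "has_C_boundary 1 \<Omega>"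
  shows "(polynomially_convex (closure \<Omega>) \<longrightarrow>
            (\<forall>\<epsilon>>0. \<exists>\<Omega>' h.
               ambient_C1_isotopy h \<Omega> \<Omega>' \<and> (\<forall>s\<in>{0..1}. \<forall>z. norm (h s z - z) < \<epsilon>) \<and>
               domain \<Omega>' \<and> smoothly_bounded \<Omega>' \<and> strictly_pseudoconvex \<Omega>' \<and> \<Omega>' \<subseteq> \<Omega> \<and>
               polynomially_convex (closure \<Omega>'))) \<and>
         (rationally_convex (closure \<Omega>) \<longrightarrow>
            (\<forall>\<epsilon>>0. \<exists>\<Omega>' h.
               ambient_C1_isotopy h \<Omega> \<Omega>' \<and> (\<forall>s\<in>{0..1}. \<forall>z. norm (h s z - z) < \<epsilon>) \<and>
               domain \<Omega>' \<and> smoothly_bounded \<Omega>' \<and> strictly_pseudoconvex \<Omega>' \<and> \<Omega>' \<subseteq> \<Omega> \<and>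
               rationally_convex (closure \<Omega>')))"
proof (intro conjI impI allI)
  fix \<epsilon> :: real
  assume K: "polynomially_convex (closure \<Omega>)" and \<epsilon>: "\<epsilon> > 0"
  show "\<exists>\<Omega>' h. ambient_C1_isotopy h \<Omega> \<Omega>' \<and> (\<forall>s\<in>{0..1}. \<forall>z. norm (h s z - z) < \<epsilon>) \<and>
               domain \<Omega>' \<and> smoothly_bounded \<Omega>' \<and> strictly_pseudoconvex \<Omega>' \<and> \<Omega>' \<subseteq> \<Omega> \<and>
               polynomially_convex (closure \<Omega>')"
  proof (cases "\<Omega> = {}")
    case True
    show ?thesis using empty_domain[OF True \<epsilon>] K by blast
  next
    case False
    have cK: "compact (closure \<Omega>)" using K by (simp add: polynomially_convex_def)
    have fam: "\<exists>\<F> \<kappa>. finite \<F> \<and> \<F> \<subseteq> Collect polynomial_fun \<and>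
      (\<forall>x. cball x \<delta> \<subseteq> closure \<Omega> \<longrightarrow> (\<Sum>f\<in>\<F>. (norm (f x))\<^sup>2) \<le> \<tau>) \<and>
      (\<forall>y y'. y \<in> closure \<Omega> \<longrightarrow> y' \<notin> closure \<Omega> \<longrightarrow> dist y y' < \<delta> / 2 \<longrightarrow> B \<le> (\<Sum>f\<in>\<F>. (norm (f y))\<^sup>2)) \<and>
      \<kappa> \<noteq> 0 \<and> (\<forall>i. (\<lambda>z. \<kappa> * z $ i) \<in> \<F>)" if "\<delta> > 0" "\<tau> > 0" for \<delta> \<tau> B
      by (rule exhausting_family[OF cK _ _ _ polynomial_separation_near_boundary[OF K] that, where B = B])
         (simp add: polynomial_fun_continuous, simp add: polynomial_fun_cmult_power, simp add: polynomial_fun.coord, assumption+, blast)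
    have rat: "rational_fun_on (closure \<Omega>) f" if "f \<in> Collect polynomial_fun" for f
      using that polynomial_imp_rational by blast
    obtain \<Omega>' h \<eta> f and \<Lambda> :: "(((complex ^ 'n) \<times> (complex ^ 'n) set) \<times> (complex ^ 'n \<Rightarrow> complex)) set"
      where \<Omega>': "ambient_C1_isotopy h \<Omega> \<Omega>'" "\<forall>s\<in>{0..1}. \<forall>z. norm (h s z - z) < \<epsilon>" "domain \<Omega>'" "smoothly_bounded \<Omega>'"
        "strictly_pseudoconvex \<Omega>'" "\<Omega>' \<subseteq> \<Omega>" "\<Omega>' \<noteq> {}" "\<eta> > 0"
        "closure \<Omega>' = {z. cball z \<eta> \<subseteq> closure \<Omega> \<and> sum_of_squares f \<Lambda> z \<le> 1}"
        "\<And>l. l \<in> \<Lambda> \<Longrightarrow> \<exists>g\<in>Collect polynomial_fun. \<exists>c a. norm a \<le> \<eta> \<and> f l = (\<lambda>z. c * g (z + a))"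
    proof (rule pseudoconvex_approximation[where \<A> = "Collect polynomial_fun", OF assms cK False \<epsilon>], goal_cases)
      case (1 f) show ?case by (rule rat[OF 1(2)])
    next
      case (2 \<delta> \<tau> B) show ?case by (rule fam[OF 2(2,3)])
    next
      case (3 \<Omega>' h \<eta> \<Lambda> f) show ?case by (rule that[OF 3(2-11)])
    qed
    have "polynomially_convex (closure \<Omega>')"
    proof (rule polynomially_convex_sublevel[OF K _ \<Omega>'(9) _ _ \<Omega>'(8)])
      show "polynomial_fun (f l)" if "l \<in> \<Lambda>" for l
        using \<Omega>'(10)[OF that] polynomial_fun_cmult polynomial_fun_shift by force
      show "compact (closure \<Omega>')" using \<Omega>'(4) by (simp add: smoothly_bounded_def)
      show "closure \<Omega>' \<noteq> {}" using \<Omega>'(7) by simp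
    qed
    with \<Omega>'(1-6) show ?thesis by blast
  qed
next
  fix \<epsilon> :: real
  assume K: "rationally_convex (closure \<Omega>)" and \<epsilon>: "\<epsilon> > 0"
  show "\<exists>\<Omega>' h. ambient_C1_isotopy h \<Omega> \<Omega>' \<and> (\<forall>s\<in>{0..1}. \<forall>z. norm (h s z - z) < \<epsilon>) \<and>
               domain \<Omega>' \<and> smoothly_bounded \<Omega>' \<and> strictly_pseudoconvex \<Omega>' \<and> \<Omega>' \<subseteq> \<Omega> \<and>
               rationally_convex (closure \<Omega>')"
  proof (cases "\<Omega> = {}")
    case True
    show ?thesis using empty_domain[OF True \<epsilon>] K by blast
  next
    case False
    have cK: "compact (closure \<Omega>)" using K by (simp add: rationally_convex_def)
    have fam: "\<exists>\<F> \<kappa>. finite \<F> \<and> \<F> \<subseteq> Collect (rational_fun_on (closure \<Omega>)) \<and>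
      (\<forall>x. cball x \<delta> \<subseteq> closure \<Omega> \<longrightarrow> (\<Sum>f\<in>\<F>. (norm (f x))\<^sup>2) \<le> \<tau>) \<and>
      (\<forall>y y'. y \<in> closure \<Omega> \<longrightarrow> y' \<notin> closure \<Omega> \<longrightarrow> dist y y' < \<delta> / 2 \<longrightarrow> B \<le> (\<Sum>f\<in>\<F>. (norm (f y))\<^sup>2)) \<and>
      \<kappa> \<noteq> 0 \<and> (\<forall>i. (\<lambda>z. \<kappa> * z $ i) \<in> \<F>)" if "\<delta> > 0" "\<tau> > 0" for \<delta> \<tau> B
      by (rule exhausting_family[OF cK _ _ _ rational_separation_near_boundary[OF K] that, where B = B])
         (simp add: rational_fun_on_continuous, simp add: rational_fun_on_cmult_power, simp add: polynomial_imp_rational polynomial_fun.coord, assumption+, blast)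
    obtain \<Omega>' h \<eta> f and \<Lambda> :: "(((complex ^ 'n) \<times> (complex ^ 'n) set) \<times> (complex ^ 'n \<Rightarrow> complex)) set"
      where \<Omega>': "ambient_C1_isotopy h \<Omega> \<Omega>'" "\<forall>s\<in>{0..1}. \<forall>z. norm (h s z - z) < \<epsilon>" "domain \<Omega>'" "smoothly_bounded \<Omega>'"
        "strictly_pseudoconvex \<Omega>'" "\<Omega>' \<subseteq> \<Omega>" "\<Omega>' \<noteq> {}" "\<eta> > 0"
        "closure \<Omega>' = {z. cball z \<eta> \<subseteq> closure \<Omega> \<and> sum_of_squares f \<Lambda> z \<le> 1}"
        "\<And>l. l \<in> \<Lambda> \<Longrightarrow> \<exists>g\<in>Collect (rational_fun_on (closure \<Omega>)). \<exists>c a. norm a \<le> \<eta> \<and> f l = (\<lambda>z. c * g (z + a))"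
    proof (rule pseudoconvex_approximation[where \<A> = "Collect (rational_fun_on (closure \<Omega>))", OF assms cK False \<epsilon>], goal_cases)
      case (1 f) show ?case by (rule CollectD[OF 1(2)])
    next
      case (2 \<delta> \<tau> B) show ?case by (rule fam[OF 2(2,3)])
    next
      case (3 \<Omega>' h \<eta> \<Lambda> f) show ?case by (rule that[OF 3(2-11)])
    qed
    have "rationally_convex (closure \<Omega>')"
    proof (rule rationally_convex_sublevel[OF K _ \<Omega>'(9) _ _ \<Omega>'(8)])
      \<comment> \<open>For \<open>z\<close> in the core and \<open>norm a \<le> \<eta>\<close> the
        point \<open>z + a\<close> lies in the closure of \<Omega>, where \<open>g\<close> has no
        poles.\<close>
      show "regular_on {z. cball z \<eta> \<subseteq> closure \<Omega>} (f l)" if l: "l \<in> \<Lambda>" for l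
        using \<Omega>'(10)[OF l]
      proof (elim bexE exE conjE)
        fix g c a
        assume gA: "g \<in> Collect (rational_fun_on (closure \<Omega>))" and g: "norm a \<le> \<eta>" "f l = (\<lambda>z. c * g (z + a))"
        have gr: "rational_fun_on (closure \<Omega>) g" using gA by simp
        obtain D where D: "closure \<Omega> \<subseteq> D" "regular_on D g" using rational_fun_imp_regular_open[OF gr] by blast
        show ?thesis
          unfolding g(2)
          by (intro regular_on_cmult regular_on_shift[OF D(2)]) (use D(1) g(1) in \<open>auto simp: dist_norm subset_iff\<close>)
      qed
      show "compact (closure \<Omega>')" using \<Omega>'(4) by (simp add: smoothly_bounded_def)
      show "closure \<Omega>' \<noteq> {}" using \<Omega>'(7) by simp
    qed
    with \<Omega>'(1-6) show ?thesis by blast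
  qed
qed

end
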